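(* Let $A$ be a commutative unitary ring, $R = A[q,q^{-1}]$, $M = A[[q,q^{-1}]]$, and let $(C^*,d^* )$ be a well filtered complex of $R$-modules. Let $C^*_M = C^*\otimes_R M$ with the induced grading and coboundary. Then there is an isomorphism $$H^{*+1}(C^* ) \simeq H^{*}(C^*_M),$$ i.e. $H^{i+1}(C^* )\simeq H^i(C^*_M)$ for every integer $i$.
   Context: Here $R=A[q,q^{-1}]$ is the ring of Laurent polynomials over $A$, and $M=A[[q,q^{-1}]]$ is the $R$-module of all formal bi-infinite series $\sum_{i\in\mathbb{Z}}a_iq^i$, $a_i\in A$. Cochain complexes $(C^*,d^* )$ are graded complexes with $C^*$ an $R$-module and $d^*$ an $R$-linear map raising degree by one. Induced differential: if $C_3\subset C_2\subset C_1$ are graded complexes such that the induced coboundaries on $C_1/C_2$ and $C_2/C_3$ vanish (e.g. each of these quotients is concentrated in a single degree), so that $H^*(C_1/C_2)=C_1/C_2$ and $H^*(C_2/C_3)=C_2/C_3$, the induced differential $\overline d: C_1/C_2\to C_2/C_3$ is the connecting map of the long exact cohomology sequence of $0\to C_2/C_3\to C_1/C_3\to C_1/C_2\to 0$. Well filtered complex (recursive definition): the complex $(C^*,d^* )$ is well filtered if $C^*$ is a free finitely generated $R$-module, $C^*\neq R$ (i.e. the underlying module is not free of rank one), and, if $C^*\ne\{0\}$, there are a decreasing filtration $F$ and an integer $n>0$ such that: (a) $C^*$ is a filtered complex with the decreasing filtration $F$, compatible with the coboundary map $d^*$ (each $F_iC$ is a graded subcomplex), with $F_0C=C^*$ and $F_{n+1}C=\{0\}$;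 (b) $F_nC=(F_nC)^n\simeq F_{n-1}C/F_nC=(F_{n-1}C/F_nC)^{n-1}\simeq R$ (that is, $F_nC$ is concentrated in degree $n$, $F_{n-1}C/F_nC$ is concentrated in degree $n-1$, and both are isomorphic to $R$); (c) the induced differential $\overline d:F_{n-1}C/F_nC\to F_nC/F_{n+1}C$ corresponds to multiplication by a non-zero polynomial $p\in R$ whose first and last non-zero coefficients are invertible in $A$; (d) for every integer $i\neq n-1,n$, the induced complex $((F_iC/F_{i+1}C)^*,d_i^* )$ is a well filtered complex. *)

theory Defs
  imports "HOL.Hull" "HOL-Algebra.Module" "HOL-Algebra.QuotRing"
begin

section \<open>Modules: homomorphisms, quotients, freeness\<close>

definition module_hom ::
    "('r, 'm) ring_scheme \<Rightarrow> ('r, 'b, 'n) module_scheme \<Rightarrow> ('r, 'c, 'k) module_scheme \<Rightarrow> ('b \<Rightarrow> 'c) set"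
  where "module_hom R M N =
    {f \<in> carrier M \<rightarrow> carrier N.
       (\<forall>x\<in>carrier M. \<forall>y\<in>carrier M. f (x \<oplus>\<^bsub>M\<^esub> y) = f x \<oplus>\<^bsub>N\<^esub> f y) \<and>
       (\<forall>r\<in>carrier R. \<forall>x\<in>carrier M. f (r \<odot>\<^bsub>M\<^esub> x) = r \<odot>\<^bsub>N\<^esub> f x)}"

definition module_iso ::
    "('r, 'm) ring_scheme \<Rightarrow> ('r, 'b, 'n) module_scheme \<Rightarrow> ('r, 'c, 'k) module_scheme \<Rightarrow> ('b \<Rightarrow> 'c) set"
  where "module_iso R M N = {f \<in> module_hom R M N. bij_betw f (carrier M) (carrier N)}"

definition modules_isomorphic ::
    "('r, 'm) ring_scheme \<Rightarrow> ('r, 'b, 'n) module_scheme \<Rightarrow> ('r, 'c, 'k) module_scheme \<Rightarrow> bool"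
  where "modules_isomorphic R M N \<longleftrightarrow> module_iso R M N \<noteq> {}"

text \<open>The fields \<^const>\<open>mult\<close> and \<^const>\<open>one\<close> that a module record inherits from rings
  play no role for modules and are left unspecified.\<close>

definition quotient_module ::
    "('r, 'b, 'n) module_scheme \<Rightarrow> 'b set \<Rightarrow> ('r, 'b set) module"
  where "quotient_module M N =
    \<lparr>carrier = a_rcosets\<^bsub>M\<^esub> N, mult = undefined, one = undefined, zero = N, add = set_add M,
     smult = (\<lambda>r X. ((\<lambda>x. r \<odot>\<^bsub>M\<^esub> x) ` X) <+>\<^bsub>M\<^esub> N)\<rparr>"

definition regular_module :: "('r, 'm) ring_scheme \<Rightarrow> ('r, 'r) module"
  where "regular_module R =
    \<lparr>carrier = carrier R, mult = mult R, one = one R, zero = zero R, add = add R, smult = mult R\<rparr>"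

definition free_finitely_generated ::
    "('r, 'm) ring_scheme \<Rightarrow> ('r, 'b, 'n) module_scheme \<Rightarrow> bool"
  where "free_finitely_generated R M \<longleftrightarrow> module R M \<and>
    (\<exists>B. finite B \<and> B \<subseteq> carrier M \<and>
       (\<forall>x\<in>carrier M. \<exists>!a. a \<in> B \<rightarrow>\<^sub>E carrier R \<and> x = (\<Oplus>\<^bsub>M\<^esub>b\<in>B. a b \<odot>\<^bsub>M\<^esub> b)))"


section \<open>Tensor products over a commutative ring\<close>

definition free_module :: "('r, 'm) ring_scheme \<Rightarrow> 's set \<Rightarrow> ('r, 's \<Rightarrow> 'r) module"
  where "free_module R S =
    \<lparr>carrier = {f. (\<forall>s. f s \<in> carrier R) \<and> finite {s. f s \<noteq> \<zero>\<^bsub>R\<^esub>} \<and> {s. f s \<noteq> \<zero>\<^bsub>R\<^esub>} \<subseteq> S},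
     mult = undefined, one = undefined,
     zero = (\<lambda>s. \<zero>\<^bsub>R\<^esub>), add = (\<lambda>f g s. f s \<oplus>\<^bsub>R\<^esub> g s), smult = (\<lambda>r f s. r \<otimes>\<^bsub>R\<^esub> f s)\<rparr>"

definition free_gen :: "('r, 'm) ring_scheme \<Rightarrow> 's \<Rightarrow> 's \<Rightarrow> 'r"
  where "free_gen R s = (\<lambda>t. if t = s then \<one>\<^bsub>R\<^esub> else \<zero>\<^bsub>R\<^esub>)"

definition module_span ::
    "('r, 'm) ring_scheme \<Rightarrow> ('r, 'b, 'n) module_scheme \<Rightarrow> 'b set \<Rightarrow> 'b set"
  where "module_span R M S = (\<lambda>N. submodule N R M) hull S"

definition tensor_relations ::
    "('r, 'm) ring_scheme \<Rightarrow> ('r, 'b, 'n) module_scheme \<Rightarrow> ('r, 'c, 'k) module_scheme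
       \<Rightarrow> ('b \<times> 'c \<Rightarrow> 'r) set"
  where "tensor_relations R M N =
    (let F = free_module R (carrier M \<times> carrier N); e = (\<lambda>x y. free_gen R (x, y)) in
     module_span R F
       ({e (x \<oplus>\<^bsub>M\<^esub> x') y \<ominus>\<^bsub>F\<^esub> (e x y \<oplus>\<^bsub>F\<^esub> e x' y) | x x' y.
           x \<in> carrier M \<and> x' \<in> carrier M \<and> y \<in> carrier N}
      \<union> {e x (y \<oplus>\<^bsub>N\<^esub> y') \<ominus>\<^bsub>F\<^esub> (e x y \<oplus>\<^bsub>F\<^esub> e x y') | x y y'.
           x \<in> carrier M \<and> y \<in> carrier N \<and> y' \<in> carrier N}
      \<union> {e (r \<odot>\<^bsub>M\<^esub> x) y \<ominus>\<^bsub>F\<^esub> r \<odot>\<^bsub>F\<^esub> e x y | r x y.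
           r \<in> carrier R \<and> x \<in> carrier M \<and> y \<in> carrier N}
      \<union> {e x (r \<odot>\<^bsub>N\<^esub> y) \<ominus>\<^bsub>F\<^esub> r \<odot>\<^bsub>F\<^esub> e x y | r x y.
           r \<in> carrier R \<and> x \<in> carrier M \<and> y \<in> carrier N}))"

definition tensor_product ::
    "('r, 'm) ring_scheme \<Rightarrow> ('r, 'b, 'n) module_scheme \<Rightarrow> ('r, 'c, 'k) module_scheme
       \<Rightarrow> ('r, ('b \<times> 'c \<Rightarrow> 'r) set) module"
  where "tensor_product R M N =
    quotient_module (free_module R (carrier M \<times> carrier N)) (tensor_relations R M N)"

definition pure_tensor ::
    "('r, 'm) ring_scheme \<Rightarrow> ('r, 'b, 'n) module_scheme \<Rightarrow> ('r, 'c, 'k) module_scheme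
       \<Rightarrow> 'b \<Rightarrow> 'c \<Rightarrow> ('b \<times> 'c \<Rightarrow> 'r) set"
  where "pure_tensor R M N x y =
    tensor_relations R M N +>\<^bsub>free_module R (carrier M \<times> carrier N)\<^esub> free_gen R (x, y)"

definition free_push :: "('r, 'm) ring_scheme \<Rightarrow> ('s \<Rightarrow> 't) \<Rightarrow> ('s \<Rightarrow> 'r) \<Rightarrow> 't \<Rightarrow> 'r"
  where "free_push R h f = (\<lambda>t. \<Oplus>\<^bsub>R\<^esub>s\<in>{s. f s \<noteq> \<zero>\<^bsub>R\<^esub> \<and> h s = t}. f s)"

text \<open>The endomorphism of the tensor product induced by an endomorphism \<open>h\<close> of the first factor
  and the identity of the second: \<open>x \<otimes> y\<close> goes to \<open>h x \<otimes> y\<close>.\<close>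

definition tensor_map ::
    "('r, 'm) ring_scheme \<Rightarrow> ('r, 'b, 'n) module_scheme \<Rightarrow> ('r, 'c, 'k) module_scheme
       \<Rightarrow> ('b \<Rightarrow> 'b) \<Rightarrow> ('b \<times> 'c \<Rightarrow> 'r) set \<Rightarrow> ('b \<times> 'c \<Rightarrow> 'r) set"
  where "tensor_map R M N h X =
    (free_push R (map_prod h id) ` X) <+>\<^bsub>free_module R (carrier M \<times> carrier N)\<^esub>
      tensor_relations R M N"


section \<open>Graded cochain complexes\<close>

text \<open>A complex is a single module with an internal grading indexed by the integers and a
  differential on the whole module.\<close>

record ('r, 'c) cochain_complex = "('r, 'c) module" +
  homog :: "int \<Rightarrow> 'c set"
  differential :: "'c \<Rightarrow> 'c"

locale graded_complex = module R C for R (structure) and C (structure) +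
  assumes homog_submodule: "submodule (homog C i) R C"
    and homog_decomposition:
      "x \<in> carrier C \<Longrightarrow>
        \<exists>!f. (\<forall>i::int. f i \<in> homog C i) \<and> finite {i. f i \<noteq> \<zero>\<^bsub>C\<^esub>} \<and>
             x = (\<Oplus>\<^bsub>C\<^esub>i\<in>{i. f i \<noteq> \<zero>\<^bsub>C\<^esub>}. f i)"
    and differential_hom: "differential C \<in> module_hom R C C"
    and differential_degree: "x \<in> homog C i \<Longrightarrow> differential C x \<in> homog C (i + 1)"
    and differential_square: "x \<in> carrier C \<Longrightarrow> differential C (differential C x) = \<zero>\<^bsub>C\<^esub>"

definition restrict_complex ::
    "('r, 'c) cochain_complex \<Rightarrow> 'c set \<Rightarrow> ('r, 'c) cochain_complex"
  where "restrict_complex C X = C\<lparr>carrier := X, homog := (\<lambda>i. homog C i \<inter> X)\<rparr>"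

definition graded_subcomplex ::
    "('r, 'm) ring_scheme \<Rightarrow> ('r, 'c) cochain_complex \<Rightarrow> 'c set \<Rightarrow> bool"
  where "graded_subcomplex R C X \<longleftrightarrow> X \<subseteq> carrier C \<and> graded_complex R (restrict_complex C X)"

definition quotient_complex ::
    "('r, 'c) cochain_complex \<Rightarrow> 'c set \<Rightarrow> ('r, 'c set) cochain_complex"
  where "quotient_complex C Y = module.extend (quotient_module C Y)
    (cochain_complex.fields
      (\<lambda>i. (\<lambda>x. Y +>\<^bsub>C\<^esub> x) ` homog C i)
      (\<lambda>S. (differential C ` S) <+>\<^bsub>C\<^esub> Y))"

definition complexes_isomorphic ::
    "('r, 'm) ring_scheme \<Rightarrow> ('r, 'c) cochain_complex \<Rightarrow> ('r, 'd) cochain_complex \<Rightarrow> bool"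
  where "complexes_isomorphic R C D \<longleftrightarrow>
    (\<exists>f\<in>module_iso R C D. (\<forall>i. f ` homog C i = homog D i) \<and>
       (\<forall>x\<in>carrier C. f (differential C x) = differential D (f x)))"

definition concentrated_in :: "('r, 'c) cochain_complex \<Rightarrow> int \<Rightarrow> bool"
  where "concentrated_in C i \<longleftrightarrow> homog C i = carrier C"

definition cohomology :: "('r, 'c) cochain_complex \<Rightarrow> int \<Rightarrow> ('r, 'c set) module"
  where "cohomology C i = quotient_module
    (C\<lparr>carrier := {x \<in> homog C i. differential C x = \<zero>\<^bsub>C\<^esub>}\<rparr>)
    (differential C ` homog C (i - 1))"

definition tensor_complex ::
    "('r, 'm) ring_scheme \<Rightarrow> ('r, 'c) cochain_complex \<Rightarrow> ('r, 'b, 'n) module_scheme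
       \<Rightarrow> ('r, ('c \<times> 'b \<Rightarrow> 'r) set) cochain_complex"
  where "tensor_complex R C M = module.extend (tensor_product R C M)
    (cochain_complex.fields
      (\<lambda>i. module_span R (tensor_product R C M)
             {pure_tensor R C M x y | x y. x \<in> homog C i \<and> y \<in> carrier M})
      (tensor_map R C M (differential C)))"

text \<open>For graded subcomplexes \<open>C3 \<subseteq> C2 \<subseteq> C1\<close> of \<open>C\<close> such that the coboundaries of \<open>C1/C2\<close> and
  \<open>C2/C3\<close> vanish, the connecting map \<open>C1/C2 \<rightarrow> C2/C3\<close> lifts a coset \<open>x + C2\<close> to \<open>x + C3\<close> in
  \<open>C1/C3\<close> and applies the coboundary there, with value \<open>d x + C3\<close>.  Since \<open>d C2 \<subseteq> C3\<close>, this
  coset is \<open>d S + C3\<close> for \<open>S = x + C2\<close>, which needs no choice of the lift.\<close>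

definition induced_differential ::
    "('r, 'c) cochain_complex \<Rightarrow> 'c set \<Rightarrow> 'c set \<Rightarrow> 'c set"
  where "induced_differential C C3 S = (differential C ` S) <+>\<^bsub>C\<^esub> C3"


section \<open>Laurent polynomials and bi-infinite series\<close>

text \<open>A series \<open>\<Sum>i. a\<^sub>i q^i\<close> is represented by its coefficient function.\<close>

definition convolution ::
    "('a, 'm) ring_scheme \<Rightarrow> (int \<Rightarrow> 'a) \<Rightarrow> (int \<Rightarrow> 'a) \<Rightarrow> int \<Rightarrow> 'a"
  where "convolution A f g = (\<lambda>i. \<Oplus>\<^bsub>A\<^esub>j\<in>{j. f j \<noteq> \<zero>\<^bsub>A\<^esub>}. f j \<otimes>\<^bsub>A\<^esub> g (i - j))"

definition laurent_ring :: "('a, 'm) ring_scheme \<Rightarrow> (int \<Rightarrow> 'a) ring"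
  where "laurent_ring A =
    \<lparr>carrier = {f. (\<forall>i. f i \<in> carrier A) \<and> finite {i. f i \<noteq> \<zero>\<^bsub>A\<^esub>}},
     mult = convolution A, one = (\<lambda>i. if i = 0 then \<one>\<^bsub>A\<^esub> else \<zero>\<^bsub>A\<^esub>),
     zero = (\<lambda>i. \<zero>\<^bsub>A\<^esub>), add = (\<lambda>f g i. f i \<oplus>\<^bsub>A\<^esub> g i)\<rparr>"

definition biinfinite_series :: "('a, 'm) ring_scheme \<Rightarrow> (int \<Rightarrow> 'a, int \<Rightarrow> 'a) module"
  where "biinfinite_series A =
    \<lparr>carrier = {f. \<forall>i. f i \<in> carrier A}, mult = undefined, one = undefined,
     zero = (\<lambda>i. \<zero>\<^bsub>A\<^esub>), add = (\<lambda>f g i. f i \<oplus>\<^bsub>A\<^esub> g i), smult = convolution A\<rparr>"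

definition extreme_coeffs_invertible :: "('a, 'm) ring_scheme \<Rightarrow> (int \<Rightarrow> 'a) \<Rightarrow> bool"
  where "extreme_coeffs_invertible A p \<longleftrightarrow>
    p (Min {i. p i \<noteq> \<zero>\<^bsub>A\<^esub>}) \<in> Units A \<and> p (Max {i. p i \<noteq> \<zero>\<^bsub>A\<^esub>}) \<in> Units A"


section \<open>Well filtered complexes\<close>

abbreviation graded_piece ::
    "('r, 'c) cochain_complex \<Rightarrow> (int \<Rightarrow> 'c set) \<Rightarrow> int \<Rightarrow> ('r, 'c set) cochain_complex"
  where "graded_piece C F i \<equiv> quotient_complex (restrict_complex C (F i)) (F (i + 1))"

definition decreasing_filtration ::
    "('r, 'm) ring_scheme \<Rightarrow> ('r, 'c) cochain_complex \<Rightarrow> (int \<Rightarrow> 'c set) \<Rightarrow> bool"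
  where "decreasing_filtration R C F \<longleftrightarrow>
    (\<forall>i. graded_subcomplex R C (F i)) \<and> (\<forall>i j. i \<le> j \<longrightarrow> F j \<subseteq> F i)"

text \<open>The recursion is well founded because the rank drops, so the least fixed point is meant.
  A quotient \<open>F i / F (i + 1)\<close> lives on the type of cosets, whereas an inductive predicate has to
  stay on one type; the recursive clause therefore speaks of a complex \<open>D\<close> on the original type
  that is isomorphic to the quotient.  Such a \<open>D\<close> always exists (transport the structure along a
  choice of coset representatives), and being well filtered is invariant under isomorphism.\<close>

inductive well_filtered ::
    "('a, 'm) ring_scheme \<Rightarrow> (int \<Rightarrow> 'a, 'c) cochain_complex \<Rightarrow> bool" for A
  where
    "\<lbrakk>graded_complex (laurent_ring A) C;
      free_finitely_generated (laurent_ring A) C;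
      \<not> modules_isomorphic (laurent_ring A) C (regular_module (laurent_ring A));
      carrier C \<noteq> {\<zero>\<^bsub>C\<^esub>} \<longrightarrow>
        (\<exists>(F :: int \<Rightarrow> 'c set) (n::int). n > 0 \<and>
           decreasing_filtration (laurent_ring A) C F \<and>
           F 0 = carrier C \<and> F (n + 1) = {\<zero>\<^bsub>C\<^esub>} \<and>
           concentrated_in (restrict_complex C (F n)) n \<and>
           modules_isomorphic (laurent_ring A) (restrict_complex C (F n))
             (regular_module (laurent_ring A)) \<and>
           concentrated_in (graded_piece C F (n - 1)) (n - 1) \<and>
           modules_isomorphic (laurent_ring A) (graded_piece C F (n - 1))
             (regular_module (laurent_ring A)) \<and>
           (\<exists>p\<in>carrier (laurent_ring A). p \<noteq> \<zero>\<^bsub>laurent_ring A\<^esub> \<and> extreme_coeffs_invertible A p \<and>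
             (\<exists>u\<in>module_iso (laurent_ring A) (graded_piece C F (n - 1))
                   (regular_module (laurent_ring A)).
              \<exists>v\<in>module_iso (laurent_ring A) (graded_piece C F n)
                   (regular_module (laurent_ring A)).
              \<forall>S\<in>carrier (graded_piece C F (n - 1)).
                v (induced_differential C (F (n + 1)) S) = p \<otimes>\<^bsub>laurent_ring A\<^esub> u S)) \<and>
           (\<forall>i. i \<noteq> n - 1 \<and> i \<noteq> n \<longrightarrow>
              (\<exists>D :: (int \<Rightarrow> 'a, 'c) cochain_complex.
                 complexes_isomorphic (laurent_ring A) (graded_piece C F i) D \<and>
                 well_filtered A D)))\<rbrakk>
     \<Longrightarrow> well_filtered A C"

end

theory Submission
  imports Defs
begin

text \<open>Let \<open>R\<close> be the Laurent polynomials and \<open>M\<close> the bi-infinite series over \<open>A\<close>.  Inside \<open>M\<close> lie the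
  series bounded below and the series bounded above; their sum is \<open>M\<close> and their intersection is \<open>R\<close>.
  The resulting exact sequence \<open>0 \<rightarrow> R \<rightarrow> M\<^sub>+ \<oplus> M\<^sub>- \<rightarrow> M \<rightarrow> 0\<close> stays exact after tensoring with the free
  module \<open>C\<close>.  If \<open>C \<otimes> M\<^sub>+\<close> and \<open>C \<otimes> M\<^sub>-\<close> are acyclic, the long exact sequence identifies \<open>H\<^sup>i(C \<otimes> M)\<close> with
  \<open>H\<^sup>i\<^sup>+\<^sup>1(C)\<close>.

  The acyclicity comes from the polynomials \<open>p\<close> in the definition of a well filtered complex: an
  invertible lowest coefficient makes \<open>p\<close> act bijectively on \<open>M\<^sub>+\<close>, an invertible highest one on \<open>M\<^sub>-\<close>
  (\<open>half_invertible_extreme_coeffs\<close>).  Rather than following the filtration through the tensor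
  products, the proof extracts from it a statement about \<open>C\<close> alone: some product \<open>s\<close> of such
  polynomials acts on \<open>C\<close> by a null-homotopic map, \<open>d h + h d = s\<close>
  (\<open>well_filtered_scalar_homotopy\<close>).  The two top pieces of the filtration provide such a homotopy
  directly (\<open>scalar_homotopy_two_term\<close>), and homotopies for a subcomplex and for a free quotient
  combine to one for the product of the two scalars (\<open>scalar_homotopy_extension\<close>).  On \<open>C \<otimes> M\<^sub>+\<close> and
  \<open>C \<otimes> M\<^sub>-\<close> the scalar \<open>s\<close> is both invertible and null-homotopic, so these complexes are acyclic
  (\<open>sub_tensor_acyclic\<close>).

  The homotopy also makes the isomorphism explicit.  Let \<open>\<theta>\<close> be the difference of the two
  expansions of \<open>1 / s\<close>, in \<open>M\<^sub>+\<close> and in \<open>M\<^sub>-\<close>.  Then \<open>z \<mapsto> h z \<otimes> \<theta>\<close>, with \<open>h\<close> restricted to its part of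
  degree \<open>-1\<close>, takes cocycles of \<open>C\<close> to cocycles of \<open>C \<otimes> M\<close> and induces the isomorphism
  (\<open>cohomology_shift\<close>).\<close>

section \<open>Module homomorphisms, spans and quotients\<close>

lemma (in abelian_group) minus_eq_zero_iff:
  assumes "x \<in> carrier G" "y \<in> carrier G"
  shows "x \<ominus> y = \<zero> \<longleftrightarrow> x = y"
proof
  assume "x \<ominus> y = \<zero>"
  then have "\<ominus> (\<ominus> y) = x" using assms by (intro minus_equality) (simp_all add: minus_eq)
  then show "x = y" using assms by simp
qed (simp add: assms minus_eq r_neg)

lemma (in abelian_group) telescope:
  assumes "a \<in> carrier G" "b \<in> carrier G" "u \<in> carrier G" "v \<in> carrier G"
  shows "(a \<ominus> u) \<oplus> (b \<oplus> v) \<oplus> (u \<ominus> v) = a \<oplus> b"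
proof -
  have "(a \<ominus> u) \<oplus> (b \<oplus> v) \<oplus> (u \<ominus> v) = (a \<oplus> b) \<oplus> ((u \<oplus> \<ominus> u) \<oplus> (v \<oplus> \<ominus> v))"
    using assms by (simp add: minus_eq a_ac)
  then show ?thesis using assms by (simp add: r_neg)
qed

lemma (in abelian_group) minus_zero_right: "x \<in> carrier G \<Longrightarrow> x \<ominus> \<zero> = x"
  using minus_equality[of \<zero> \<zero>] by (simp add: minus_eq)

context abelian_monoid
begin

lemma finsum_swap:
  assumes "finite I" "finite J" "\<And>i j. i \<in> I \<Longrightarrow> j \<in> J \<Longrightarrow> f i j \<in> carrier G"
  shows "(\<Oplus>i\<in>I. \<Oplus>j\<in>J. f i j) = (\<Oplus>j\<in>J. \<Oplus>i\<in>I. f i j)"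
  using assms(1,3)
proof (induction I rule: finite_induct)
  case (insert i I)
  then have "(\<Oplus>i\<in>insert i I. \<Oplus>j\<in>J. f i j) = (\<Oplus>j\<in>J. f i j) \<oplus> (\<Oplus>j\<in>J. \<Oplus>i\<in>I. f i j)"
    by (simp add: Pi_def finsum_closed)
  also have "\<dots> = (\<Oplus>j\<in>J. f i j \<oplus> (\<Oplus>i\<in>I. f i j))"
    using insert by (intro finsum_addf[symmetric]) (auto intro!: finsum_closed)
  also have "\<dots> = (\<Oplus>j\<in>J. \<Oplus>i\<in>insert i I. f i j)"
    using insert by (intro finsum_cong') (auto intro!: finsum_closed)
  finally show ?case .
qed simp

end

lemma module_homI:
  assumes "\<And>x. x \<in> carrier M \<Longrightarrow> f x \<in> carrier N"
    and "\<And>x y. x \<in> carrier M \<Longrightarrow> y \<in> carrier M \<Longrightarrow> f (x \<oplus>\<^bsub>M\<^esub> y) = f x \<oplus>\<^bsub>N\<^esub> f y"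
    and "\<And>r x. r \<in> carrier R \<Longrightarrow> x \<in> carrier M \<Longrightarrow> f (r \<odot>\<^bsub>M\<^esub> x) = r \<odot>\<^bsub>N\<^esub> f x"
  shows "f \<in> module_hom R M N"
  using assms unfolding module_hom_def by auto

lemma module_hom_closed: "f \<in> module_hom R M N \<Longrightarrow> x \<in> carrier M \<Longrightarrow> f x \<in> carrier N"
  and module_hom_add: "f \<in> module_hom R M N \<Longrightarrow> x \<in> carrier M \<Longrightarrow> y \<in> carrier M \<Longrightarrow>
      f (x \<oplus>\<^bsub>M\<^esub> y) = f x \<oplus>\<^bsub>N\<^esub> f y"
  and module_hom_smult: "f \<in> module_hom R M N \<Longrightarrow> r \<in> carrier R \<Longrightarrow> x \<in> carrier M \<Longrightarrow>
      f (r \<odot>\<^bsub>M\<^esub> x) = r \<odot>\<^bsub>N\<^esub> f x"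
  unfolding module_hom_def by auto

lemma module_hom_comp:
  "f \<in> module_hom R M N \<Longrightarrow> g \<in> module_hom R N P \<Longrightarrow> (\<lambda>x. g (f x)) \<in> module_hom R M P"
  by (intro module_homI) (simp_all add: module_hom_closed module_hom_add module_hom_smult)

context
  fixes R :: "('r, 'm) ring_scheme" and M :: "('r, 'b, 'n) module_scheme"
    and N :: "('r, 'c, 'k) module_scheme"
  assumes M: "module R M" and N: "module R N"
begin

interpretation M: module R M by (rule M)
interpretation N: module R N by (rule N)

lemma module_hom_zero:
  assumes "f \<in> module_hom R M N"
  shows "f \<zero>\<^bsub>M\<^esub> = \<zero>\<^bsub>N\<^esub>"
proof -
  have "f (\<zero>\<^bsub>R\<^esub> \<odot>\<^bsub>M\<^esub> \<zero>\<^bsub>M\<^esub>) = \<zero>\<^bsub>R\<^esub> \<odot>\<^bsub>N\<^esub> f \<zero>\<^bsub>M\<^esub>"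
    using assms by (intro module_hom_smult) auto
  then show ?thesis
    using module_hom_closed[OF assms M.zero_closed] by simp
qed

lemma module_hom_uminus:
  assumes f: "f \<in> module_hom R M N" and x: "x \<in> carrier M"
  shows "f (\<ominus>\<^bsub>M\<^esub> x) = \<ominus>\<^bsub>N\<^esub> f x"
proof -
  have "f (\<ominus>\<^bsub>R\<^esub> \<one>\<^bsub>R\<^esub> \<odot>\<^bsub>M\<^esub> x) = \<ominus>\<^bsub>R\<^esub> \<one>\<^bsub>R\<^esub> \<odot>\<^bsub>N\<^esub> f x"
    using assms by (intro module_hom_smult) auto
  then show ?thesis
    using module_hom_closed[OF f x] x by (simp add: M.smult_l_minus N.smult_l_minus)
qed

lemma module_hom_minus:
  assumes f: "f \<in> module_hom R M N" and x: "x \<in> carrier M" and y: "y \<in> carrier M"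
  shows "f (x \<ominus>\<^bsub>M\<^esub> y) = f x \<ominus>\<^bsub>N\<^esub> f y"
  using module_hom_add[OF f, of x "\<ominus>\<^bsub>M\<^esub> y"] module_hom_uminus[OF f y] x y
  by (simp add: a_minus_def)

lemma module_hom_finsum:
  assumes f: "f \<in> module_hom R M N" and "finite I" and "g \<in> I \<rightarrow> carrier M"
  shows "f (\<Oplus>\<^bsub>M\<^esub>i\<in>I. g i) = (\<Oplus>\<^bsub>N\<^esub>i\<in>I. f (g i))"
  using assms(2,3)
proof (induction I rule: finite_induct)
  case empty
  then show ?case by (simp add: module_hom_zero[OF f])
next
  case (insert i I)
  then have "g i \<in> carrier M" "g \<in> I \<rightarrow> carrier M" by auto
  moreover from this have "(\<lambda>i. f (g i)) \<in> I \<rightarrow> carrier N"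
    using module_hom_closed[OF f] by blast
  ultimately show ?case
    using insert module_hom_closed[OF f] module_hom_add[OF f] by simp
qed

lemma module_hom_addf:
  assumes f: "f \<in> module_hom R M N" and g: "g \<in> module_hom R M N"
  shows "(\<lambda>x. f x \<oplus>\<^bsub>N\<^esub> g x) \<in> module_hom R M N"
  using module_hom_closed[OF f] module_hom_closed[OF g]
  by (intro module_homI)
     (auto simp: module_hom_add[OF f] module_hom_add[OF g] N.add.m_ac N.smult_r_distr
        module_hom_smult[OF f] module_hom_smult[OF g])

lemma module_hom_smultf:
  assumes f: "f \<in> module_hom R M N" and r: "r \<in> carrier R"
  shows "(\<lambda>x. r \<odot>\<^bsub>N\<^esub> f x) \<in> module_hom R M N"
  using module_hom_closed[OF f] r
  by (intro module_homI)
     (auto simp: module_hom_add[OF f] N.smult_r_distr module_hom_smult[OF f]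
        N.smult_assoc1[symmetric] M.R.m_comm)

lemma module_hom_minusf:
  assumes f: "f \<in> module_hom R M N" and g: "g \<in> module_hom R M N"
  shows "(\<lambda>x. f x \<ominus>\<^bsub>N\<^esub> g x) \<in> module_hom R M N"
proof -
  have "(\<lambda>x. f x \<oplus>\<^bsub>N\<^esub> (\<ominus>\<^bsub>R\<^esub> \<one>\<^bsub>R\<^esub>) \<odot>\<^bsub>N\<^esub> g x) \<in> module_hom R M N"
    using f g by (intro module_hom_addf module_hom_smultf) auto
  then show ?thesis
    using module_hom_closed[OF g] module_hom_closed[OF f]
    by (auto simp: module_hom_def a_minus_def N.smult_l_minus)
qed

lemma module_hom_kernel_submodule:
  assumes f: "f \<in> module_hom R M N"
  shows "submodule {x \<in> carrier M. f x = \<zero>\<^bsub>N\<^esub>} R M"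
  by (rule M.submoduleI)
     (auto simp: module_hom_zero[OF f] module_hom_uminus[OF f] module_hom_add[OF f]
        module_hom_smult[OF f])

lemma module_hom_image_submodule:
  assumes f: "f \<in> module_hom R M N" and X: "submodule X R M"
  shows "submodule (f ` X) R N"
proof (rule N.submoduleI)
  note XE = M.submoduleE[OF X]
  have sub: "x \<in> carrier M" if "x \<in> X" for x using that XE(1) by auto
  have "\<zero>\<^bsub>M\<^esub> \<in> X"
    using subgroup.one_closed[OF submodule.axioms(1)[OF X]] by simp
  then show "\<zero>\<^bsub>N\<^esub> \<in> f ` X" using module_hom_zero[OF f] by force
  show "f ` X \<subseteq> carrier N" using sub module_hom_closed[OF f] by auto
  show "\<ominus>\<^bsub>N\<^esub> a \<in> f ` X" if "a \<in> f ` X" for a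
    using that XE(3) sub by (auto simp: module_hom_uminus[OF f, symmetric])
  show "a \<oplus>\<^bsub>N\<^esub> b \<in> f ` X" if "a \<in> f ` X" "b \<in> f ` X" for a b
    using that XE(5) sub by (auto simp: module_hom_add[OF f, symmetric])
  show "r \<odot>\<^bsub>N\<^esub> a \<in> f ` X" if "r \<in> carrier R" "a \<in> f ` X" for r a
    using that XE(4) sub by (auto simp: module_hom_smult[OF f, symmetric])
qed

end

context module
begin

lemma submodule_zero:
  assumes "submodule N R M"
  shows "\<zero>\<^bsub>M\<^esub> \<in> N"
  using subgroup.one_closed[OF submodule.axioms(1)[OF assms]] by simp

lemma submodule_minus:
  assumes "submodule N R M" "x \<in> N" "y \<in> N"
  shows "x \<ominus>\<^bsub>M\<^esub> y \<in> N"
  unfolding a_minus_def by (intro submoduleE(5)[OF assms(1)] submoduleE(3)[OF assms(1)] assms)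

lemma submodule_restrict_iff:
  "submodule N R (M\<lparr>carrier := X\<rparr>) \<longleftrightarrow> submodule N R M \<and> N \<subseteq> X"
  if "submodule X R M"
proof -
  interpret X: module R "M\<lparr>carrier := X\<rparr>"
    using submodule.submodule_is_module[OF that] module_axioms by blast
  have XM: "X \<subseteq> carrier M" using submoduleE(1)[OF that] .
  show ?thesis
  proof
    assume N: "submodule N R (M\<lparr>carrier := X\<rparr>)"
    have sub: "N \<subseteq> X" using X.submoduleE(1)[OF N] by simp
    have "module R (M\<lparr>carrier := N\<rparr>)"
      using submodule.submodule_is_module[OF N X.module_axioms] by simp
    then show "submodule N R M \<and> N \<subseteq> X"
      using module_incl_imp_submodule sub XM by blast
  next
    assume N: "submodule N R M \<and> N \<subseteq> X"
    then have "module R (M\<lparr>carrier := N\<rparr>)"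
      using submodule.submodule_is_module module_axioms by blast
    then show "submodule N R (M\<lparr>carrier := X\<rparr>)"
      using X.module_incl_imp_submodule[of N] N by simp
  qed
qed

lemma span_submodule:
  assumes "S \<subseteq> carrier M"
  shows "submodule (module_span R M S) R M"
proof -
  let ?H = "\<Inter>{N. submodule N R M \<and> S \<subseteq> N}"
  have 1: "submodule (carrier M) R M" by (rule carrier_is_submodule)
  have "submodule ?H R M"
  proof (rule submoduleI)
    show "?H \<subseteq> carrier M" using 1 assms by blast
    show "\<zero>\<^bsub>M\<^esub> \<in> ?H" using submodule_zero by blast
    show "\<ominus>\<^bsub>M\<^esub> a \<in> ?H" if "a \<in> ?H" for a
      using that by (auto intro: submoduleE(3))
    show "a \<oplus>\<^bsub>M\<^esub> b \<in> ?H" if "a \<in> ?H" "b \<in> ?H" for a b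
      using that by (auto intro: submoduleE(5))
    show "r \<odot>\<^bsub>M\<^esub> a \<in> ?H" if "r \<in> carrier R" "a \<in> ?H" for r a
      using that by (auto intro: submoduleE(4))
  qed
  then show ?thesis unfolding module_span_def hull_def .
qed

lemma span_superset: "S \<subseteq> module_span R M S"
  unfolding module_span_def by (rule hull_subset)

lemma span_least: "submodule N R M \<Longrightarrow> S \<subseteq> N \<Longrightarrow> module_span R M S \<subseteq> N"
  unfolding module_span_def by (rule hull_minimal)

lemma span_mem: "x \<in> S \<Longrightarrow> x \<in> module_span R M S"
  using span_superset by blast

context
  fixes N assumes N: "submodule N R M"
begin

interpretation N: abelian_subgroup N M
proof (rule abelian_subgroupI3)
  show "additive_subgroup N M"
    using N unfolding submodule_def additive_subgroup_def by simp
  show "abelian_group M" by (rule M.abelian_group_axioms)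
qed

lemma coset_eq_iff:
  assumes "x \<in> carrier M" "y \<in> carrier M"
  shows "N +>\<^bsub>M\<^esub> x = N +>\<^bsub>M\<^esub> y \<longleftrightarrow> x \<ominus>\<^bsub>M\<^esub> y \<in> N"
proof -
  have "N +>\<^bsub>M\<^esub> x = N +>\<^bsub>M\<^esub> y \<longleftrightarrow> x \<in> N +>\<^bsub>M\<^esub> y"
    using N.a_repr_independence' N.a_rcos_self assms by metis
  then show ?thesis using N.a_rcos_module[OF assms(2,1)] unfolding a_minus_def by simp
qed

lemma coset_self: "x \<in> carrier M \<Longrightarrow> x \<in> N +>\<^bsub>M\<^esub> x"
  by (rule N.a_rcos_self)

lemma coset_eq_zero_iff:
  "x \<in> carrier M \<Longrightarrow> N +>\<^bsub>M\<^esub> x = N \<longleftrightarrow> x \<in> N"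
  using N.a_rcos_const N.a_rcos_self by blast

lemma coset_add:
  "x \<in> carrier M \<Longrightarrow> y \<in> carrier M \<Longrightarrow>
     (N +>\<^bsub>M\<^esub> x) <+>\<^bsub>M\<^esub> (N +>\<^bsub>M\<^esub> y) = N +>\<^bsub>M\<^esub> (x \<oplus>\<^bsub>M\<^esub> y)"
  by (rule N.a_rcos_sum)

lemma quotient_carrierE:
  assumes "X \<in> carrier (quotient_module M N)"
  obtains x where "x \<in> carrier M" "X = N +>\<^bsub>M\<^esub> x"
  using assms unfolding quotient_module_def by (auto simp: A_RCOSETS_def')

lemma quotient_carrierI: "x \<in> carrier M \<Longrightarrow> N +>\<^bsub>M\<^esub> x \<in> carrier (quotient_module M N)"
  unfolding quotient_module_def by (auto simp: A_RCOSETS_def')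

end

text \<open>Scalar multiplication in a quotient, the map induced on a tensor product and the coboundaries of
  quotient complexes all have the shape \<open>S \<mapsto> f ` S + N'\<close>.  Such an expression sends the coset of
  \<open>x\<close> to the coset of \<open>f x\<close>, because the sum with \<open>N'\<close> absorbs \<open>f ` N\<close>; this lemma therefore
  evaluates all of them, without a choice of representatives.\<close>

lemma coset_image:
  assumes N: "submodule N R M" and M': "module R M'" and N': "submodule N' R M'"
    and f: "f \<in> module_hom R M M'" and sub: "f ` N \<subseteq> N'" and x: "x \<in> carrier M"
  shows "(f ` (N +>\<^bsub>M\<^esub> x)) <+>\<^bsub>M'\<^esub> N' = N' +>\<^bsub>M'\<^esub> f x"
proof -
  interpret M': module R M' by (rule M')
  have Nc: "y \<in> carrier M" if "y \<in> N" for y using that submoduleE(1)[OF N] by auto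
  have N'c: "y \<in> carrier M'" if "y \<in> N'" for y using that M'.submoduleE(1)[OF N'] by auto
  have fx: "f x \<in> carrier M'" using module_hom_closed[OF f x] .
  show ?thesis
  proof
    show "(f ` (N +>\<^bsub>M\<^esub> x)) <+>\<^bsub>M'\<^esub> N' \<subseteq> N' +>\<^bsub>M'\<^esub> f x"
    proof
      fix z assume "z \<in> (f ` (N +>\<^bsub>M\<^esub> x)) <+>\<^bsub>M'\<^esub> N'"
      then obtain a b where ab: "a \<in> N" "b \<in> N'" "z = f (a \<oplus>\<^bsub>M\<^esub> x) \<oplus>\<^bsub>M'\<^esub> b"
        by (auto simp: set_add_def' a_r_coset_def')
      have fa: "f a \<in> N'" using ab sub by auto
      have "z = (f a \<oplus>\<^bsub>M'\<^esub> b) \<oplus>\<^bsub>M'\<^esub> f x"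
        using ab Nc N'c fa fx x by (simp add: module_hom_add[OF f] M'.add.m_ac)
      moreover have "f a \<oplus>\<^bsub>M'\<^esub> b \<in> N'" using M'.submoduleE(5)[OF N' fa ab(2)] .
      ultimately show "z \<in> N' +>\<^bsub>M'\<^esub> f x" by (auto simp: a_r_coset_def')
    qed
    show "N' +>\<^bsub>M'\<^esub> f x \<subseteq> (f ` (N +>\<^bsub>M\<^esub> x)) <+>\<^bsub>M'\<^esub> N'"
    proof
      fix z assume "z \<in> N' +>\<^bsub>M'\<^esub> f x"
      then obtain b where b: "b \<in> N'" "z = b \<oplus>\<^bsub>M'\<^esub> f x" by (auto simp: a_r_coset_def')
      then have "z = f x \<oplus>\<^bsub>M'\<^esub> b" using N'c fx by (simp add: M'.add.m_comm)
      moreover have "x \<in> N +>\<^bsub>M\<^esub> x" using coset_self[OF N x] .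
      ultimately show "z \<in> (f ` (N +>\<^bsub>M\<^esub> x)) <+>\<^bsub>M'\<^esub> N'"
        using b by (auto simp: set_add_def')
    qed
  qed
qed

lemma smult_hom: "r \<in> carrier R \<Longrightarrow> (\<lambda>x. r \<odot>\<^bsub>M\<^esub> x) \<in> module_hom R M M"
  by (intro module_homI) (auto simp: smult_r_distr smult_assoc1[symmetric] R.m_comm)

lemma id_hom: "(\<lambda>x. x) \<in> module_hom R M M"
  by (intro module_homI) auto

lemma coset_smult:
  assumes N: "submodule N R M" and "r \<in> carrier R" "x \<in> carrier M"
  shows "r \<odot>\<^bsub>quotient_module M N\<^esub> (N +>\<^bsub>M\<^esub> x) = N +>\<^bsub>M\<^esub> (r \<odot>\<^bsub>M\<^esub> x)"
  using coset_image[OF N module_axioms N smult_hom, of r x] assms submoduleE(4)[OF N]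
  by (auto simp: quotient_module_def)

lemma quotient_module_simps [simp]:
  "\<zero>\<^bsub>quotient_module M N\<^esub> = N" "X \<oplus>\<^bsub>quotient_module M N\<^esub> Y = X <+>\<^bsub>M\<^esub> Y"
  by (simp_all add: quotient_module_def)

lemma quotient_is_module:
  assumes N: "submodule N R M"
  shows "module R (quotient_module M N)"
proof -
  let ?Q = "quotient_module M N"
  have zero: "N = N +>\<^bsub>M\<^esub> \<zero>\<^bsub>M\<^esub>" using coset_eq_zero_iff[OF N M.zero_closed] submodule_zero[OF N] by blast
  note [simp] = coset_add[OF N] coset_smult[OF N]
  have grp: "abelian_group ?Q"
  proof (rule abelian_groupI)
    fix X Y Z
    assume "X \<in> carrier ?Q" "Y \<in> carrier ?Q" "Z \<in> carrier ?Q"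
    then show "X \<oplus>\<^bsub>?Q\<^esub> Y \<oplus>\<^bsub>?Q\<^esub> Z = X \<oplus>\<^bsub>?Q\<^esub> (Y \<oplus>\<^bsub>?Q\<^esub> Z)"
      by (elim quotient_carrierE[OF N]) (simp add: M.add.m_ac)
  next
    fix X Y
    assume "X \<in> carrier ?Q" "Y \<in> carrier ?Q"
    then show "X \<oplus>\<^bsub>?Q\<^esub> Y = Y \<oplus>\<^bsub>?Q\<^esub> X" "X \<oplus>\<^bsub>?Q\<^esub> Y \<in> carrier ?Q"
      by (elim quotient_carrierE[OF N]; simp add: M.add.m_ac quotient_carrierI[OF N])+
  next
    show "\<zero>\<^bsub>?Q\<^esub> \<in> carrier ?Q" using quotient_carrierI[OF N M.zero_closed] zero by simp
  next
    fix X assume "X \<in> carrier ?Q"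
    then obtain x where x: "x \<in> carrier M" "X = N +>\<^bsub>M\<^esub> x" by (rule quotient_carrierE[OF N])
    show "\<zero>\<^bsub>?Q\<^esub> \<oplus>\<^bsub>?Q\<^esub> X = X"
      using coset_add[OF N M.zero_closed x(1)] zero x by simp
    have "(N +>\<^bsub>M\<^esub> (\<ominus>\<^bsub>M\<^esub> x)) \<oplus>\<^bsub>?Q\<^esub> X = \<zero>\<^bsub>?Q\<^esub>"
      using x zero by (simp add: M.l_neg)
    then show "\<exists>Y\<in>carrier ?Q. Y \<oplus>\<^bsub>?Q\<^esub> X = \<zero>\<^bsub>?Q\<^esub>"
      using x quotient_carrierI[OF N] by blast
  qed
  show ?thesis
  proof (rule moduleI[OF R.cring_axioms grp])
    fix a b X Y
    assume ab: "a \<in> carrier R" "b \<in> carrier R" and X: "X \<in> carrier ?Q" and Y: "Y \<in> carrier ?Q"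
    show "a \<odot>\<^bsub>?Q\<^esub> X \<in> carrier ?Q"
      using X ab by (elim quotient_carrierE[OF N]) (simp add: quotient_carrierI[OF N])
    show "(a \<oplus>\<^bsub>R\<^esub> b) \<odot>\<^bsub>?Q\<^esub> X = a \<odot>\<^bsub>?Q\<^esub> X \<oplus>\<^bsub>?Q\<^esub> b \<odot>\<^bsub>?Q\<^esub> X"
      using X ab by (elim quotient_carrierE[OF N]) (simp add: smult_l_distr)
    show "a \<odot>\<^bsub>?Q\<^esub> (X \<oplus>\<^bsub>?Q\<^esub> Y) = a \<odot>\<^bsub>?Q\<^esub> X \<oplus>\<^bsub>?Q\<^esub> a \<odot>\<^bsub>?Q\<^esub> Y"
      using X Y ab by (elim quotient_carrierE[OF N]) (simp add: smult_r_distr)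
    show "(a \<otimes>\<^bsub>R\<^esub> b) \<odot>\<^bsub>?Q\<^esub> X = a \<odot>\<^bsub>?Q\<^esub> (b \<odot>\<^bsub>?Q\<^esub> X)"
      using X ab by (elim quotient_carrierE[OF N]) (simp add: smult_assoc1)
  next
    fix X assume X: "X \<in> carrier ?Q"
    then show "\<one>\<^bsub>R\<^esub> \<odot>\<^bsub>?Q\<^esub> X = X" by (elim quotient_carrierE[OF N]) simp
  qed
qed

lemma coset_hom:
  "submodule N R M \<Longrightarrow> (\<lambda>x. N +>\<^bsub>M\<^esub> x) \<in> module_hom R M (quotient_module M N)"
  by (intro module_homI) (simp_all add: coset_add coset_smult quotient_carrierI)

lemma coset_image_hom:
  assumes N: "submodule N R M" and M': "module R M'" and N': "submodule N' R M'"
    and f: "f \<in> module_hom R M M'" and sub: "f ` N \<subseteq> N'"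
  shows "(\<lambda>X. (f ` X) <+>\<^bsub>M'\<^esub> N') \<in> module_hom R (quotient_module M N) (quotient_module M' N')"
proof -
  interpret M': module R M' by (rule M')
  note [simp] = coset_image[OF assms] coset_add[OF N] coset_smult[OF N] module_hom_closed[OF f]
    M'.coset_add[OF N'] M'.coset_smult[OF N'] M'.quotient_carrierI[OF N']
    module_hom_add[OF f] module_hom_smult[OF f]
  show ?thesis
    by (intro module_homI) (auto elim!: quotient_carrierE[OF N])
qed

text \<open>The form in which two cohomology modules are compared: \<open>f\<close> is a map of cocycles that detects and
  preserves coboundaries and hits every cocycle up to a coboundary.\<close>

lemma quotients_isomorphic:
  assumes N: "submodule N R M" and M': "module R M'" and N': "submodule N' R M'"
    and f: "f \<in> module_hom R M M'"
    and inj: "\<And>x. x \<in> carrier M \<Longrightarrow> f x \<in> N' \<longleftrightarrow> x \<in> N"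
    and surj: "\<And>y. y \<in> carrier M' \<Longrightarrow> \<exists>x\<in>carrier M. \<exists>b\<in>N'. y = b \<oplus>\<^bsub>M'\<^esub> f x"
  shows "modules_isomorphic R (quotient_module M N) (quotient_module M' N')"
proof -
  interpret M': module R M' by (rule M')
  let ?g = "\<lambda>X. (f ` X) <+>\<^bsub>M'\<^esub> N'"
  have sub: "f ` N \<subseteq> N'" using inj submoduleE(1)[OF N] by auto
  note img = coset_image[OF N M' N' f sub]
  have "bij_betw ?g (carrier (quotient_module M N)) (carrier (quotient_module M' N'))"
  proof (rule bij_betw_imageI)
    show "inj_on ?g (carrier (quotient_module M N))"
    proof (rule inj_onI)
      fix X Y assume XY: "X \<in> carrier (quotient_module M N)" "Y \<in> carrier (quotient_module M N)"
        and eq: "?g X = ?g Y"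
      obtain x where x: "x \<in> carrier M" "X = N +>\<^bsub>M\<^esub> x" using XY(1) by (rule quotient_carrierE[OF N])
      obtain y where y: "y \<in> carrier M" "Y = N +>\<^bsub>M\<^esub> y" using XY(2) by (rule quotient_carrierE[OF N])
      have "f x \<ominus>\<^bsub>M'\<^esub> f y \<in> N'"
        using eq M'.coset_eq_iff[OF N' module_hom_closed[OF f x(1)] module_hom_closed[OF f y(1)]]
        unfolding x(2) y(2) img[OF x(1)] img[OF y(1)] by simp
      then have "x \<ominus>\<^bsub>M\<^esub> y \<in> N"
        using inj[of "x \<ominus>\<^bsub>M\<^esub> y"] x y module_hom_minus[OF module_axioms M' f x(1) y(1)] by simp
      then show "X = Y" using coset_eq_iff[OF N x(1) y(1)] x y by simp
    qed
    show "?g ` carrier (quotient_module M N) = carrier (quotient_module M' N')"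
    proof
      show "?g ` carrier (quotient_module M N) \<subseteq> carrier (quotient_module M' N')"
        using module_hom_closed[OF coset_image_hom[OF N M' N' f sub]] by auto
      show "carrier (quotient_module M' N') \<subseteq> ?g ` carrier (quotient_module M N)"
      proof
        fix Y assume "Y \<in> carrier (quotient_module M' N')"
        then obtain y where y: "y \<in> carrier M'" "Y = N' +>\<^bsub>M'\<^esub> y" by (rule M'.quotient_carrierE[OF N'])
        obtain x b where x: "x \<in> carrier M" and b: "b \<in> N'" "y = b \<oplus>\<^bsub>M'\<^esub> f x"
          using surj[OF y(1)] by auto
        have "b \<in> carrier M'" "f x \<in> carrier M'"
          using b M'.submoduleE(1)[OF N'] module_hom_closed[OF f x] by auto
        then have yfx: "y \<ominus>\<^bsub>M'\<^esub> f x \<in> N'"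
          using b by (simp add: M'.minus_eq M'.M.a_assoc M'.M.r_neg)
        have "Y = ?g (N +>\<^bsub>M\<^esub> x)"
          unfolding y(2) img[OF x]
          using M'.coset_eq_iff[OF N' y(1) module_hom_closed[OF f x]] yfx by simp
        then show "Y \<in> ?g ` carrier (quotient_module M N)" using quotient_carrierI[OF N x] by blast
      qed
    qed
  qed
  then show ?thesis
    using coset_image_hom[OF N M' N' f sub] unfolding modules_isomorphic_def module_iso_def by blast
qed

end


section \<open>Tensor products\<close>

context module
begin

lemma preimage_submodule:
  assumes M': "module R M'" and f: "f \<in> module_hom R M M'" and P: "submodule P R M'"
  shows "submodule {x \<in> carrier M. f x \<in> P} R M"
proof -
  interpret M': module R M' by (rule M')
  show ?thesis
    by (rule submoduleI)
       (auto simp: module_hom_zero[OF module_axioms M' f] module_hom_add[OF f]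
          module_hom_uminus[OF module_axioms M' f] module_hom_smult[OF f] M'.submodule_zero[OF P]
          intro: M'.submoduleE(3-5)[OF P])
qed

lemma span_hom_range:
  assumes M': "module R M'" and f: "f \<in> module_hom R M M'" and P: "submodule P R M'"
    and S: "S \<subseteq> carrier M" and gen: "\<And>s. s \<in> S \<Longrightarrow> f s \<in> P" and x: "x \<in> module_span R M S"
  shows "f x \<in> P"
  using span_least[OF preimage_submodule[OF M' f P], of S] S gen x by blast

lemma span_hom_eqI:
  assumes M': "module R M'" and f: "f \<in> module_hom R M M'" and g: "g \<in> module_hom R M M'"
    and S: "S \<subseteq> carrier M" and gen: "\<And>s. s \<in> S \<Longrightarrow> f s = g s" and x: "x \<in> module_span R M S"
  shows "f x = g x"
proof -
  interpret M': module R M' by (rule M')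
  have "f s \<ominus>\<^bsub>M'\<^esub> g s = \<zero>\<^bsub>M'\<^esub>" if "s \<in> S" for s
    using gen[OF that] module_hom_closed[OF g, of s] that S by (auto simp: a_minus_def M'.r_neg)
  then have gen': "f s \<ominus>\<^bsub>M'\<^esub> g s \<in> {\<zero>\<^bsub>M'\<^esub>}" if "s \<in> S" for s
    using that by simp
  have "submodule {\<zero>\<^bsub>M'\<^esub>} R M'" by (rule M'.submoduleI) auto
  from span_hom_range[OF M' module_hom_minusf[OF module_axioms M' f g] this S gen' x]
  have "f x \<ominus>\<^bsub>M'\<^esub> g x = \<zero>\<^bsub>M'\<^esub>" by simp
  moreover have "x \<in> carrier M"
    using span_submodule[OF S] submoduleE(1) x by blast
  ultimately show ?thesis
    using M'.minus_eq_zero_iff module_hom_closed[OF f] module_hom_closed[OF g] by blast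
qed

end

context cring
begin

lemma free_module_is_module: "module R (free_module R S)"
proof (rule moduleI[OF cring_axioms])
  let ?F = "free_module R S"
  have sub: "{s. f s \<oplus> g s \<noteq> \<zero>} \<subseteq> {s. f s \<noteq> \<zero>} \<union> {s. g s \<noteq> \<zero>}" for f g :: "'c \<Rightarrow> 'a"
    by auto
  have fin: "finite {s. f s \<oplus> g s \<noteq> \<zero>}" if "finite {s. f s \<noteq> \<zero>}" "finite {s. g s \<noteq> \<zero>}"
    for f g :: "'c \<Rightarrow> 'a"
    using finite_subset[OF sub] that by simp
  have sm: "finite {s. r \<otimes> f s \<noteq> \<zero>}" if "finite {s. f s \<noteq> \<zero>}" "r \<in> carrier R" for r and f :: "'c \<Rightarrow> 'a"
    using that by (auto intro: finite_subset[of _ "{s. f s \<noteq> \<zero>}"])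
  show "abelian_group ?F"
  proof (rule abelian_groupI)
    fix f assume f: "f \<in> carrier ?F"
    have "(\<lambda>s. \<ominus> f s) \<in> carrier ?F"
      using f unfolding free_module_def by (auto elim!: finite_subset[rotated])
    moreover have "(\<lambda>s. \<ominus> f s) \<oplus>\<^bsub>?F\<^esub> f = \<zero>\<^bsub>?F\<^esub>"
      using f unfolding free_module_def by (auto simp: l_neg)
    ultimately show "\<exists>g\<in>carrier ?F. g \<oplus>\<^bsub>?F\<^esub> f = \<zero>\<^bsub>?F\<^esub>" by blast
  next
    fix f g assume "f \<in> carrier ?F" "g \<in> carrier ?F"
    then show "f \<oplus>\<^bsub>?F\<^esub> g \<in> carrier ?F"
      unfolding free_module_def using fin[of f g] by force
  qed (auto simp: free_module_def fun_eq_iff add.m_ac)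
  fix r f assume "r \<in> carrier R" "f \<in> carrier ?F"
  then show "r \<odot>\<^bsub>?F\<^esub> f \<in> carrier ?F"
    unfolding free_module_def using sm[of f r] by force
qed (auto simp: free_module_def fun_eq_iff l_distr r_distr m_assoc)

lemma free_gen_closed: "s \<in> S \<Longrightarrow> free_gen R s \<in> carrier (free_module R S)"
  unfolding free_module_def free_gen_def by auto

lemma free_module_spanned:
  assumes N: "submodule N R (free_module R S)" and gen: "\<And>s. s \<in> S \<Longrightarrow> free_gen R s \<in> N"
    and f: "f \<in> carrier (free_module R S)"
  shows "f \<in> N"
proof -
  interpret F: module R "free_module R S" by (rule free_module_is_module)
  have "f \<in> N" if "finite J" "f \<in> carrier (free_module R S)" "{s. f s \<noteq> \<zero>} \<subseteq> J" for J f
    using that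
  proof (induction J arbitrary: f rule: finite_induct)
    case empty
    then have "f = \<zero>\<^bsub>free_module R S\<^esub>" by (auto simp: free_module_def fun_eq_iff)
    then show ?case using F.submodule_zero[OF N] by simp
  next
    case (insert s J)
    show ?case
    proof (cases "f s = \<zero>")
      case True
      then have "{s. f s \<noteq> \<zero>} \<subseteq> J" using insert.prems(2) by auto
      then show ?thesis using insert by blast
    next
      case False
      then have s: "s \<in> S" "f s \<in> carrier R" using insert.prems unfolding free_module_def by auto
      let ?g = "f(s := \<zero>)"
      have g: "?g \<in> carrier (free_module R S)"
        using insert.prems unfolding free_module_def by (auto elim!: finite_subset[rotated])
      have "{t. ?g t \<noteq> \<zero>} \<subseteq> J" using insert.prems(2) by auto
      then have "?g \<in> N" using insert.IH[OF g] by blast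
      moreover have "f s \<odot>\<^bsub>free_module R S\<^esub> free_gen R s \<in> N"
        using F.submoduleE(4)[OF N] gen s by blast
      moreover have "f = ?g \<oplus>\<^bsub>free_module R S\<^esub> (f s \<odot>\<^bsub>free_module R S\<^esub> free_gen R s)"
        using insert.prems(1) unfolding free_module_def free_gen_def by (auto simp: fun_eq_iff)
      ultimately show ?thesis using F.submoduleE(5)[OF N] by metis
    qed
  qed
  then show ?thesis using f unfolding free_module_def by auto
qed

text \<open>Summing over a set that contains the support makes the sums for several functions have the same
  index set, which is what linearity needs.\<close>

lemma free_push_eq:
  assumes "finite J" "{s. f s \<noteq> \<zero>} \<subseteq> J" "\<And>s. f s \<in> carrier R"
  shows "free_push R h f t = (\<Oplus>s\<in>J. if h s = t then f s else \<zero>)"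
  unfolding free_push_def
  using assms by (intro add.finprod_mono_neutral_cong_left) auto

lemma free_push_hom:
  assumes h: "\<And>s. s \<in> S \<Longrightarrow> h s \<in> S'"
  shows "free_push R h \<in> module_hom R (free_module R S) (free_module R S')"
proof (rule module_homI)
  let ?F = "free_module R S" and ?F' = "free_module R S'"
  fix f assume f: "f \<in> carrier ?F"
  then have f': "\<And>s. f s \<in> carrier R" "finite {s. f s \<noteq> \<zero>}" "{s. f s \<noteq> \<zero>} \<subseteq> S"
    unfolding free_module_def by auto
  have ex: "\<exists>s. f s \<noteq> \<zero> \<and> h s = t" if "free_push R h f t \<noteq> \<zero>" for t
  proof (rule ccontr)
    assume "\<not> ?thesis"
    then have "{s. f s \<noteq> \<zero> \<and> h s = t} = {}" by auto
    then have "free_push R h f t = \<zero>" unfolding free_push_def by (simp only: finsum_empty)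
    then show False using that by simp
  qed
  then have sub: "{t. free_push R h f t \<noteq> \<zero>} \<subseteq> h ` {s. f s \<noteq> \<zero>}" by auto
  have "free_push R h f t \<in> carrier R" for t
    unfolding free_push_def using f' by (intro finsum_closed) auto
  moreover have "{t. free_push R h f t \<noteq> \<zero>} \<subseteq> S'" using sub h f'(3) by blast
  ultimately show "free_push R h f \<in> carrier ?F'"
    using finite_subset[OF sub] f'(2) unfolding free_module_def by auto
  {
    fix g assume g: "g \<in> carrier ?F"
    then have g': "\<And>s. g s \<in> carrier R" "finite {s. g s \<noteq> \<zero>}" "{s. g s \<noteq> \<zero>} \<subseteq> S"
      unfolding free_module_def by auto
    let ?J = "{s. f s \<noteq> \<zero>} \<union> {s. g s \<noteq> \<zero>}"
    have "free_push R h (\<lambda>s. f s \<oplus> g s) t = free_push R h f t \<oplus> free_push R h g t" for t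
    proof -
      have "free_push R h (\<lambda>s. f s \<oplus> g s) t = (\<Oplus>s\<in>?J. if h s = t then f s \<oplus> g s else \<zero>)"
        using f' g' by (intro free_push_eq) auto
      also have "\<dots> = (\<Oplus>s\<in>?J. (if h s = t then f s else \<zero>) \<oplus> (if h s = t then g s else \<zero>))"
        using f' g' by (intro finsum_cong) (auto simp: simp_implies_def)
      also have "\<dots> = (\<Oplus>s\<in>?J. if h s = t then f s else \<zero>) \<oplus> (\<Oplus>s\<in>?J. if h s = t then g s else \<zero>)"
        using f' g' by (intro finsum_addf) auto
      also have "(\<Oplus>s\<in>?J. if h s = t then f s else \<zero>) = free_push R h f t"
        using f' g' by (intro free_push_eq[symmetric]) auto
      also have "(\<Oplus>s\<in>?J. if h s = t then g s else \<zero>) = free_push R h g t"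
        using f' g' by (intro free_push_eq[symmetric]) auto
      finally show ?thesis .
    qed
    then show "free_push R h (f \<oplus>\<^bsub>?F\<^esub> g) = free_push R h f \<oplus>\<^bsub>?F'\<^esub> free_push R h g"
      by (simp add: free_module_def fun_eq_iff)
  }
  fix r assume r: "r \<in> carrier R"
  have "free_push R h (\<lambda>s. r \<otimes> f s) t = r \<otimes> free_push R h f t" for t
  proof -
    have "free_push R h (\<lambda>s. r \<otimes> f s) t = (\<Oplus>s\<in>{s. f s \<noteq> \<zero>}. if h s = t then r \<otimes> f s else \<zero>)"
      using f' r by (intro free_push_eq) auto
    also have "\<dots> = (\<Oplus>s\<in>{s. f s \<noteq> \<zero>}. r \<otimes> (if h s = t then f s else \<zero>))"
      using f' r by (intro finsum_cong) (auto simp: simp_implies_def)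
    also have "\<dots> = r \<otimes> (\<Oplus>s\<in>{s. f s \<noteq> \<zero>}. (if h s = t then f s else \<zero>))"
      using f' r by (intro finsum_rdistr[symmetric]) auto
    also have "(\<Oplus>s\<in>{s. f s \<noteq> \<zero>}. if h s = t then f s else \<zero>) = free_push R h f t"
      using f' by (intro free_push_eq[symmetric]) auto
    finally show ?thesis .
  qed
  then show "free_push R h (r \<odot>\<^bsub>?F\<^esub> f) = r \<odot>\<^bsub>?F'\<^esub> free_push R h f"
    by (simp add: free_module_def fun_eq_iff)
qed

lemma free_push_gen: "free_push R h (free_gen R s) = free_gen R (h s)"
proof
  fix t
  have "{s'. free_gen R s s' \<noteq> \<zero> \<and> h s' = t} = (if \<one> \<noteq> \<zero> \<and> h s = t then {s} else {})"
    by (auto simp: free_gen_def)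
  then show "free_push R h (free_gen R s) t = free_gen R (h s) t"
    unfolding free_push_def by (auto simp: free_gen_def)
qed

definition linear_extension :: "('a, 'c, 'k) module_scheme \<Rightarrow> ('s \<Rightarrow> 'c) \<Rightarrow> ('s \<Rightarrow> 'a) \<Rightarrow> 'c"
  where "linear_extension N \<beta> f = (\<Oplus>\<^bsub>N\<^esub>s\<in>{s. f s \<noteq> \<zero>}. f s \<odot>\<^bsub>N\<^esub> \<beta> s)"

lemma linear_extension_hom:
  assumes N: "module R N" and \<beta>: "\<And>s. s \<in> S \<Longrightarrow> \<beta> s \<in> carrier N"
  shows "linear_extension N \<beta> \<in> module_hom R (free_module R S) N"
proof -
  interpret N: module R N by (rule N)
  let ?F = "free_module R S"
  have eq: "linear_extension N \<beta> f = (\<Oplus>\<^bsub>N\<^esub>s\<in>J. f s \<odot>\<^bsub>N\<^esub> \<beta> s)"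
    if "finite J" "{s. f s \<noteq> \<zero>} \<subseteq> J" "J \<subseteq> S" "\<And>s. f s \<in> carrier R" for f J
    unfolding linear_extension_def using that \<beta>
    by (intro N.add.finprod_mono_neutral_cong_left) auto
  show ?thesis
  proof (rule module_homI)
    fix f assume f: "f \<in> carrier ?F"
    then have f': "\<And>s. f s \<in> carrier R" "finite {s. f s \<noteq> \<zero>}" "{s. f s \<noteq> \<zero>} \<subseteq> S"
      unfolding free_module_def by auto
    show "linear_extension N \<beta> f \<in> carrier N"
      unfolding linear_extension_def using f' \<beta> by (intro N.finsum_closed) auto
    {
      fix g assume g: "g \<in> carrier ?F"
      then have g': "\<And>s. g s \<in> carrier R" "finite {s. g s \<noteq> \<zero>}" "{s. g s \<noteq> \<zero>} \<subseteq> S"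
        unfolding free_module_def by auto
      let ?J = "{s. f s \<noteq> \<zero>} \<union> {s. g s \<noteq> \<zero>}"
      have J: "finite ?J" "?J \<subseteq> S" using f' g' by auto
      have "linear_extension N \<beta> (\<lambda>s. f s \<oplus> g s) = (\<Oplus>\<^bsub>N\<^esub>s\<in>?J. (f s \<oplus> g s) \<odot>\<^bsub>N\<^esub> \<beta> s)"
        using f' g' by (intro eq) auto
      also have "\<dots> = (\<Oplus>\<^bsub>N\<^esub>s\<in>?J. f s \<odot>\<^bsub>N\<^esub> \<beta> s \<oplus>\<^bsub>N\<^esub> g s \<odot>\<^bsub>N\<^esub> \<beta> s)"
        using f' g' J \<beta> by (intro N.finsum_cong') (auto simp: N.smult_l_distr subset_iff)
      also have "\<dots> = (\<Oplus>\<^bsub>N\<^esub>s\<in>?J. f s \<odot>\<^bsub>N\<^esub> \<beta> s) \<oplus>\<^bsub>N\<^esub> (\<Oplus>\<^bsub>N\<^esub>s\<in>?J. g s \<odot>\<^bsub>N\<^esub> \<beta> s)"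
        using f' g' J \<beta> by (intro N.finsum_addf) auto
      also have "(\<Oplus>\<^bsub>N\<^esub>s\<in>?J. f s \<odot>\<^bsub>N\<^esub> \<beta> s) = linear_extension N \<beta> f"
        using f' J by (intro eq[symmetric]) auto
      also have "(\<Oplus>\<^bsub>N\<^esub>s\<in>?J. g s \<odot>\<^bsub>N\<^esub> \<beta> s) = linear_extension N \<beta> g"
        using g' J by (intro eq[symmetric]) auto
      finally show "linear_extension N \<beta> (f \<oplus>\<^bsub>?F\<^esub> g) = linear_extension N \<beta> f \<oplus>\<^bsub>N\<^esub> linear_extension N \<beta> g"
        by (simp add: free_module_def)
    }
    fix r assume r: "r \<in> carrier R"
    have "linear_extension N \<beta> (\<lambda>s. r \<otimes> f s) = (\<Oplus>\<^bsub>N\<^esub>s\<in>{s. f s \<noteq> \<zero>}. (r \<otimes> f s) \<odot>\<^bsub>N\<^esub> \<beta> s)"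
      using f' r by (intro eq) auto
    also have "\<dots> = (\<Oplus>\<^bsub>N\<^esub>s\<in>{s. f s \<noteq> \<zero>}. r \<odot>\<^bsub>N\<^esub> (f s \<odot>\<^bsub>N\<^esub> \<beta> s))"
      using f' r \<beta> by (intro N.finsum_cong') (auto simp: N.smult_assoc1 subset_iff)
    also have "\<dots> = r \<odot>\<^bsub>N\<^esub> (\<Oplus>\<^bsub>N\<^esub>s\<in>{s. f s \<noteq> \<zero>}. f s \<odot>\<^bsub>N\<^esub> \<beta> s)"
      using f' r \<beta> by (intro N.finsum_smult_ldistr[symmetric]) auto
    finally show "linear_extension N \<beta> (r \<odot>\<^bsub>?F\<^esub> f) = r \<odot>\<^bsub>N\<^esub> linear_extension N \<beta> f"
      by (simp add: free_module_def linear_extension_def)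
  qed
qed

lemma linear_extension_gen:
  assumes N: "module R N" and \<beta>: "\<beta> s \<in> carrier N"
  shows "linear_extension N \<beta> (free_gen R s) = \<beta> s"
proof -
  interpret N: module R N by (rule N)
  have "\<beta> s = \<zero>\<^bsub>N\<^esub>" if "\<one> = \<zero>"
    using N.smult_one[OF \<beta>] N.smult_l_null[OF \<beta>] that by simp
  then have "linear_extension N \<beta> (free_gen R s) = (\<Oplus>\<^bsub>N\<^esub>t\<in>{s}. free_gen R s t \<odot>\<^bsub>N\<^esub> \<beta> t)"
    unfolding linear_extension_def using \<beta>
    by (intro N.add.finprod_mono_neutral_cong_left) (auto simp: free_gen_def)
  then show ?thesis using \<beta> by (simp add: free_gen_def)
qed

end

locale tensor_pair = M: module R M + N: module R N for R M N
begin

abbreviation "Free \<equiv> free_module R (carrier M \<times> carrier N)"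
abbreviation "Rel \<equiv> tensor_relations R M N"
abbreviation "T \<equiv> tensor_product R M N"
abbreviation pure (infixl "\<otimes>\<^sub>T" 70) where "x \<otimes>\<^sub>T y \<equiv> pure_tensor R M N x y"

sublocale F: module R Free by (rule M.R.free_module_is_module)

lemma gen_closed [simp]: "x \<in> carrier M \<Longrightarrow> y \<in> carrier N \<Longrightarrow> free_gen R (x, y) \<in> carrier Free"
  by (rule M.R.free_gen_closed) simp

lemmas rel_def = tensor_relations_def[of R M N, unfolded Let_def]

lemma rel_submodule: "submodule Rel R Free"
  unfolding rel_def by (rule F.span_submodule) auto

sublocale T: module R T
  unfolding tensor_product_def by (rule F.quotient_is_module[OF rel_submodule])

text \<open>The relations are the span of four families, so a linear map sends them into a submodule \<open>P\<close> once
  it does so on these families.  With \<open>P\<close> the relations themselves this gives functoriality of the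
  tensor product, with \<open>P = 0\<close> its universal property.\<close>

lemma rel_hom_range:
  assumes L: "module R L" and P: "submodule P R L" and f: "f \<in> module_hom R Free L"
    and "\<And>x x' y. x \<in> carrier M \<Longrightarrow> x' \<in> carrier M \<Longrightarrow> y \<in> carrier N \<Longrightarrow>
      f (free_gen R (x \<oplus>\<^bsub>M\<^esub> x', y)) \<ominus>\<^bsub>L\<^esub> (f (free_gen R (x, y)) \<oplus>\<^bsub>L\<^esub> f (free_gen R (x', y))) \<in> P"
    and "\<And>x y y'. x \<in> carrier M \<Longrightarrow> y \<in> carrier N \<Longrightarrow> y' \<in> carrier N \<Longrightarrow>
      f (free_gen R (x, y \<oplus>\<^bsub>N\<^esub> y')) \<ominus>\<^bsub>L\<^esub> (f (free_gen R (x, y)) \<oplus>\<^bsub>L\<^esub> f (free_gen R (x, y'))) \<in> P"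
    and "\<And>r x y. r \<in> carrier R \<Longrightarrow> x \<in> carrier M \<Longrightarrow> y \<in> carrier N \<Longrightarrow>
      f (free_gen R (r \<odot>\<^bsub>M\<^esub> x, y)) \<ominus>\<^bsub>L\<^esub> r \<odot>\<^bsub>L\<^esub> f (free_gen R (x, y)) \<in> P"
    and "\<And>r x y. r \<in> carrier R \<Longrightarrow> x \<in> carrier M \<Longrightarrow> y \<in> carrier N \<Longrightarrow>
      f (free_gen R (x, r \<odot>\<^bsub>N\<^esub> y)) \<ominus>\<^bsub>L\<^esub> r \<odot>\<^bsub>L\<^esub> f (free_gen R (x, y)) \<in> P"
    and z: "z \<in> Rel"
  shows "f z \<in> P"
proof -
  interpret L: module R L by (rule L)
  note hom = module_hom_minus[OF F.module_axioms L f] module_hom_add[OF f] module_hom_smult[OF f]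
  show ?thesis
    using z unfolding rel_def
    by (rule F.span_hom_range[OF L f P, rotated 2]) (auto simp: hom assms(4-7))
qed

lemma rel_generators:
  shows "x \<in> carrier M \<Longrightarrow> x' \<in> carrier M \<Longrightarrow> y \<in> carrier N \<Longrightarrow>
      free_gen R (x \<oplus>\<^bsub>M\<^esub> x', y) \<ominus>\<^bsub>Free\<^esub> (free_gen R (x, y) \<oplus>\<^bsub>Free\<^esub> free_gen R (x', y)) \<in> Rel"
    and "x \<in> carrier M \<Longrightarrow> y \<in> carrier N \<Longrightarrow> y' \<in> carrier N \<Longrightarrow>
      free_gen R (x, y \<oplus>\<^bsub>N\<^esub> y') \<ominus>\<^bsub>Free\<^esub> (free_gen R (x, y) \<oplus>\<^bsub>Free\<^esub> free_gen R (x, y')) \<in> Rel"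
    and "r \<in> carrier R \<Longrightarrow> x \<in> carrier M \<Longrightarrow> y \<in> carrier N \<Longrightarrow>
      free_gen R (r \<odot>\<^bsub>M\<^esub> x, y) \<ominus>\<^bsub>Free\<^esub> r \<odot>\<^bsub>Free\<^esub> free_gen R (x, y) \<in> Rel"
    and "r \<in> carrier R \<Longrightarrow> x \<in> carrier M \<Longrightarrow> y \<in> carrier N \<Longrightarrow>
      free_gen R (x, r \<odot>\<^bsub>N\<^esub> y) \<ominus>\<^bsub>Free\<^esub> r \<odot>\<^bsub>Free\<^esub> free_gen R (x, y) \<in> Rel"
  unfolding rel_def by (rule F.span_mem, blast)+

lemma pure_closed [simp]: "x \<in> carrier M \<Longrightarrow> y \<in> carrier N \<Longrightarrow> x \<otimes>\<^sub>T y \<in> carrier T"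
  unfolding pure_tensor_def tensor_product_def
  by (rule F.quotient_carrierI[OF rel_submodule]) simp

lemma T_add: "X \<oplus>\<^bsub>T\<^esub> Y = X <+>\<^bsub>Free\<^esub> Y"
  by (simp add: tensor_product_def)

lemma pure_add_left:
  assumes "x \<in> carrier M" "x' \<in> carrier M" "y \<in> carrier N"
  shows "(x \<oplus>\<^bsub>M\<^esub> x') \<otimes>\<^sub>T y = x \<otimes>\<^sub>T y \<oplus>\<^bsub>T\<^esub> x' \<otimes>\<^sub>T y"
  using rel_generators(1)[OF assms] assms unfolding pure_tensor_def T_add
  by (simp add: F.coset_add[OF rel_submodule] F.coset_eq_iff[OF rel_submodule])

lemma pure_add_right:
  assumes "x \<in> carrier M" "y \<in> carrier N" "y' \<in> carrier N"
  shows "x \<otimes>\<^sub>T (y \<oplus>\<^bsub>N\<^esub> y') = x \<otimes>\<^sub>T y \<oplus>\<^bsub>T\<^esub> x \<otimes>\<^sub>T y'"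
  using rel_generators(2)[OF assms] assms unfolding pure_tensor_def T_add
  by (simp add: F.coset_add[OF rel_submodule] F.coset_eq_iff[OF rel_submodule])

lemma pure_smult_left:
  assumes "r \<in> carrier R" "x \<in> carrier M" "y \<in> carrier N"
  shows "(r \<odot>\<^bsub>M\<^esub> x) \<otimes>\<^sub>T y = r \<odot>\<^bsub>T\<^esub> (x \<otimes>\<^sub>T y)"
  using rel_generators(3)[OF assms] assms unfolding pure_tensor_def tensor_product_def
  by (simp add: F.coset_smult[OF rel_submodule] F.coset_eq_iff[OF rel_submodule])

lemma pure_smult_right:
  assumes "r \<in> carrier R" "x \<in> carrier M" "y \<in> carrier N"
  shows "x \<otimes>\<^sub>T (r \<odot>\<^bsub>N\<^esub> y) = r \<odot>\<^bsub>T\<^esub> (x \<otimes>\<^sub>T y)"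
  using rel_generators(4)[OF assms] assms unfolding pure_tensor_def tensor_product_def
  by (simp add: F.coset_smult[OF rel_submodule] F.coset_eq_iff[OF rel_submodule])

lemma pure_hom_left: "y \<in> carrier N \<Longrightarrow> (\<lambda>x. x \<otimes>\<^sub>T y) \<in> module_hom R M T"
  by (intro module_homI) (auto simp: pure_add_left pure_smult_left)

lemma pure_hom_right: "x \<in> carrier M \<Longrightarrow> (\<lambda>y. x \<otimes>\<^sub>T y) \<in> module_hom R N T"
  by (intro module_homI) (auto simp: pure_add_right pure_smult_right)

definition "pures = {x \<otimes>\<^sub>T y | x y. x \<in> carrier M \<and> y \<in> carrier N}"

lemma pures_closed: "pures \<subseteq> carrier T"
  unfolding pures_def by auto

text \<open>The induction principle of the tensor product: with it, identities between linear maps and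
  membership in submodules are checked on pure tensors only.\<close>

lemma tensor_spanned: "module_span R T pures = carrier T"
proof
  show "module_span R T pures \<subseteq> carrier T"
    using T.submoduleE(1)[OF T.span_submodule[OF pures_closed]] .
  show "carrier T \<subseteq> module_span R T pures"
  proof
    fix X assume "X \<in> carrier T"
    then obtain f where f: "f \<in> carrier Free" "X = Rel +>\<^bsub>Free\<^esub> f"
      unfolding tensor_product_def by (rule F.quotient_carrierE[OF rel_submodule])
    have hom: "(\<lambda>f. Rel +>\<^bsub>Free\<^esub> f) \<in> module_hom R Free T"
      unfolding tensor_product_def by (rule F.coset_hom[OF rel_submodule])
    have gen: "Rel +>\<^bsub>Free\<^esub> free_gen R s \<in> module_span R T pures" if "s \<in> carrier M \<times> carrier N" for s
      using that by (intro T.span_mem) (auto simp: pures_def pure_tensor_def)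
    have "f \<in> {f \<in> carrier Free. Rel +>\<^bsub>Free\<^esub> f \<in> module_span R T pures}"
    proof (rule M.R.free_module_spanned[OF _ _ f(1)])
      show "submodule {f \<in> carrier Free. Rel +>\<^bsub>Free\<^esub> f \<in> module_span R T pures} R Free"
        by (rule F.preimage_submodule[OF T.module_axioms hom T.span_submodule[OF pures_closed]])
    qed (use gen gen_closed in auto)
    then show "X \<in> module_span R T pures" using f(2) by simp
  qed
qed

lemma tensor_hom_eqI:
  assumes "module R L" "f \<in> module_hom R T L" "g \<in> module_hom R T L"
    and "\<And>x y. x \<in> carrier M \<Longrightarrow> y \<in> carrier N \<Longrightarrow> f (x \<otimes>\<^sub>T y) = g (x \<otimes>\<^sub>T y)"
    and "t \<in> carrier T"
  shows "f t = g t"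
  using T.span_hom_eqI[OF assms(1-3) pures_closed] assms(4,5) tensor_spanned
  unfolding pures_def by auto

lemma tensor_hom_range:
  assumes "module R L" "f \<in> module_hom R T L" "submodule P R L"
    and "\<And>x y. x \<in> carrier M \<Longrightarrow> y \<in> carrier N \<Longrightarrow> f (x \<otimes>\<^sub>T y) \<in> P"
    and "t \<in> carrier T"
  shows "f t \<in> P"
  using T.span_hom_range[OF assms(1-3) pures_closed] assms(4,5) tensor_spanned
  unfolding pures_def by auto

lemma tensor_map_hom_pure:
  assumes h: "h \<in> module_hom R M M"
  shows "tensor_map R M N h \<in> module_hom R T T"
    and "x \<in> carrier M \<Longrightarrow> y \<in> carrier N \<Longrightarrow> tensor_map R M N h (x \<otimes>\<^sub>T y) = h x \<otimes>\<^sub>T y"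
proof -
  let ?g = "free_push R (map_prod h id)"
  note [simp] = module_hom_closed[OF h] module_hom_add[OF h] module_hom_smult[OF h]
  have g: "?g \<in> module_hom R Free Free" by (rule M.R.free_push_hom) auto
  have sub: "?g ` Rel \<subseteq> Rel"
    using rel_hom_range[OF F.module_axioms rel_submodule g]
    by (auto simp: M.R.free_push_gen rel_generators)
  show "tensor_map R M N h \<in> module_hom R T T"
    using F.coset_image_hom[OF rel_submodule F.module_axioms rel_submodule g sub]
    unfolding tensor_map_def[abs_def] tensor_product_def .
  assume "x \<in> carrier M" "y \<in> carrier N"
  then show "tensor_map R M N h (x \<otimes>\<^sub>T y) = h x \<otimes>\<^sub>T y"
    using F.coset_image[OF rel_submodule F.module_axioms rel_submodule g sub, of "free_gen R (x, y)"]
    unfolding tensor_map_def pure_tensor_def by (simp add: M.R.free_push_gen)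
qed

lemma tensor_universal:
  assumes L: "module R L"
    and left: "\<And>y. y \<in> carrier N \<Longrightarrow> (\<lambda>x. \<beta> x y) \<in> module_hom R M L"
    and right: "\<And>x. x \<in> carrier M \<Longrightarrow> \<beta> x \<in> module_hom R N L"
  obtains \<Lambda> where "\<Lambda> \<in> module_hom R T L"
    "\<And>x y. x \<in> carrier M \<Longrightarrow> y \<in> carrier N \<Longrightarrow> \<Lambda> (x \<otimes>\<^sub>T y) = \<beta> x y"
proof -
  interpret L: module R L by (rule L)
  let ?e = "M.R.linear_extension L (case_prod \<beta>)"
  have \<beta>: "\<beta> x y \<in> carrier L" if "x \<in> carrier M" "y \<in> carrier N" for x y
    using module_hom_closed[OF right] that .
  have e: "?e \<in> module_hom R Free L"
    using \<beta> by (intro M.R.linear_extension_hom[OF L]) auto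
  have gen: "?e (free_gen R (x, y)) = \<beta> x y" if "x \<in> carrier M" "y \<in> carrier N" for x y
    using M.R.linear_extension_gen[OF L, of "case_prod \<beta>" "(x, y)"] \<beta>[OF that] by simp
  have zero_sub: "submodule {\<zero>\<^bsub>L\<^esub>} R L" by (rule L.submoduleI) auto
  have kill: "?e z = \<zero>\<^bsub>L\<^esub>" if "z \<in> Rel" for z
  proof -
    have "?e z \<in> {\<zero>\<^bsub>L\<^esub>}"
      using that
      by (rule rel_hom_range[OF L zero_sub e, rotated 4])
         (auto simp: gen \<beta> module_hom_add[OF left] module_hom_smult[OF left]
            module_hom_add[OF right] module_hom_smult[OF right] a_minus_def L.r_neg)
    then show ?thesis by simp
  qed
  \<comment> \<open>Any representative of a coset gives the same value, since the relations are killed.\<close>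
  define \<Lambda> where "\<Lambda> X = ?e (SOME f. f \<in> X)" for X
  have \<Lambda>: "\<Lambda> (Rel +>\<^bsub>Free\<^esub> f) = ?e f" if f: "f \<in> carrier Free" for f
  proof -
    let ?f = "SOME g. g \<in> Rel +>\<^bsub>Free\<^esub> f"
    have "?f \<in> Rel +>\<^bsub>Free\<^esub> f"
      using F.coset_self[OF rel_submodule f] by (rule someI[where P = "\<lambda>g. g \<in> Rel +>\<^bsub>Free\<^esub> f"])
    then obtain k where k: "k \<in> Rel" "?f = k \<oplus>\<^bsub>Free\<^esub> f" by (auto simp: a_r_coset_def')
    then have "k \<in> carrier Free" using F.submoduleE(1)[OF rel_submodule] by auto
    then show ?thesis
      unfolding \<Lambda>_def k(2) using f kill[OF k(1)] module_hom_closed[OF e f]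
      by (simp add: module_hom_add[OF e])
  qed
  show ?thesis
  proof
    show "\<Lambda> \<in> module_hom R T L"
      unfolding tensor_product_def
      by (intro module_homI)
         (auto elim!: F.quotient_carrierE[OF rel_submodule] simp: \<Lambda> module_hom_closed[OF e]
           F.coset_add[OF rel_submodule] F.coset_smult[OF rel_submodule]
           module_hom_add[OF e] module_hom_smult[OF e])
    show "\<Lambda> (x \<otimes>\<^sub>T y) = \<beta> x y" if "x \<in> carrier M" "y \<in> carrier N" for x y
      unfolding pure_tensor_def using \<Lambda> gen that by simp
  qed
qed

end


section \<open>Laurent polynomials acting on bi-infinite series\<close>

locale coefficients = cring A for A (structure)
begin

abbreviation "L \<equiv> laurent_ring A"
abbreviation "Series \<equiv> biinfinite_series A"
abbreviation supp :: "(int \<Rightarrow> 'a) \<Rightarrow> int set" where "supp f \<equiv> {i. f i \<noteq> \<zero>}"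

lemma series_iff: "f \<in> carrier Series \<longleftrightarrow> (\<forall>i. f i \<in> carrier A)"
  by (simp add: biinfinite_series_def)

lemma laurent_iff: "f \<in> carrier L \<longleftrightarrow> f \<in> carrier Series \<and> finite (supp f)"
  by (simp add: laurent_ring_def biinfinite_series_def)

lemma series_nth [simp]: "f \<in> carrier Series \<Longrightarrow> f i \<in> carrier A"
  by (simp add: series_iff)

lemma laurent_nth [simp]: "f \<in> carrier L \<Longrightarrow> f i \<in> carrier A"
  by (simp add: laurent_iff)

lemma laurent_series: "f \<in> carrier L \<Longrightarrow> f \<in> carrier Series"
  by (simp add: laurent_iff)

lemma convolution_eq:
  assumes "f \<in> carrier L" "g \<in> carrier Series" "finite J" "supp f \<subseteq> J"
  shows "convolution A f g i = (\<Oplus>j\<in>J. f j \<otimes> g (i - j))"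
  unfolding convolution_def using assms
  by (intro add.finprod_mono_neutral_cong_left) auto

lemma convolution_closed:
  assumes "f \<in> carrier L" "g \<in> carrier Series"
  shows "convolution A f g \<in> carrier Series"
proof -
  have "convolution A f g i \<in> carrier A" for i
    unfolding convolution_def using assms by (intro finsum_closed Pi_I m_closed) simp_all
  then show ?thesis by (simp add: series_iff del: series_nth)
qed

lemma convolution_supp:
  assumes f: "f \<in> carrier L" and g: "g \<in> carrier Series"
  shows "supp (convolution A f g) \<subseteq> (\<lambda>(j, k). j + k) ` (supp f \<times> supp g)"
proof
  fix i assume i: "i \<in> supp (convolution A f g)"
  have "\<exists>j\<in>supp f. f j \<otimes> g (i - j) \<noteq> \<zero>"
  proof (rule ccontr)
    assume "\<not> ?thesis"
    then have "convolution A f g i = \<zero>"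
      unfolding convolution_def by (intro add.finprod_one_eqI) auto
    then show False using i by simp
  qed
  then obtain j where j: "j \<in> supp f" "f j \<otimes> g (i - j) \<noteq> \<zero>" by blast
  then have "i - j \<in> supp g" using f by auto
  then have "(\<lambda>(j, k). j + k) (j, i - j) \<in> (\<lambda>(j, k). j + k) ` (supp f \<times> supp g)"
    using j(1) by (intro imageI) simp
  then show "i \<in> (\<lambda>(j, k). j + k) ` (supp f \<times> supp g)" by simp
qed

lemma convolution_laurent:
  "f \<in> carrier L \<Longrightarrow> g \<in> carrier L \<Longrightarrow> convolution A f g \<in> carrier L"
  using finite_subset[OF convolution_supp[of f g]] convolution_closed[of f g]
  by (auto simp: laurent_iff)

lemma convolution_add_right:
  assumes "f \<in> carrier L" "g \<in> carrier Series" "h \<in> carrier Series"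
  shows "convolution A f (\<lambda>i. g i \<oplus> h i) = (\<lambda>i. convolution A f g i \<oplus> convolution A f h i)"
proof
  fix i
  have "convolution A f (\<lambda>i. g i \<oplus> h i) i = (\<Oplus>j\<in>supp f. f j \<otimes> g (i - j) \<oplus> f j \<otimes> h (i - j))"
    unfolding convolution_def using assms by (intro finsum_cong') (auto simp: r_distr)
  then show "convolution A f (\<lambda>i. g i \<oplus> h i) i = convolution A f g i \<oplus> convolution A f h i"
    unfolding convolution_def using assms by (subst (asm) finsum_addf) auto
qed

lemma convolution_add_left:
  assumes f: "f \<in> carrier L" and g: "g \<in> carrier L" and h: "h \<in> carrier Series"
  shows "convolution A (\<lambda>i. f i \<oplus> g i) h = (\<lambda>i. convolution A f h i \<oplus> convolution A g h i)"
proof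
  fix i
  let ?J = "supp f \<union> supp g"
  have J: "finite ?J" using f g by (simp add: laurent_iff)
  have sub: "supp (\<lambda>i. f i \<oplus> g i) \<subseteq> ?J" by auto
  have "(\<lambda>i. f i \<oplus> g i) \<in> carrier Series" using f g by (simp add: series_iff[of "\<lambda>i. f i \<oplus> g i"])
  then have "(\<lambda>i. f i \<oplus> g i) \<in> carrier L"
    using finite_subset[OF sub J] by (simp add: laurent_iff[of "\<lambda>i. f i \<oplus> g i"])
  then have "convolution A (\<lambda>i. f i \<oplus> g i) h i = (\<Oplus>j\<in>?J. (f j \<oplus> g j) \<otimes> h (i - j))"
    using f g h J by (intro convolution_eq) auto
  also have "\<dots> = (\<Oplus>j\<in>?J. f j \<otimes> h (i - j) \<oplus> g j \<otimes> h (i - j))"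
    using f g h by (intro finsum_cong') (auto simp: l_distr)
  also have "\<dots> = (\<Oplus>j\<in>?J. f j \<otimes> h (i - j)) \<oplus> (\<Oplus>j\<in>?J. g j \<otimes> h (i - j))"
    using f g h by (intro finsum_addf) auto
  also have "\<dots> = convolution A f h i \<oplus> convolution A g h i"
    using convolution_eq[OF f h J] convolution_eq[OF g h J] by auto
  finally show "convolution A (\<lambda>i. f i \<oplus> g i) h i = convolution A f h i \<oplus> convolution A g h i" .
qed

lemma convolution_assoc:
  assumes f: "f \<in> carrier L" and g: "g \<in> carrier L" and h: "h \<in> carrier Series"
  shows "convolution A (convolution A f g) h = convolution A f (convolution A g h)"
proof
  fix i
  let ?S = "(\<lambda>(j, k). j + k) ` (supp f \<times> supp g)"
  have fin: "finite (supp f)" "finite ?S" using f g by (auto simp: laurent_iff)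
  have gS: "g \<in> carrier Series" using g by (rule laurent_series)
  have "convolution A (convolution A f g) h i = (\<Oplus>s\<in>?S. convolution A f g s \<otimes> h (i - s))"
    using convolution_eq[OF convolution_laurent[OF f g] h fin(2) convolution_supp[OF f gS]] .
  also have "\<dots> = (\<Oplus>s\<in>?S. \<Oplus>j\<in>supp f. f j \<otimes> (g (s - j) \<otimes> h (i - s)))"
    using fin f g h unfolding convolution_def
    by (intro finsum_cong') (auto intro!: finsum_closed finsum_cong' simp: finsum_ldistr m_assoc)
  also have "\<dots> = (\<Oplus>j\<in>supp f. \<Oplus>s\<in>?S. f j \<otimes> (g (s - j) \<otimes> h (i - s)))"
    using fin f g h by (intro finsum_swap) auto
  also have "\<dots> = (\<Oplus>j\<in>supp f. f j \<otimes> convolution A g h (i - j))"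
  proof (intro finsum_cong')
    fix j assume j: "j \<in> supp f"
    \<comment> \<open>For fixed \<open>j\<close> only the exponents \<open>s = j + k\<close> with \<open>k\<close> in the support of \<open>g\<close> contribute.\<close>
    have "(\<Oplus>s\<in>?S. g (s - j) \<otimes> h (i - s)) = (\<Oplus>s\<in>(\<lambda>k. j + k) ` supp g. g (s - j) \<otimes> h (i - s))"
    proof (intro add.finprod_mono_neutral_cong_right)
      show "\<And>s. s \<in> ?S - (+) j ` supp g \<Longrightarrow> g (s - j) \<otimes> h (i - s) = \<zero>"
      proof -
        fix s assume "s \<in> ?S - (+) j ` supp g"
        then have "s - j \<notin> supp g" by (auto simp: image_iff)
        then show "g (s - j) \<otimes> h (i - s) = \<zero>" using h by simp
      qed
    qed (use fin g h j in auto)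
    also have "\<dots> = (\<Oplus>k\<in>supp g. g ((j + k) - j) \<otimes> h (i - (j + k)))"
      using g h by (intro finsum_reindex) (auto simp: inj_on_def)
    also have "\<dots> = convolution A g h (i - j)"
      unfolding convolution_def by (simp add: algebra_simps)
    finally have inner: "(\<Oplus>s\<in>?S. g (s - j) \<otimes> h (i - s)) = convolution A g h (i - j)" .
    have "(\<Oplus>s\<in>?S. f j \<otimes> (g (s - j) \<otimes> h (i - s))) = f j \<otimes> (\<Oplus>s\<in>?S. g (s - j) \<otimes> h (i - s))"
      using fin f g h by (intro finsum_rdistr[symmetric]) auto
    then show "(\<Oplus>s\<in>?S. f j \<otimes> (g (s - j) \<otimes> h (i - s))) = f j \<otimes> convolution A g h (i - j)"
      using inner by simp
  qed (use f convolution_closed[OF g h] in auto)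
  also have "\<dots> = convolution A f (convolution A g h) i"
    by (simp add: convolution_def)
  finally show "convolution A (convolution A f g) h i = convolution A f (convolution A g h) i" .
qed

lemma convolution_comm:
  assumes f: "f \<in> carrier L" and g: "g \<in> carrier L"
  shows "convolution A f g = convolution A g f"
proof
  fix i
  let ?J = "supp f \<union> (\<lambda>k. i - k) ` supp g"
  have fin: "finite ?J" using f g by (simp add: laurent_iff)
  have "convolution A f g i = (\<Oplus>j\<in>?J. f j \<otimes> g (i - j))"
    using f laurent_series[OF g] fin by (intro convolution_eq) auto
  also have "\<dots> = (\<Oplus>j\<in>?J. g (i - j) \<otimes> f (i - (i - j)))"
    using f g by (intro finsum_cong') (auto simp: m_comm)
  also have "\<dots> = (\<Oplus>k\<in>(\<lambda>j. i - j) ` ?J. g k \<otimes> f (i - k))"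
    using f g by (intro finsum_reindex[symmetric]) (auto simp: inj_on_def)
  also have "\<dots> = convolution A g f i"
  proof (rule convolution_eq[symmetric])
    show "supp g \<subseteq> (\<lambda>j. i - j) ` ?J" by (auto simp: image_Un image_image)
  qed (use f g fin laurent_series in auto)
  finally show "convolution A f g i = convolution A g f i" .
qed

lemma convolution_monom:
  assumes "g \<in> carrier Series"
  shows "convolution A (\<lambda>i. if i = 0 then \<one> else \<zero>) g = g"
proof
  fix i
  have "convolution A (\<lambda>i. if i = 0 then \<one> else \<zero>) g i
      = (\<Oplus>j\<in>{0}. (if j = 0 then \<one> else \<zero>) \<otimes> g (i - j))"
    using assms by (intro convolution_eq) (auto simp: laurent_iff series_iff simp del: series_nth laurent_nth)
  then show "convolution A (\<lambda>i. if i = 0 then \<one> else \<zero>) g i = g i" using assms by simp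
qed

lemma laurent_simps [simp]:
  "\<zero>\<^bsub>L\<^esub> = (\<lambda>i. \<zero>)" "f \<oplus>\<^bsub>L\<^esub> g = (\<lambda>i. f i \<oplus> g i)" "f \<otimes>\<^bsub>L\<^esub> g = convolution A f g"
  "\<one>\<^bsub>L\<^esub> = (\<lambda>i. if i = 0 then \<one> else \<zero>)"
  unfolding laurent_ring_def by (simp_all only: ring.simps monoid.simps)

lemma series_simps [simp]:
  "\<zero>\<^bsub>Series\<^esub> = (\<lambda>i. \<zero>)" "f \<oplus>\<^bsub>Series\<^esub> g = (\<lambda>i. f i \<oplus> g i)"
  "f \<odot>\<^bsub>Series\<^esub> g = convolution A f g"
  unfolding biinfinite_series_def by (simp_all only: module.simps ring.simps monoid.simps)

lemma laurent_one: "(\<lambda>i. if i = 0 then \<one> else \<zero>) \<in> carrier L"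
  by (auto simp: laurent_iff series_iff simp del: series_nth laurent_nth)

lemma laurent_cring: "cring L"
proof (rule cringI)
  have fin: "finite (supp (\<lambda>i. f i \<oplus> g i))" if "f \<in> carrier L" "g \<in> carrier L" for f g
    using that by (auto simp: laurent_iff intro: finite_subset[of _ "supp f \<union> supp g"])
  show "abelian_group L"
  proof (rule abelian_groupI)
    fix f assume f: "f \<in> carrier L"
    then have "(\<lambda>i. \<ominus> f i) \<in> carrier L"
      by (auto simp: laurent_iff series_iff simp del: series_nth laurent_nth elim!: finite_subset[rotated])
    moreover have "(\<lambda>i. \<ominus> f i) \<oplus>\<^bsub>L\<^esub> f = \<zero>\<^bsub>L\<^esub>"
      using f by (auto simp: l_neg)
    ultimately show "\<exists>g\<in>carrier L. g \<oplus>\<^bsub>L\<^esub> f = \<zero>\<^bsub>L\<^esub>" by blast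
  next
    fix f g assume "f \<in> carrier L" "g \<in> carrier L"
    then show "f \<oplus>\<^bsub>L\<^esub> g \<in> carrier L"
      using fin[of f g] by (auto simp: laurent_iff series_iff simp del: series_nth laurent_nth)
  qed (auto simp: laurent_iff series_iff fun_eq_iff a_ac simp del: series_nth laurent_nth)
  show "comm_monoid L"
  proof (rule comm_monoidI)
    fix f g h assume "f \<in> carrier L" "g \<in> carrier L" "h \<in> carrier L"
    then show "f \<otimes>\<^bsub>L\<^esub> g \<otimes>\<^bsub>L\<^esub> h = f \<otimes>\<^bsub>L\<^esub> (g \<otimes>\<^bsub>L\<^esub> h)"
      by (simp add: convolution_assoc laurent_series)
    show "f \<otimes>\<^bsub>L\<^esub> g = g \<otimes>\<^bsub>L\<^esub> f"
      using \<open>f \<in> carrier L\<close> \<open>g \<in> carrier L\<close> by (simp add: convolution_comm)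
  qed (simp_all add: convolution_laurent laurent_one convolution_monom laurent_series)
  fix f g h assume "f \<in> carrier L" "g \<in> carrier L" "h \<in> carrier L"
  then show "(f \<oplus>\<^bsub>L\<^esub> g) \<otimes>\<^bsub>L\<^esub> h = f \<otimes>\<^bsub>L\<^esub> h \<oplus>\<^bsub>L\<^esub> g \<otimes>\<^bsub>L\<^esub> h"
    by (simp add: convolution_add_left laurent_series)
qed

lemma series_module: "module L Series"
proof (rule moduleI[OF laurent_cring])
  show "abelian_group Series"
  proof (rule abelian_groupI)
    fix f assume f: "f \<in> carrier Series"
    have "(\<lambda>i. \<ominus> f i) \<in> carrier Series" "(\<lambda>i. \<ominus> f i) \<oplus>\<^bsub>Series\<^esub> f = \<zero>\<^bsub>Series\<^esub>"
      using f by (auto simp: series_iff l_neg simp del: series_nth laurent_nth)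
    then show "\<exists>g\<in>carrier Series. g \<oplus>\<^bsub>Series\<^esub> f = \<zero>\<^bsub>Series\<^esub>" by blast
  qed (auto simp: series_iff fun_eq_iff a_ac simp del: series_nth laurent_nth)
qed (simp_all add: convolution_closed convolution_add_left convolution_add_right convolution_assoc
      convolution_monom)

sublocale L: cring L by (rule laurent_cring)
sublocale Series: module L Series by (rule series_module)

text \<open>The series bounded below are the Laurent series in \<open>q\<close>, those bounded above the Laurent series in
  \<open>q\<inverse>\<close>.  Together they span all bi-infinite series, and what they have in common are the Laurent
  polynomials.\<close>

definition below :: "(int \<Rightarrow> 'a) set"
  where "below = {f \<in> carrier Series. \<exists>N. \<forall>i<N. f i = \<zero>}"

definition above :: "(int \<Rightarrow> 'a) set"
  where "above = {f \<in> carrier Series. \<exists>N. \<forall>i>N. f i = \<zero>}"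

text \<open>The scalars that become invertible on both halves.  On all bi-infinite series such a scalar still
  has a kernel, and this kernel is where the cohomology with coefficients in series comes from.  The
  definition speaks of the action instead of the coefficients because it is then visibly closed
  under products.\<close>

definition half_invertible :: "(int \<Rightarrow> 'a) \<Rightarrow> bool"
  where "half_invertible s \<longleftrightarrow> s \<in> carrier L \<and>
    bij_betw (convolution A s) below below \<and> bij_betw (convolution A s) above above"

text \<open>The substitution of \<open>q\<inverse>\<close> for \<open>q\<close>.  It is compatible with products and exchanges the two halves, so
  that statements about the second half follow from those about the first.\<close>

definition flip :: "(int \<Rightarrow> 'a) \<Rightarrow> int \<Rightarrow> 'a"
  where "flip f i = f (- i)"

lemma flip_flip [simp]: "flip (flip f) = f"
  by (simp add: flip_def fun_eq_iff)

lemma supp_flip: "supp (flip f) = uminus ` supp f"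
  by (auto simp: flip_def image_iff) (metis add.inverse_inverse)

lemma flip_series [simp]: "flip f \<in> carrier Series \<longleftrightarrow> f \<in> carrier Series"
  by (auto simp: series_iff flip_def simp del: series_nth laurent_nth) (metis add.inverse_inverse)

lemma flip_laurent [simp]: "flip f \<in> carrier L \<longleftrightarrow> f \<in> carrier L"
  by (auto simp: laurent_iff supp_flip finite_image_iff)

lemma flip_convolution:
  assumes "f \<in> carrier L" "g \<in> carrier Series"
  shows "convolution A (flip f) (flip g) = flip (convolution A f g)"
proof
  fix i
  have "convolution A (flip f) (flip g) i = (\<Oplus>j\<in>supp f. flip f (- j) \<otimes> flip g (i - (- j)))"
    unfolding convolution_def supp_flip using assms
    by (intro finsum_reindex) (auto simp: flip_def)
  then show "convolution A (flip f) (flip g) i = flip (convolution A f g) i"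
    by (simp add: convolution_def flip_def)
qed

lemma flip_above: "above = flip ` below"
proof
  show "above \<subseteq> flip ` below"
  proof
    fix f assume "f \<in> above"
    then obtain N where "f \<in> carrier Series" "\<forall>i>N. f i = \<zero>" by (auto simp: above_def)
    then have "flip f \<in> below" by (auto simp: below_def flip_def intro!: exI[of _ "-N"])
    then show "f \<in> flip ` below" by (metis flip_flip imageI)
  qed
  show "flip ` below \<subseteq> above"
  proof
    fix f assume "f \<in> flip ` below"
    then obtain g N where g: "f = flip g" "g \<in> carrier Series" "\<forall>i<N. g i = \<zero>" by (auto simp: below_def)
    then show "f \<in> above" by (auto simp: above_def flip_def[of g] intro!: exI[of _ "-N"])
  qed
qed

lemma below_series: "f \<in> below \<Longrightarrow> f \<in> carrier Series"
  by (simp add: below_def)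

lemma above_series: "f \<in> above \<Longrightarrow> f \<in> carrier Series"
  by (simp add: above_def)

lemma convolution_below:
  assumes s: "s \<in> carrier L" and f: "f \<in> below"
  shows "convolution A s f \<in> below"
proof -
  obtain N where N: "f \<in> carrier Series" "\<And>i. i < N \<Longrightarrow> f i = \<zero>" using f by (auto simp: below_def)
  have fin: "finite (supp s)" using s by (simp add: laurent_iff)
  obtain k where k: "\<And>j. j \<in> supp s \<Longrightarrow> k \<le> j"
    using fin Min_le[OF fin] by blast
  have "convolution A s f i = \<zero>" if "i < k + N" for i
    unfolding convolution_def
  proof (rule add.finprod_one_eqI)
    fix j assume "j \<in> supp s"
    then have "i - j < N" using k[of j] that by linarith
    then show "s j \<otimes> f (i - j) = \<zero>" using N s by simp
  qed
  then show ?thesis using convolution_closed[OF s N(1)] by (auto simp: below_def)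
qed

lemma series_submoduleI:
  assumes sub: "X \<subseteq> carrier Series" and zero: "\<zero>\<^bsub>Series\<^esub> \<in> X"
    and add: "\<And>f g. f \<in> X \<Longrightarrow> g \<in> X \<Longrightarrow> f \<oplus>\<^bsub>Series\<^esub> g \<in> X"
    and smult: "\<And>s f. s \<in> carrier L \<Longrightarrow> f \<in> X \<Longrightarrow> convolution A s f \<in> X"
  shows "submodule X L Series"
proof (rule Series.submoduleI[OF sub zero _ add])
  show smult': "s \<odot>\<^bsub>Series\<^esub> f \<in> X" if "s \<in> carrier L" "f \<in> X" for s f
    using smult[OF that] by simp
  show "\<ominus>\<^bsub>Series\<^esub> f \<in> X" if "f \<in> X" for f
    using smult'[of "\<ominus>\<^bsub>L\<^esub> \<one>\<^bsub>L\<^esub>" f] that subsetD[OF sub that]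
    by (simp add: Series.smult_l_minus del: laurent_simps series_simps)
qed

lemma below_submodule: "submodule below L Series"
proof (rule series_submoduleI)
  show "below \<subseteq> carrier Series" by (auto simp: below_def)
  show "\<zero>\<^bsub>Series\<^esub> \<in> below" by (auto simp: below_def series_iff simp del: series_nth laurent_nth)
  have add: "f \<oplus>\<^bsub>Series\<^esub> g \<in> below" if fg: "f \<in> below" "g \<in> below" for f g
  proof -
    obtain N N' where "f \<in> carrier Series" "\<forall>i<N. f i = \<zero>" "g \<in> carrier Series" "\<forall>i<N'. g i = \<zero>"
      using fg unfolding below_def by blast
    then show ?thesis by (auto simp: below_def series_iff simp del: series_nth laurent_nth
          intro!: exI[of _ "min N N'"])
  qed
  then show "\<And>f g. f \<in> below \<Longrightarrow> g \<in> below \<Longrightarrow> f \<oplus>\<^bsub>Series\<^esub> g \<in> below" .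
  show "\<And>s f. s \<in> carrier L \<Longrightarrow> f \<in> below \<Longrightarrow> convolution A s f \<in> below"
    by (rule convolution_below)
qed

lemma convolution_above:
  assumes s: "s \<in> carrier L" and f: "f \<in> above"
  shows "convolution A s f \<in> above"
proof -
  obtain g where g: "g \<in> below" "f = flip g" using f by (auto simp: flip_above)
  then have "convolution A s f = flip (convolution A (flip s) g)"
    using flip_convolution[of "flip s" g] s below_series by simp
  then show ?thesis using convolution_below[of "flip s" g] g s by (simp add: flip_above)
qed

lemma above_submodule: "submodule above L Series"
proof (rule series_submoduleI)
  show "above \<subseteq> carrier Series" by (auto simp: above_def)
  show "\<zero>\<^bsub>Series\<^esub> \<in> above" by (auto simp: above_def series_iff simp del: series_nth laurent_nth)
  have add: "f \<oplus>\<^bsub>Series\<^esub> g \<in> above" if fg: "f \<in> above" "g \<in> above" for f g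
  proof -
    obtain N N' where "f \<in> carrier Series" "\<forall>i>N. f i = \<zero>" "g \<in> carrier Series" "\<forall>i>N'. g i = \<zero>"
      using fg unfolding above_def by blast
    then show ?thesis by (auto simp: above_def series_iff simp del: series_nth laurent_nth
          intro!: exI[of _ "max N N'"])
  qed
  then show "\<And>f g. f \<in> above \<Longrightarrow> g \<in> above \<Longrightarrow> f \<oplus>\<^bsub>Series\<^esub> g \<in> above" .
  show "\<And>s f. s \<in> carrier L \<Longrightarrow> f \<in> above \<Longrightarrow> convolution A s f \<in> above"
    by (rule convolution_above)
qed

lemma series_split:
  assumes "f \<in> carrier Series"
  obtains g h where "g \<in> below" "h \<in> above" "f = g \<oplus>\<^bsub>Series\<^esub> h"
proof
  show "(\<lambda>i. if i < 0 then \<zero> else f i) \<in> below" "(\<lambda>i. if i < 0 then f i else \<zero>) \<in> above"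
    using assms
    by (auto simp: below_def above_def series_iff simp del: series_nth laurent_nth intro: exI[of _ 0])
  show "f = (\<lambda>i. if i < 0 then \<zero> else f i) \<oplus>\<^bsub>Series\<^esub> (\<lambda>i. if i < 0 then f i else \<zero>)"
    using assms by (auto simp: fun_eq_iff)
qed

lemma below_Int_above: "below \<inter> above = carrier L"
proof
  show "below \<inter> above \<subseteq> carrier L"
  proof
    fix f assume f: "f \<in> below \<inter> above"
    then obtain N N' where "\<forall>i<N. f i = \<zero>" "\<forall>i>N'. f i = \<zero>"
      by (auto simp: below_def above_def)
    then have "supp f \<subseteq> {N..N'}" by (auto simp: not_less[symmetric])
    then show "f \<in> carrier L"
      using f finite_subset by (auto simp: laurent_iff below_def)
  qed
  show "carrier L \<subseteq> below \<inter> above"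
  proof
    fix f assume f: "f \<in> carrier L"
    then have fin: "finite (supp f)" by (simp add: laurent_iff)
    have "\<exists>N. \<forall>i<N. f i = \<zero>" using Min_le[OF fin] by (metis mem_Collect_eq not_le)
    moreover have "\<exists>N. \<forall>i>N. f i = \<zero>" using Max_ge[OF fin] by (metis mem_Collect_eq not_le)
    ultimately show "f \<in> below \<inter> above"
      using laurent_series[OF f] by (simp add: below_def above_def)
  qed
qed

lemma half_invertible_one: "half_invertible \<one>\<^bsub>L\<^esub>"
proof -
  have "bij_betw (convolution A \<one>\<^bsub>L\<^esub>) X X" if "X \<subseteq> carrier Series" for X
    using bij_betw_id[of X] that
    by (subst bij_betw_cong[of X _ id]) (auto simp: convolution_monom)
  then show ?thesis
    unfolding half_invertible_def
    using below_series above_series L.one_closed by (simp add: subset_iff del: laurent_simps)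
qed

lemma half_invertible_mult:
  assumes s: "half_invertible s" and t: "half_invertible t"
  shows "half_invertible (s \<otimes>\<^bsub>L\<^esub> t)"
proof -
  have st: "s \<in> carrier L" "t \<in> carrier L" using s t by (auto simp: half_invertible_def)
  have "bij_betw (convolution A (convolution A s t)) X X"
    if "bij_betw (convolution A s) X X" "bij_betw (convolution A t) X X" "X \<subseteq> carrier Series" for X
    using bij_betw_trans[OF that(2,1)] that(3) st
    by (subst bij_betw_cong[of X _ "convolution A s \<circ> convolution A t"])
       (auto simp: convolution_assoc)
  then show ?thesis
    using s t below_series above_series convolution_laurent[OF st]
    unfolding half_invertible_def by (simp add: subset_iff)
qed

text \<open>A series \<open>x\<close> bounded below with \<open>p x = y\<close> is found coefficient by coefficient, from the lowest one
  upwards: the coefficient of \<open>y\<close> at \<open>i\<close> determines that of \<open>x\<close> at \<open>i - k\<close> from the lower ones, since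
  \<open>p k\<close> is a unit.  The same recursion shows that only \<open>x = 0\<close> solves \<open>p x = 0\<close>.\<close>

lemma convolution_lowest:
  assumes p: "p \<in> carrier L" and k: "p k \<in> Units A" and low: "\<And>j. j < k \<Longrightarrow> p j = \<zero>"
  shows "bij_betw (convolution A p) below below"
proof -
  let ?J = "insert k (supp p - {k})"
  have fin: "finite (supp p)" using p by (simp add: laurent_iff)
  have pk: "p k \<in> carrier A" using k by auto
  have conv: "convolution A p x i = p k \<otimes> x (i - k) \<oplus> (\<Oplus>j\<in>supp p - {k}. p j \<otimes> x (i - j))"
    if "x \<in> carrier Series" for x i
  proof -
    have "convolution A p x i = (\<Oplus>j\<in>?J. p j \<otimes> x (i - j))"
      using fin by (intro convolution_eq[OF p that]) auto
    also have "\<dots> = p k \<otimes> x (i - k) \<oplus> (\<Oplus>j\<in>supp p - {k}. p j \<otimes> x (i - j))"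
      using fin p that by (intro finsum_insert) auto
    finally show ?thesis .
  qed
  have gt: "k < j" if "j \<in> supp p - {k}" for j
    using low[of j] that by (cases j k rule: linorder_cases) auto
  have ker: "x = \<zero>\<^bsub>Series\<^esub>" if x: "x \<in> below" and px: "convolution A p x = \<zero>\<^bsub>Series\<^esub>" for x
  proof -
    obtain N where N: "x \<in> carrier Series" "\<And>i. i < N \<Longrightarrow> x i = \<zero>" using x by (auto simp: below_def)
    have "x (N + int n) = \<zero>" for n
    proof (induction n rule: less_induct)
      case (less n)
      have "x m = \<zero>" if "m < N + int n" for m
      proof (cases "m < N")
        case False
        then have "m = N + int (nat (m - N))" "nat (m - N) < n" using that by auto
        then show ?thesis using less by metis
      qed (rule N(2))
      then have "(\<Oplus>j\<in>supp p - {k}. p j \<otimes> x (N + int n + k - j)) = \<zero>"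
        using gt p by (intro add.finprod_one_eqI) fastforce
      then have "p k \<otimes> x (N + int n) = \<zero>"
        using conv[OF N(1), of "N + int n + k"] px pk N(1) by simp
      then have "inv (p k) \<otimes> (p k \<otimes> x (N + int n)) = \<zero>" using k by simp
      then show ?case using k pk N(1) by (simp add: m_assoc[symmetric] Units_l_inv)
    qed
    then have "x i = \<zero>" for i
      using N(2)[of i] by (cases "i < N") (auto dest: zle_iff_zadd[THEN iffD1] simp: not_less)
    then show ?thesis by auto
  qed
  have hom: "(\<lambda>x. p \<odot>\<^bsub>Series\<^esub> x) \<in> module_hom L Series Series" using Series.smult_hom[OF p] .
  have inj: "inj_on (convolution A p) below"
  proof (rule inj_onI)
    fix x y assume xy: "x \<in> below" "y \<in> below" "convolution A p x = convolution A p y"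
    have c: "x \<in> carrier Series" "y \<in> carrier Series" using xy below_series by auto
    have "p \<odot>\<^bsub>Series\<^esub> (x \<ominus>\<^bsub>Series\<^esub> y) = p \<odot>\<^bsub>Series\<^esub> x \<ominus>\<^bsub>Series\<^esub> p \<odot>\<^bsub>Series\<^esub> y"
      by (rule module_hom_minus[OF series_module series_module hom c])
    also have "\<dots> = \<zero>\<^bsub>Series\<^esub>"
      using xy(3) c p Series.minus_eq_zero_iff convolution_closed by (simp del: series_simps(1))
    finally have "x \<ominus>\<^bsub>Series\<^esub> y = \<zero>\<^bsub>Series\<^esub>"
      using ker[OF Series.submodule_minus[OF below_submodule xy(1,2)]] by simp
    then show "x = y" using Series.minus_eq_zero_iff[OF c] by blast
  qed
  have surj: "\<exists>x\<in>below. convolution A p x = y" if y: "y \<in> below" for y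
  proof -
    obtain N where N: "y \<in> carrier Series" "\<And>i. i < N \<Longrightarrow> y i = \<zero>" using y by (auto simp: below_def)
    \<comment> \<open>The value \<open>X n\<close> is the coefficient of the solution at \<open>N - k + n\<close>.  The recursive calls stand
      under a sum over the support of \<open>p\<close>, so the recursion is set up by hand on \<open>less_than\<close>.\<close>
    define H where "H = (\<lambda>X n. inv (p k) \<otimes> (y (N + int n) \<ominus>
      (\<Oplus>j\<in>supp p - {k}. p j \<otimes> (if j - k \<le> int n then X (n - nat (j - k)) else \<zero>))))"
    define X where "X = wfrec less_than H"
    have cut: "cut X less_than n (n - nat (j - k)) = X (n - nat (j - k))"
      if "j \<in> supp p - {k}" "j - k \<le> int n" for n j
      using gt[OF that(1)] that(2) by (intro cut_apply) simp
    have "(\<lambda>j. p j \<otimes> (if j - k \<le> int n then cut X less_than n (n - nat (j - k)) else \<zero>)) j =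
          (\<lambda>j. p j \<otimes> (if j - k \<le> int n then X (n - nat (j - k)) else \<zero>)) j"
      if "j \<in> supp p - {k}" for n j
      using cut[OF that] by simp
    moreover have clo: "X n \<in> carrier A" for n
    proof (induction n rule: less_induct)
      case (less n)
      have "cut X less_than n (n - nat (j - k)) \<in> carrier A"
        if "j \<in> supp p - {k}" "j - k \<le> int n" for j
        using less[of "n - nat (j - k)"] cut[OF that] gt[OF that(1)] that(2) by simp
      then have "H (cut X less_than n) n \<in> carrier A"
        unfolding H_def using p k N by (intro m_closed minus_closed finsum_closed) auto
      then show ?case unfolding X_def by (subst wfrec) auto
    qed
    ultimately have "H (cut X less_than n) n = H X n" for n
      unfolding H_def using p
      by (intro arg_cong[where f = "\<lambda>z. inv (p k) \<otimes> (y (N + int n) \<ominus> z)"] finsum_cong') auto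
    moreover have "X n = H (cut X less_than n) n" for n
      unfolding X_def by (subst wfrec) auto
    ultimately have X: "X n = H X n" for n by simp
    define x where "x i = (if i < N - k then \<zero> else X (nat (i - (N - k))))" for i
    have xS: "x \<in> carrier Series" using clo by (simp add: series_iff x_def del: series_nth laurent_nth)
    have "convolution A p x i = y i" for i
    proof (cases "i < N")
      case True
      have "(\<Oplus>j\<in>supp p - {k}. p j \<otimes> x (i - j)) = \<zero>"
        using gt p True by (intro add.finprod_one_eqI) (force simp: x_def)
      then show ?thesis using conv[OF xS, of i] True N pk by (simp add: x_def)
    next
      case False
      define n where "n = nat (i - N)"
      have n: "i = N + int n" using False by (simp add: n_def)
      let ?S = "\<Oplus>j\<in>supp p - {k}. p j \<otimes> x (i - j)"
      have S: "?S \<in> carrier A" using p xS by (intro finsum_closed) auto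
      have "(\<Oplus>j\<in>supp p - {k}. p j \<otimes> (if j - k \<le> int n then X (n - nat (j - k)) else \<zero>)) = ?S"
      proof (rule finsum_cong')
        fix j assume j: "j \<in> supp p - {k}"
        have "(if j - k \<le> int n then X (n - nat (j - k)) else \<zero>) = x (i - j)"
        proof (cases "j - k \<le> int n")
          case True
          have "nat (i - j - (N - k)) = n - nat (j - k)" using True n gt[OF j] by linarith
          then show ?thesis using True n by (simp add: x_def)
        qed (simp add: x_def n)
        then show "p j \<otimes> (if j - k \<le> int n then X (n - nat (j - k)) else \<zero>) = p j \<otimes> x (i - j)" by simp
      qed (use p xS in auto)
      then have "X n = inv (p k) \<otimes> (y i \<ominus> ?S)" using X[of n] unfolding H_def n by simp
      moreover have "x (i - k) = X n" unfolding x_def n by simp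
      ultimately have "p k \<otimes> x (i - k) = y i \<ominus> ?S"
        using k pk N(1) S by (simp add: m_assoc[symmetric])
      then show ?thesis
        using conv[OF xS, of i] N(1) S by (simp add: minus_eq a_assoc l_neg)
    qed
    moreover have "x \<in> below" using xS by (auto simp: below_def x_def intro!: exI[of _ "N - k"])
    ultimately show ?thesis by blast
  qed
  show ?thesis
    unfolding bij_betw_def using inj surj convolution_below[OF p] by blast
qed

lemma half_invertible_extreme_coeffs:
  assumes p: "p \<in> carrier L" "p \<noteq> \<zero>\<^bsub>L\<^esub>" and ext: "extreme_coeffs_invertible A p"
  shows "half_invertible p"
proof -
  have fin: "finite (supp p)" using p by (simp add: laurent_iff)
  have low: "bij_betw (convolution A p) below below"
  proof (rule convolution_lowest[OF p(1)])
    show "p (Min (supp p)) \<in> Units A" using ext by (simp add: extreme_coeffs_invertible_def)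
    show "p j = \<zero>" if "j < Min (supp p)" for j using Min_le[OF fin, of j] that by auto
  qed
  have "bij_betw (convolution A (flip p)) below below"
  proof (rule convolution_lowest)
    show "flip p \<in> carrier L" using p by simp
    show "flip p (- Max (supp p)) \<in> Units A"
      using ext by (simp add: extreme_coeffs_invertible_def flip_def)
    show "flip p j = \<zero>" if "j < - Max (supp p)" for j
      using Max_ge[OF fin, of "- j"] that by (auto simp: flip_def)
  qed
  moreover have fb: "bij_betw flip below above" "bij_betw flip above below"
    using flip_above by (auto intro!: bij_betw_byWitness[where f' = flip])
  ultimately have "bij_betw (flip \<circ> (convolution A (flip p) \<circ> flip)) above above"
    using bij_betw_trans by metis
  then have "bij_betw (convolution A p) above above"
  proof (subst bij_betw_cong)
    fix f assume "f \<in> above"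
    then show "convolution A p f = (flip \<circ> (convolution A (flip p) \<circ> flip)) f"
      using flip_convolution[OF p(1) above_series] by simp
  qed
  then show ?thesis using low p by (simp add: half_invertible_def)
qed

end


section \<open>Free modules and splittings\<close>

lemma regular_simps [simp]:
  "carrier (regular_module R) = carrier R" "\<zero>\<^bsub>regular_module R\<^esub> = \<zero>\<^bsub>R\<^esub>"
  "x \<oplus>\<^bsub>regular_module R\<^esub> y = x \<oplus>\<^bsub>R\<^esub> y" "x \<odot>\<^bsub>regular_module R\<^esub> y = x \<otimes>\<^bsub>R\<^esub> y"
  by (simp_all add: regular_module_def)

lemma (in cring) regular_is_module: "module R (regular_module R)"
proof (rule moduleI[OF cring_axioms])
  show "abelian_group (regular_module R)"
    by (rule abelian_groupI) (auto simp: a_ac intro: l_neg)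
qed (auto simp: l_distr r_distr m_assoc)

context
  fixes R :: "('r, 'm) ring_scheme" and M :: "('r, 'b, 'n) module_scheme"
    and N :: "('r, 'c, 'k) module_scheme"
  assumes M: "module R M" and N: "module R N"
begin

interpretation M: module R M by (rule M)
interpretation N: module R N by (rule N)

lemma module_hom_finsumf:
  assumes "finite I" "\<And>i. i \<in> I \<Longrightarrow> f i \<in> module_hom R M N"
  shows "(\<lambda>x. \<Oplus>\<^bsub>N\<^esub>i\<in>I. f i x) \<in> module_hom R M N"
proof (rule module_homI)
  fix x y assume x: "x \<in> carrier M"
  have c: "f i x \<in> carrier N" if "i \<in> I" "x \<in> carrier M" for i x
    using module_hom_closed assms(2) that by metis
  show "(\<Oplus>\<^bsub>N\<^esub>i\<in>I. f i x) \<in> carrier N" using c x by (intro N.finsum_closed) auto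
  show "(\<Oplus>\<^bsub>N\<^esub>i\<in>I. f i (x \<oplus>\<^bsub>M\<^esub> y)) = (\<Oplus>\<^bsub>N\<^esub>i\<in>I. f i x) \<oplus>\<^bsub>N\<^esub> (\<Oplus>\<^bsub>N\<^esub>i\<in>I. f i y)"
    if y: "y \<in> carrier M"
  proof -
    have "(\<Oplus>\<^bsub>N\<^esub>i\<in>I. f i (x \<oplus>\<^bsub>M\<^esub> y)) = (\<Oplus>\<^bsub>N\<^esub>i\<in>I. f i x \<oplus>\<^bsub>N\<^esub> f i y)"
      using c x y module_hom_add[OF assms(2)] by (intro N.finsum_cong') auto
    also have "\<dots> = (\<Oplus>\<^bsub>N\<^esub>i\<in>I. f i x) \<oplus>\<^bsub>N\<^esub> (\<Oplus>\<^bsub>N\<^esub>i\<in>I. f i y)"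
      using c x y by (intro N.finsum_addf) auto
    finally show ?thesis .
  qed
  show "(\<Oplus>\<^bsub>N\<^esub>i\<in>I. f i (r \<odot>\<^bsub>M\<^esub> x)) = r \<odot>\<^bsub>N\<^esub> (\<Oplus>\<^bsub>N\<^esub>i\<in>I. f i x)" if r: "r \<in> carrier R" for r
  proof -
    have "(\<Oplus>\<^bsub>N\<^esub>i\<in>I. f i (r \<odot>\<^bsub>M\<^esub> x)) = (\<Oplus>\<^bsub>N\<^esub>i\<in>I. r \<odot>\<^bsub>N\<^esub> f i x)"
      using c x r module_hom_smult[OF assms(2)] by (intro N.finsum_cong') auto
    also have "\<dots> = r \<odot>\<^bsub>N\<^esub> (\<Oplus>\<^bsub>N\<^esub>i\<in>I. f i x)"
      using c x r assms(1) by (intro N.finsum_smult_ldistr[symmetric]) auto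
    finally show ?thesis .
  qed
qed

lemma module_hom_scale:
  assumes f: "f \<in> module_hom R M (regular_module R)" and y: "y \<in> carrier N"
  shows "(\<lambda>x. f x \<odot>\<^bsub>N\<^esub> y) \<in> module_hom R M N"
  using module_hom_closed[OF f] y
  by (intro module_homI)
     (auto simp: module_hom_add[OF f] module_hom_smult[OF f] N.smult_l_distr N.smult_assoc1)

end

text \<open>The coordinate functionals of a basis are linear because expansions in a basis are unique.\<close>

lemma free_dual_basis:
  assumes "free_finitely_generated R M"
  obtains B \<phi> where "finite B" "B \<subseteq> carrier M"
    "\<And>b. b \<in> B \<Longrightarrow> \<phi> b \<in> module_hom R M (regular_module R)"
    "\<And>x. x \<in> carrier M \<Longrightarrow> x = (\<Oplus>\<^bsub>M\<^esub>b\<in>B. \<phi> b x \<odot>\<^bsub>M\<^esub> b)"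
proof -
  have "module R M" using assms by (simp add: free_finitely_generated_def)
  then interpret M: module R M .
  obtain B where "finite B \<and> B \<subseteq> carrier M \<and> (\<forall>x\<in>carrier M.
      \<exists>!a. a \<in> B \<rightarrow>\<^sub>E carrier R \<and> x = (\<Oplus>\<^bsub>M\<^esub>b\<in>B. a b \<odot>\<^bsub>M\<^esub> b))"
    using assms unfolding free_finitely_generated_def by (elim conjE exE) (rule that, intro conjI)
  note basis = this
  have B: "finite B" "B \<subseteq> carrier M" using basis by simp_all
  have ex: "\<exists>!a. a \<in> B \<rightarrow>\<^sub>E carrier R \<and> x = (\<Oplus>\<^bsub>M\<^esub>b\<in>B. a b \<odot>\<^bsub>M\<^esub> b)" if "x \<in> carrier M" for x
    using basis[THEN conjunct2, THEN conjunct2] that by (rule bspec)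
  define rep where "rep x a \<longleftrightarrow> a \<in> B \<rightarrow>\<^sub>E carrier R \<and> x = (\<Oplus>\<^bsub>M\<^esub>b\<in>B. a b \<odot>\<^bsub>M\<^esub> b)" for x a
  define c where "c x = (THE a. rep x a)" for x
  have c: "rep x (c x)" if "x \<in> carrier M" for x
    unfolding c_def using ex[OF that] unfolding rep_def by (rule theI')
  have uniq: "c x = a" if "x \<in> carrier M" "rep x a" for x a
    using ex[OF that(1)] c[OF that(1)] that(2) unfolding rep_def by blast
  have cR: "c x b \<in> carrier R" if "x \<in> carrier M" "b \<in> B" for x b
    using c[OF that(1)] that(2) unfolding rep_def by auto
  have BM: "b \<in> carrier M" if "b \<in> B" for b using B that by auto
  have cx: "x = (\<Oplus>\<^bsub>M\<^esub>b\<in>B. c x b \<odot>\<^bsub>M\<^esub> b)" if "x \<in> carrier M" for x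
    using c[OF that] unfolding rep_def by blast
  have add: "c (x \<oplus>\<^bsub>M\<^esub> y) b = c x b \<oplus>\<^bsub>R\<^esub> c y b"
    if x: "x \<in> carrier M" and y: "y \<in> carrier M" and b: "b \<in> B" for x y b
  proof -
    have "(\<Oplus>\<^bsub>M\<^esub>b\<in>B. restrict (\<lambda>b. c x b \<oplus>\<^bsub>R\<^esub> c y b) B b \<odot>\<^bsub>M\<^esub> b)
        = (\<Oplus>\<^bsub>M\<^esub>b\<in>B. c x b \<odot>\<^bsub>M\<^esub> b \<oplus>\<^bsub>M\<^esub> c y b \<odot>\<^bsub>M\<^esub> b)"
      using cR[OF x] cR[OF y] BM by (intro M.finsum_cong') (auto simp: M.smult_l_distr)
    also have "\<dots> = (\<Oplus>\<^bsub>M\<^esub>b\<in>B. c x b \<odot>\<^bsub>M\<^esub> b) \<oplus>\<^bsub>M\<^esub> (\<Oplus>\<^bsub>M\<^esub>b\<in>B. c y b \<odot>\<^bsub>M\<^esub> b)"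
      using cR[OF x] cR[OF y] BM by (intro M.finsum_addf) auto
    also have "\<dots> = x \<oplus>\<^bsub>M\<^esub> y" using cx[OF x] cx[OF y] by simp
    finally have "rep (x \<oplus>\<^bsub>M\<^esub> y) (restrict (\<lambda>b. c x b \<oplus>\<^bsub>R\<^esub> c y b) B)"
      using cR[OF x] cR[OF y] unfolding rep_def by auto
    then have "c (x \<oplus>\<^bsub>M\<^esub> y) = restrict (\<lambda>b. c x b \<oplus>\<^bsub>R\<^esub> c y b) B"
      using uniq x y by simp
    then show ?thesis using b by simp
  qed
  have smult: "c (r \<odot>\<^bsub>M\<^esub> x) b = r \<otimes>\<^bsub>R\<^esub> c x b"
    if r: "r \<in> carrier R" and x: "x \<in> carrier M" and b: "b \<in> B" for r x b
  proof -
    have "(\<Oplus>\<^bsub>M\<^esub>b\<in>B. restrict (\<lambda>b. r \<otimes>\<^bsub>R\<^esub> c x b) B b \<odot>\<^bsub>M\<^esub> b)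
        = (\<Oplus>\<^bsub>M\<^esub>b\<in>B. r \<odot>\<^bsub>M\<^esub> (c x b \<odot>\<^bsub>M\<^esub> b))"
      using cR[OF x] r BM by (intro M.finsum_cong') (auto simp: M.smult_assoc1)
    also have "\<dots> = r \<odot>\<^bsub>M\<^esub> (\<Oplus>\<^bsub>M\<^esub>b\<in>B. c x b \<odot>\<^bsub>M\<^esub> b)"
      using cR[OF x] r BM B by (intro M.finsum_smult_ldistr[symmetric]) auto
    also have "\<dots> = r \<odot>\<^bsub>M\<^esub> x" using cx[OF x] by simp
    finally have "rep (r \<odot>\<^bsub>M\<^esub> x) (restrict (\<lambda>b. r \<otimes>\<^bsub>R\<^esub> c x b) B)"
      using cR[OF x] r unfolding rep_def by auto
    then have "c (r \<odot>\<^bsub>M\<^esub> x) = restrict (\<lambda>b. r \<otimes>\<^bsub>R\<^esub> c x b) B" using uniq x r by simp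
    then show ?thesis using b by simp
  qed
  show thesis
  proof (rule that[OF B])
    show "(\<lambda>x. c x b) \<in> module_hom R M (regular_module R)" if "b \<in> B" for b
      using that cR add smult by (intro module_homI) auto
    show "x = (\<Oplus>\<^bsub>M\<^esub>b\<in>B. c x b \<odot>\<^bsub>M\<^esub> b)" if "x \<in> carrier M" for x using cx[OF that] .
  qed
qed

lemma surjection_to_free_splits:
  assumes Y: "module R Y" and Q: "free_finitely_generated R Q"
    and \<pi>: "\<pi> \<in> module_hom R Y Q" and surj: "\<pi> ` carrier Y = carrier Q"
  obtains \<sigma> where "\<sigma> \<in> module_hom R Q Y" "\<And>q. q \<in> carrier Q \<Longrightarrow> \<pi> (\<sigma> q) = q"
proof -
  interpret Y: module R Y by (rule Y)
  have Qm: "module R Q" using Q by (simp add: free_finitely_generated_def)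
  then interpret Q: module R Q .
  obtain B \<phi> where B: "finite B" "B \<subseteq> carrier Q"
    and \<phi>: "\<And>b. b \<in> B \<Longrightarrow> \<phi> b \<in> module_hom R Q (regular_module R)"
    and rep: "\<And>x. x \<in> carrier Q \<Longrightarrow> x = (\<Oplus>\<^bsub>Q\<^esub>b\<in>B. \<phi> b x \<odot>\<^bsub>Q\<^esub> b)"
    by (rule free_dual_basis[OF Q]) (rule that)
  have "b \<in> \<pi> ` carrier Y" if "b \<in> B" for b using B(2) that surj by auto
  then have "\<forall>b\<in>B. \<exists>y\<in>carrier Y. \<pi> y = b" by (metis imageE)
  then obtain y where y: "\<And>b. b \<in> B \<Longrightarrow> y b \<in> carrier Y" "\<And>b. b \<in> B \<Longrightarrow> \<pi> (y b) = b" by metis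
  show thesis
  proof
    show "(\<lambda>x. \<Oplus>\<^bsub>Y\<^esub>b\<in>B. \<phi> b x \<odot>\<^bsub>Y\<^esub> y b) \<in> module_hom R Q Y"
      using module_hom_scale[OF Qm Y \<phi>] y by (intro module_hom_finsumf[OF Qm Y B(1)]) blast
    fix q assume q: "q \<in> carrier Q"
    have \<phi>q: "\<phi> b q \<in> carrier R" if "b \<in> B" for b using module_hom_closed[OF \<phi>[OF that] q] by simp
    have "\<pi> (\<Oplus>\<^bsub>Y\<^esub>b\<in>B. \<phi> b q \<odot>\<^bsub>Y\<^esub> y b) = (\<Oplus>\<^bsub>Q\<^esub>b\<in>B. \<pi> (\<phi> b q \<odot>\<^bsub>Y\<^esub> y b))"
      using \<phi>q y by (intro module_hom_finsum[OF Y Qm \<pi> B(1)]) auto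
    also have "\<dots> = (\<Oplus>\<^bsub>Q\<^esub>b\<in>B. \<phi> b q \<odot>\<^bsub>Q\<^esub> b)"
      using \<phi>q y B by (intro Q.finsum_cong') (auto simp: module_hom_smult[OF \<pi>])
    finally show "\<pi> (\<Oplus>\<^bsub>Y\<^esub>b\<in>B. \<phi> b q \<odot>\<^bsub>Y\<^esub> y b) = q" using rep[OF q] by simp
  qed
qed

section \<open>Scalars that are null-homotopic\<close>

text \<open>Multiplication by \<open>s\<close> is homotopic to zero.  The degree of \<open>h\<close> is left open, so that splittings used to
  build \<open>h\<close> may ignore the grading; the part of degree \<open>-1\<close> can be extracted afterwards.\<close>

definition scalar_homotopy ::
    "('r, 'm) ring_scheme \<Rightarrow> ('r, 'b, 'n) module_scheme \<Rightarrow> ('b \<Rightarrow> 'b) \<Rightarrow> 'r \<Rightarrow> ('b \<Rightarrow> 'b) \<Rightarrow> bool"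
  where "scalar_homotopy R M d s h \<longleftrightarrow>
    h \<in> module_hom R M M \<and> (\<forall>x\<in>carrier M. d (h x) \<oplus>\<^bsub>M\<^esub> h (d x) = s \<odot>\<^bsub>M\<^esub> x)"

text \<open>Null-homotopic scalars multiply in an extension \<open>0 \<rightarrow> X \<rightarrow> Y \<rightarrow> Q \<rightarrow> 0\<close> with \<open>Q\<close> free.  The homotopy \<open>hQ\<close> lifts
  along a splitting to an endomorphism \<open>g\<close> of \<open>Y\<close>.  The error \<open>e = t - (d g + g d)\<close> vanishes in \<open>Q\<close>, so
  it is a chain map from \<open>Y\<close> to \<open>X\<close>; there \<open>s e = d (hX e) + (hX e) d\<close>.  Hence \<open>s t\<close> is homotopic to
  zero by means of \<open>s g + hX e\<close>.\<close>

lemma scalar_homotopy_extension: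
  assumes Y: "module R Y" and d: "d \<in> module_hom R Y Y"
    and dd: "\<And>y. y \<in> carrier Y \<Longrightarrow> d (d y) = \<zero>\<^bsub>Y\<^esub>"
    and X: "submodule X R Y" and dX: "d ` X \<subseteq> X"
    and Q: "free_finitely_generated R Q" and \<pi>: "\<pi> \<in> module_hom R Y Q"
    and surj: "\<pi> ` carrier Y = carrier Q"
    and ker: "\<And>y. y \<in> carrier Y \<Longrightarrow> \<pi> y = \<zero>\<^bsub>Q\<^esub> \<Longrightarrow> y \<in> X"
    and \<pi>d: "\<And>y. y \<in> carrier Y \<Longrightarrow> \<pi> (d y) = dQ (\<pi> y)"
    and s: "s \<in> carrier R" "t \<in> carrier R"
    and hX: "scalar_homotopy R (Y\<lparr>carrier := X\<rparr>) d s hX"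
    and hQ: "scalar_homotopy R Q dQ t hQ"
  obtains h where "scalar_homotopy R Y d (s \<otimes>\<^bsub>R\<^esub> t) h"
proof -
  interpret Y: module R Y by (rule Y)
  have Qm: "module R Q" using Q by (simp add: free_finitely_generated_def)
  then interpret Q: module R Q .
  let ?X = "Y\<lparr>carrier := X\<rparr>"
  have Xm: "module R ?X" using submodule.submodule_is_module[OF X Y] .
  have XY: "x \<in> carrier Y" if "x \<in> X" for x using that Y.submoduleE(1)[OF X] by auto
  have hXh: "hX \<in> module_hom R ?X ?X" and hXe: "\<And>x. x \<in> X \<Longrightarrow> d (hX x) \<oplus>\<^bsub>Y\<^esub> hX (d x) = s \<odot>\<^bsub>Y\<^esub> x"
    using hX by (auto simp: scalar_homotopy_def)
  have hQh: "hQ \<in> module_hom R Q Q"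
    and hQe: "\<And>x. x \<in> carrier Q \<Longrightarrow> dQ (hQ x) \<oplus>\<^bsub>Q\<^esub> hQ (dQ x) = t \<odot>\<^bsub>Q\<^esub> x"
    using hQ by (auto simp: scalar_homotopy_def)
  obtain \<sigma> where \<sigma>: "\<sigma> \<in> module_hom R Q Y" and \<pi>\<sigma>: "\<And>q. q \<in> carrier Q \<Longrightarrow> \<pi> (\<sigma> q) = q"
    using surjection_to_free_splits[OF Y Q \<pi> surj] by metis
  define g where "g y = \<sigma> (hQ (\<pi> y))" for y
  have g: "g \<in> module_hom R Y Y"
    unfolding g_def[abs_def] using module_hom_comp[OF module_hom_comp[OF \<pi> hQh] \<sigma>] .
  note cl = module_hom_closed[OF d] module_hom_closed[OF g] module_hom_closed[OF \<pi>]
    module_hom_closed[OF hQh]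
  have \<pi>g: "\<pi> (g y) = hQ (\<pi> y)" if "y \<in> carrier Y" for y
    unfolding g_def using \<pi>\<sigma> cl that by simp
  define e where "e y = t \<odot>\<^bsub>Y\<^esub> y \<ominus>\<^bsub>Y\<^esub> (d (g y) \<oplus>\<^bsub>Y\<^esub> g (d y))" for y
  have e: "e \<in> module_hom R Y Y"
    unfolding e_def[abs_def]
    by (intro module_hom_minusf[OF Y Y] module_hom_addf[OF Y Y] Y.smult_hom s
        module_hom_comp[OF g d] module_hom_comp[OF d g])
  have eX: "e y \<in> X" if y: "y \<in> carrier Y" for y
  proof (rule ker)
    show "e y \<in> carrier Y" using module_hom_closed[OF e y] .
    have "\<pi> (e y) = t \<odot>\<^bsub>Q\<^esub> \<pi> y \<ominus>\<^bsub>Q\<^esub> (dQ (hQ (\<pi> y)) \<oplus>\<^bsub>Q\<^esub> hQ (dQ (\<pi> y)))"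
      unfolding e_def using y cl s \<pi>g \<pi>d
      by (simp add: module_hom_minus[OF Y Qm \<pi>] module_hom_add[OF \<pi>] module_hom_smult[OF \<pi>])
    then show "\<pi> (e y) = \<zero>\<^bsub>Q\<^esub>"
      using hQe[of "\<pi> y"] y cl s by (simp add: Q.minus_eq Q.r_neg)
  qed
  have d0: "d \<zero>\<^bsub>Y\<^esub> = \<zero>\<^bsub>Y\<^esub>" "g \<zero>\<^bsub>Y\<^esub> = \<zero>\<^bsub>Y\<^esub>" using module_hom_zero[OF Y Y] d g by auto
  have ed: "d (e y) = e (d y)" if y: "y \<in> carrier Y" for y
    unfolding e_def using y cl s dd d0
    by (simp add: module_hom_minus[OF Y Y d] module_hom_add[OF d] module_hom_smult[OF d])
  have eXh: "e \<in> module_hom R Y ?X"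
    using eX e by (auto simp: module_hom_def)
  have hXe_hom: "(\<lambda>y. hX (e y)) \<in> module_hom R Y Y"
    using module_hom_comp[OF eXh hXh] XY by (auto simp: module_hom_def)
  define h where "h y = s \<odot>\<^bsub>Y\<^esub> g y \<oplus>\<^bsub>Y\<^esub> hX (e y)" for y
  have h: "h \<in> module_hom R Y Y"
    unfolding h_def[abs_def]
    by (intro module_hom_addf[OF Y Y] module_hom_smultf[OF Y Y] g s hXe_hom)
  have "d (h y) \<oplus>\<^bsub>Y\<^esub> h (d y) = (s \<otimes>\<^bsub>R\<^esub> t) \<odot>\<^bsub>Y\<^esub> y" if y: "y \<in> carrier Y" for y
  proof -
    have hc: "hX (e y) \<in> carrier Y" if "y \<in> carrier Y" for y using module_hom_closed[OF hXe_hom that] .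
    have c: "g y \<in> carrier Y" "d y \<in> carrier Y" "d (g y) \<in> carrier Y" "g (d y) \<in> carrier Y"
      "hX (e y) \<in> carrier Y" "d (hX (e y)) \<in> carrier Y" "hX (e (d y)) \<in> carrier Y"
      "e y \<in> carrier Y"
      using y cl hc module_hom_closed[OF e y] by auto
    have "d (h y) \<oplus>\<^bsub>Y\<^esub> h (d y) = (s \<odot>\<^bsub>Y\<^esub> d (g y) \<oplus>\<^bsub>Y\<^esub> d (hX (e y))) \<oplus>\<^bsub>Y\<^esub> (s \<odot>\<^bsub>Y\<^esub> g (d y) \<oplus>\<^bsub>Y\<^esub> hX (e (d y)))"
      unfolding h_def using c s by (simp add: module_hom_add[OF d] module_hom_smult[OF d])
    also have "\<dots> = s \<odot>\<^bsub>Y\<^esub> (d (g y) \<oplus>\<^bsub>Y\<^esub> g (d y)) \<oplus>\<^bsub>Y\<^esub> (d (hX (e y)) \<oplus>\<^bsub>Y\<^esub> hX (d (e y)))"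
      using c s y by (simp add: ed Y.smult_r_distr Y.M.add.m_ac)
    also have "\<dots> = s \<odot>\<^bsub>Y\<^esub> (d (g y) \<oplus>\<^bsub>Y\<^esub> g (d y)) \<oplus>\<^bsub>Y\<^esub> s \<odot>\<^bsub>Y\<^esub> e y"
      using hXe[OF eX[OF y]] by simp
    also have "\<dots> = s \<odot>\<^bsub>Y\<^esub> ((d (g y) \<oplus>\<^bsub>Y\<^esub> g (d y)) \<oplus>\<^bsub>Y\<^esub> e y)"
      using c s by (simp add: Y.smult_r_distr)
    also have "(d (g y) \<oplus>\<^bsub>Y\<^esub> g (d y)) \<oplus>\<^bsub>Y\<^esub> e y = t \<odot>\<^bsub>Y\<^esub> y"
    proof -
      let ?a = "d (g y) \<oplus>\<^bsub>Y\<^esub> g (d y)"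
      have "?a \<in> carrier Y" "t \<odot>\<^bsub>Y\<^esub> y \<in> carrier Y" using c s y by auto
      then have "?a \<oplus>\<^bsub>Y\<^esub> (t \<odot>\<^bsub>Y\<^esub> y \<oplus>\<^bsub>Y\<^esub> \<ominus>\<^bsub>Y\<^esub> ?a) = t \<odot>\<^bsub>Y\<^esub> y \<oplus>\<^bsub>Y\<^esub> (?a \<oplus>\<^bsub>Y\<^esub> \<ominus>\<^bsub>Y\<^esub> ?a)"
        by (intro Y.M.add.m_lcomm) auto
      then show ?thesis
        unfolding e_def a_minus_def using \<open>?a \<in> carrier Y\<close> \<open>t \<odot>\<^bsub>Y\<^esub> y \<in> carrier Y\<close>
        by (simp add: Y.M.r_neg)
    qed
    finally show ?thesis using s y by (simp add: Y.smult_assoc1)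
  qed
  then show thesis using that h unfolding scalar_homotopy_def by blast
qed

text \<open>The base case: \<open>Y\<close> is an extension of \<open>R\<close> by \<open>R\<close>, with coordinates \<open>u\<close> on the quotient and \<open>v\<close> on the
  submodule, in which the coboundary is multiplication by \<open>p\<close>.  A homotopy for \<open>p\<close> projects \<open>Y\<close> onto
  \<open>X\<close> along a lift \<open>y1\<close> of the generator of the quotient, and sends the generator of \<open>X\<close> to \<open>y1\<close>.\<close>

lemma scalar_homotopy_two_term:
  assumes Y: "module R Y" and d: "d \<in> module_hom R Y Y" and X: "submodule X R Y"
    and dX: "\<And>y. y \<in> carrier Y \<Longrightarrow> d y \<in> X" and d0: "\<And>x. x \<in> X \<Longrightarrow> d x = \<zero>\<^bsub>Y\<^esub>"
    and u: "u \<in> module_hom R Y (regular_module R)" and usurj: "u ` carrier Y = carrier R"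
    and uker: "\<And>y. y \<in> carrier Y \<Longrightarrow> u y = \<zero>\<^bsub>R\<^esub> \<longleftrightarrow> y \<in> X"
    and v: "v \<in> module_hom R (Y\<lparr>carrier := X\<rparr>) (regular_module R)" and vinj: "inj_on v X"
    and p: "p \<in> carrier R" and vd: "\<And>y. y \<in> carrier Y \<Longrightarrow> v (d y) = p \<otimes>\<^bsub>R\<^esub> u y"
  obtains h where "scalar_homotopy R Y d p h"
proof -
  interpret Y: module R Y by (rule Y)
  have Rm: "module R (regular_module R)" by (rule Y.R.regular_is_module)
  let ?X = "Y\<lparr>carrier := X\<rparr>"
  have XY: "x \<in> carrier Y" if "x \<in> X" for x using that Y.submoduleE(1)[OF X] by auto
  have ucl: "u y \<in> carrier R" if "y \<in> carrier Y" for y using module_hom_closed[OF u that] by simp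
  have vcl: "v y \<in> carrier R" if "y \<in> X" for y using module_hom_closed[OF v, of y] that by simp
  obtain y1 where y1: "y1 \<in> carrier Y" "u y1 = \<one>\<^bsub>R\<^esub>"
    using usurj Y.R.one_closed by (metis imageE)
  define k where "k y = y \<ominus>\<^bsub>Y\<^esub> u y \<odot>\<^bsub>Y\<^esub> y1" for y
  have k: "k \<in> module_hom R Y Y"
    unfolding k_def[abs_def] using module_hom_minusf[OF Y Y Y.id_hom module_hom_scale[OF Y Y u y1(1)]] .
  have kX: "k y \<in> X" if y: "y \<in> carrier Y" for y
  proof -
    have "u (k y) = u y \<ominus>\<^bsub>regular_module R\<^esub> u y \<otimes>\<^bsub>R\<^esub> u y1"
      unfolding k_def using y y1(1) ucl
      by (simp add: module_hom_minus[OF Y Rm u] module_hom_smult[OF u])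
    also have "\<dots> = \<zero>\<^bsub>R\<^esub>"
      using ucl[OF y] y1 module.axioms(2)[OF Rm] abelian_group.r_neg[of "regular_module R" "u y"]
      by (simp add: a_minus_def)
    finally show ?thesis using uker[OF module_hom_closed[OF k y]] by simp
  qed
  have kXh: "k \<in> module_hom R Y ?X" using k kX by (auto simp: module_hom_def)
  define h where "h y = v (k y) \<odot>\<^bsub>Y\<^esub> y1" for y
  have h: "h \<in> module_hom R Y Y"
    unfolding h_def[abs_def] using module_hom_scale[OF Y Y module_hom_comp[OF kXh v] y1(1)] .
  have "d (h y) \<oplus>\<^bsub>Y\<^esub> h (d y) = p \<odot>\<^bsub>Y\<^esub> y" if y: "y \<in> carrier Y" for y
  proof -
    have ky: "k y \<in> carrier Y" using XY[OF kX[OF y]] .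
    have dh: "d (h y) = v (k y) \<odot>\<^bsub>Y\<^esub> d y1"
      unfolding h_def using vcl[OF kX[OF y]] y1 by (simp add: module_hom_smult[OF d])
    have pk: "p \<odot>\<^bsub>Y\<^esub> k y \<in> X" using Y.submoduleE(4)[OF X p kX[OF y]] .
    have "v (d (h y)) = v (k y) \<otimes>\<^bsub>R\<^esub> v (d y1)"
      unfolding dh using vcl[OF kX[OF y]] dX[OF y1(1)] module_hom_smult[OF v] by simp
    also have "\<dots> = p \<otimes>\<^bsub>R\<^esub> v (k y)"
      using vd[OF y1(1)] y1(2) p vcl[OF kX[OF y]] by (simp add: Y.R.m_comm)
    also have "\<dots> = v (p \<odot>\<^bsub>Y\<^esub> k y)" using module_hom_smult[OF v, of p "k y"] p kX[OF y] by simp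
    finally have 1: "d (h y) = p \<odot>\<^bsub>Y\<^esub> k y"
      using vinj dX[OF module_hom_closed[OF h y]] pk by (simp add: inj_on_def)
    have dy: "d y \<in> carrier Y" "u (d y) = \<zero>\<^bsub>R\<^esub>" using dX[OF y] XY uker by auto
    then have "k (d y) = d y" unfolding k_def using y1 by (simp add: Y.minus_eq)
    then have "h (d y) = (p \<otimes>\<^bsub>R\<^esub> u y) \<odot>\<^bsub>Y\<^esub> y1" unfolding h_def using vd[OF y] by simp
    then have 2: "h (d y) = p \<odot>\<^bsub>Y\<^esub> (u y \<odot>\<^bsub>Y\<^esub> y1)" using p ucl[OF y] y1 by (simp add: Y.smult_assoc1)
    have "d (h y) \<oplus>\<^bsub>Y\<^esub> h (d y) = p \<odot>\<^bsub>Y\<^esub> (k y \<oplus>\<^bsub>Y\<^esub> u y \<odot>\<^bsub>Y\<^esub> y1)"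
      unfolding 1 2 using p ky ucl[OF y] y1 by (simp add: Y.smult_r_distr)
    also have "k y \<oplus>\<^bsub>Y\<^esub> u y \<odot>\<^bsub>Y\<^esub> y1 = y"
      unfolding k_def using y y1 ucl[OF y] by (simp add: Y.minus_eq Y.M.a_assoc Y.M.l_neg)
    finally show ?thesis .
  qed
  then show thesis using that h unfolding scalar_homotopy_def by blast
qed


section \<open>Homogeneous components\<close>

context graded_complex
begin

lemma homog_closed: "x \<in> homog C i \<Longrightarrow> x \<in> carrier C"
  using submoduleE(1)[OF homog_submodule[of i]] by auto

definition decomposes :: "'c \<Rightarrow> (int \<Rightarrow> 'c) \<Rightarrow> bool"
  where "decomposes x f \<longleftrightarrow> (\<forall>i. f i \<in> homog C i) \<and> finite {i. f i \<noteq> \<zero>\<^bsub>C\<^esub>} \<and>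
    x = (\<Oplus>\<^bsub>C\<^esub>i\<in>{i. f i \<noteq> \<zero>\<^bsub>C\<^esub>}. f i)"

text \<open>As a family of linear endomorphisms that commute with the coboundary, the homogeneous components
  pass to the tensor product, where they cut out its grading.\<close>

definition component :: "int \<Rightarrow> 'c \<Rightarrow> 'c"
  where "component i x = (THE f. decomposes x f) i"

lemma decomposes_superset:
  assumes "finite J" "{i. f i \<noteq> \<zero>\<^bsub>C\<^esub>} \<subseteq> J" "\<And>i. f i \<in> homog C i"
  shows "decomposes x f \<longleftrightarrow> x = (\<Oplus>\<^bsub>C\<^esub>i\<in>J. f i)"
proof -
  have "(\<Oplus>\<^bsub>C\<^esub>i\<in>{i. f i \<noteq> \<zero>\<^bsub>C\<^esub>}. f i) = (\<Oplus>\<^bsub>C\<^esub>i\<in>J. f i)"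
    using assms homog_closed by (intro M.add.finprod_mono_neutral_cong_left) auto
  then show ?thesis
    using assms finite_subset[OF assms(2,1)] unfolding decomposes_def by auto
qed

lemma decomposes_component: "x \<in> carrier C \<Longrightarrow> decomposes x (\<lambda>i. component i x)"
  unfolding component_def
  using theI'[OF homog_decomposition[of x]] by (simp add: decomposes_def[abs_def])

lemma component_eqI: "x \<in> carrier C \<Longrightarrow> decomposes x f \<Longrightarrow> component i x = f i"
  unfolding component_def
  using the1_equality[OF homog_decomposition[of x], of f] by (simp add: decomposes_def[abs_def])

lemma component_mem: "x \<in> carrier C \<Longrightarrow> component i x \<in> homog C i"
  using decomposes_component unfolding decomposes_def by blast

lemma component_homog:
  assumes "x \<in> homog C j"
  shows "component i x = (if i = j then x else \<zero>\<^bsub>C\<^esub>)"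
proof (rule component_eqI)
  show "decomposes x (\<lambda>i. if i = j then x else \<zero>\<^bsub>C\<^esub>)"
    using assms homog_closed[OF assms] submodule_zero[OF homog_submodule]
    by (subst decomposes_superset[of "{j}"]) auto
qed (rule homog_closed[OF assms])

lemma component_hom: "component i \<in> module_hom R C C"
proof (rule module_homI)
  fix x assume x: "x \<in> carrier C"
  let ?f = "\<lambda>i. component i x"
  have f: "?f i \<in> homog C i" "?f i \<in> carrier C" for i
    using component_mem[OF x] homog_closed by auto
  have fin: "finite {i. ?f i \<noteq> \<zero>\<^bsub>C\<^esub>}" using decomposes_component[OF x] by (simp add: decomposes_def)
  show "component i x \<in> carrier C" using f by simp
  {
    fix y assume y: "y \<in> carrier C"
    let ?g = "\<lambda>i. component i y"
    have g: "?g i \<in> homog C i" "?g i \<in> carrier C" for i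
      using component_mem[OF y] homog_closed by auto
    have fin': "finite {i. ?g i \<noteq> \<zero>\<^bsub>C\<^esub>}" using decomposes_component[OF y] by (simp add: decomposes_def)
    let ?J = "{i. ?f i \<noteq> \<zero>\<^bsub>C\<^esub>} \<union> {i. ?g i \<noteq> \<zero>\<^bsub>C\<^esub>}"
    have J: "finite ?J" using fin fin' by simp
    have "x = (\<Oplus>\<^bsub>C\<^esub>i\<in>?J. ?f i)"
      using decomposes_component[OF x] by (subst (asm) decomposes_superset[OF J _ f(1)]) auto
    moreover have "y = (\<Oplus>\<^bsub>C\<^esub>i\<in>?J. ?g i)"
      using decomposes_component[OF y] by (subst (asm) decomposes_superset[OF J _ g(1)]) auto
    moreover have "(\<Oplus>\<^bsub>C\<^esub>i\<in>?J. ?f i \<oplus>\<^bsub>C\<^esub> ?g i) = (\<Oplus>\<^bsub>C\<^esub>i\<in>?J. ?f i) \<oplus>\<^bsub>C\<^esub> (\<Oplus>\<^bsub>C\<^esub>i\<in>?J. ?g i)"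
      using f g by (intro M.finsum_addf) auto
    ultimately have "x \<oplus>\<^bsub>C\<^esub> y = (\<Oplus>\<^bsub>C\<^esub>i\<in>?J. ?f i \<oplus>\<^bsub>C\<^esub> ?g i)" by simp
    moreover have "?f i \<oplus>\<^bsub>C\<^esub> ?g i \<in> homog C i" for i
      using submoduleE(5)[OF homog_submodule f(1) g(1)] .
    ultimately have "decomposes (x \<oplus>\<^bsub>C\<^esub> y) (\<lambda>i. ?f i \<oplus>\<^bsub>C\<^esub> ?g i)"
      by (subst decomposes_superset[OF J]) auto
    then show "component i (x \<oplus>\<^bsub>C\<^esub> y) = component i x \<oplus>\<^bsub>C\<^esub> component i y"
      using component_eqI x y by simp
  }
  fix r assume r: "r \<in> carrier R"
  have "r \<odot>\<^bsub>C\<^esub> x = r \<odot>\<^bsub>C\<^esub> (\<Oplus>\<^bsub>C\<^esub>i\<in>{i. ?f i \<noteq> \<zero>\<^bsub>C\<^esub>}. ?f i)"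
    using decomposes_component[OF x] by (simp add: decomposes_def)
  also have "\<dots> = (\<Oplus>\<^bsub>C\<^esub>i\<in>{i. ?f i \<noteq> \<zero>\<^bsub>C\<^esub>}. r \<odot>\<^bsub>C\<^esub> ?f i)"
    using f r fin by (intro finsum_smult_ldistr) auto
  finally have "decomposes (r \<odot>\<^bsub>C\<^esub> x) (\<lambda>i. r \<odot>\<^bsub>C\<^esub> ?f i)"
    using r f submoduleE(4)[OF homog_submodule r f(1)] by (subst decomposes_superset[OF fin]) auto
  then show "component i (r \<odot>\<^bsub>C\<^esub> x) = r \<odot>\<^bsub>C\<^esub> component i x"
    using component_eqI x r by simp
qed

lemma component_differential:
  assumes x: "x \<in> carrier C"
  shows "component (i + 1) (differential C x) = differential C (component i x)"
proof -
  let ?f = "\<lambda>i. component i x" and ?d = "differential C"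
  have f: "?f i \<in> homog C i" "?f i \<in> carrier C" for i
    using component_mem[OF x] homog_closed by auto
  have dcl: "?d y \<in> carrier C" if "y \<in> carrier C" for y
    using module_hom_closed[OF differential_hom that] .
  have d0: "?d \<zero>\<^bsub>C\<^esub> = \<zero>\<^bsub>C\<^esub>" using module_hom_zero[OF module_axioms module_axioms differential_hom] .
  let ?J = "{i. ?f i \<noteq> \<zero>\<^bsub>C\<^esub>}" and ?g = "\<lambda>i. ?d (?f (i - 1))"
  have fin: "finite ?J" using decomposes_component[OF x] by (simp add: decomposes_def)
  have sub: "{i. ?g i \<noteq> \<zero>\<^bsub>C\<^esub>} \<subseteq> (\<lambda>i. i + 1) ` ?J"
  proof
    fix i assume "i \<in> {i. ?g i \<noteq> \<zero>\<^bsub>C\<^esub>}"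
    then have "i - 1 \<in> ?J" using d0 by auto
    then show "i \<in> (\<lambda>i. i + 1) ` ?J" by (intro image_eqI[of _ _ "i - 1"]) simp_all
  qed
  have "?d x = ?d (\<Oplus>\<^bsub>C\<^esub>i\<in>?J. ?f i)"
    using decomposes_component[OF x] by (simp add: decomposes_def)
  also have "\<dots> = (\<Oplus>\<^bsub>C\<^esub>i\<in>?J. ?g (i + 1))"
    using module_hom_finsum[OF module_axioms module_axioms differential_hom fin, of ?f] f by simp
  also have "\<dots> = (\<Oplus>\<^bsub>C\<^esub>i\<in>(\<lambda>i. i + 1) ` ?J. ?g i)"
    using f dcl by (intro M.finsum_reindex[symmetric]) auto
  finally have "?d x = (\<Oplus>\<^bsub>C\<^esub>i\<in>(\<lambda>i. i + 1) ` ?J. ?g i)" .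
  moreover have "?g i \<in> homog C i" for i using differential_degree[OF f(1)[of "i - 1"]] by simp
  ultimately have "decomposes (?d x) ?g"
    using fin by (subst decomposes_superset[OF _ sub]) auto
  then show ?thesis using component_eqI[OF dcl[OF x], of ?g "i + 1"] by simp
qed

lemma homog_Int: "i \<noteq> j \<Longrightarrow> x \<in> homog C i \<Longrightarrow> x \<in> homog C j \<Longrightarrow> x = \<zero>\<^bsub>C\<^esub>"
  using component_homog[of x i j] component_homog[of x j j] by simp

end

section \<open>Well filtered complexes have invertible null-homotopic scalars\<close>

text \<open>Carries the module structure from a complex to the underlying module, and across the different
  ways in which restricted complexes and restricted modules are built as records.\<close>

lemma module_cong:
  assumes "module R M" "carrier N = carrier M" "zero N = zero M" "add N = add M" "smult N = smult M"
  shows "module R N"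
proof -
  interpret M: module R M by (rule assms(1))
  have "abelian_group N"
  proof (rule abelian_groupI)
    fix x assume "x \<in> carrier N"
    then show "\<exists>y\<in>carrier N. y \<oplus>\<^bsub>N\<^esub> x = \<zero>\<^bsub>N\<^esub>"
      unfolding assms(2-5) using M.l_neg M.a_inv_closed by blast
  qed (simp_all add: assms(2-5) M.add.m_ac)
  then show ?thesis
    by (rule moduleI[OF M.R.cring_axioms])
       (simp_all add: assms(2-5) M.smult_l_distr M.smult_r_distr M.smult_assoc1)
qed

lemma restrict_complex_simps [simp]:
  "carrier (restrict_complex C X) = X" "zero (restrict_complex C X) = zero C"
  "add (restrict_complex C X) = add C" "smult (restrict_complex C X) = smult C"
  "homog (restrict_complex C X) i = homog C i \<inter> X"
  "differential (restrict_complex C X) = differential C"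
  by (simp_all add: restrict_complex_def)

lemma quotient_complex_simps:
  "carrier (quotient_complex (restrict_complex C X) Y) = carrier (quotient_module (C\<lparr>carrier := X\<rparr>) Y)"
  "zero (quotient_complex (restrict_complex C X) Y) = zero (quotient_module (C\<lparr>carrier := X\<rparr>) Y)"
  "add (quotient_complex (restrict_complex C X) Y) = add (quotient_module (C\<lparr>carrier := X\<rparr>) Y)"
  "smult (quotient_complex (restrict_complex C X) Y) = smult (quotient_module (C\<lparr>carrier := X\<rparr>) Y)"
  "homog (quotient_complex (restrict_complex C X) Y) i = (\<lambda>x. Y +>\<^bsub>C\<^esub> x) ` (homog C i \<inter> X)"
  "differential (quotient_complex (restrict_complex C X) Y) S = (differential C ` S) <+>\<^bsub>C\<^esub> Y"
  by (simp_all add: quotient_complex_def module.defs cochain_complex.defs quotient_module_def fun_eq_iff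
      A_RCOSETS_def' a_r_coset_def' set_add_def')

lemma coset_restrict [simp]: "Y +>\<^bsub>C\<lparr>carrier := X\<rparr>\<^esub> x = Y +>\<^bsub>C\<^esub> x"
  by (simp add: a_r_coset_def')

lemma (in module) quotient_iso_hom:
  assumes N: "submodule N R M" and D: "module R D" and f: "f \<in> module_iso R (quotient_module M N) D"
  shows "(\<lambda>x. f (N +>\<^bsub>M\<^esub> x)) \<in> module_hom R M D"
    and "(\<lambda>x. f (N +>\<^bsub>M\<^esub> x)) ` carrier M = carrier D"
    and "\<And>x. x \<in> carrier M \<Longrightarrow> f (N +>\<^bsub>M\<^esub> x) = \<zero>\<^bsub>D\<^esub> \<longleftrightarrow> x \<in> N"
proof -
  let ?Q = "quotient_module M N"
  have fh: "f \<in> module_hom R ?Q D" and bij: "bij_betw f (carrier ?Q) (carrier D)"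
    using f by (auto simp: module_iso_def)
  show "(\<lambda>x. f (N +>\<^bsub>M\<^esub> x)) \<in> module_hom R M D"
    using module_hom_comp[OF coset_hom[OF N] fh] .
  have "carrier ?Q = (\<lambda>x. N +>\<^bsub>M\<^esub> x) ` carrier M"
    using quotient_carrierI[OF N] by (auto elim: quotient_carrierE[OF N])
  then show "(\<lambda>x. f (N +>\<^bsub>M\<^esub> x)) ` carrier M = carrier D"
    using bij_betw_imp_surj_on[OF bij] by (simp add: image_image)
  fix x assume x: "x \<in> carrier M"
  have f0: "f N = \<zero>\<^bsub>D\<^esub>" using module_hom_zero[OF quotient_is_module[OF N] D fh] by simp
  have zc: "N \<in> carrier ?Q"
    using module.axioms(2)[OF quotient_is_module[OF N]] abelian_group.axioms(1) abelian_monoid.zero_closed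
    by fastforce
  have "f (N +>\<^bsub>M\<^esub> x) = f N \<longleftrightarrow> N +>\<^bsub>M\<^esub> x = N"
    using bij_betw_imp_inj_on[OF bij] quotient_carrierI[OF N x] zc by (simp add: inj_on_eq_iff)
  then show "f (N +>\<^bsub>M\<^esub> x) = \<zero>\<^bsub>D\<^esub> \<longleftrightarrow> x \<in> N"
    using f0 coset_eq_zero_iff[OF N x] by simp
qed

text \<open>Induction along the recursive definition, and for each complex downwards along its filtration.  The
  two top pieces form a two-term complex whose coboundary is a half-invertible scalar \<open>p\<close>; every
  further piece is free and has a null-homotopic half-invertible scalar by the induction hypothesis,
  and products of half-invertible scalars are half-invertible.\<close>

lemma (in coefficients) well_filtered_scalar_homotopy:
  fixes C :: "(int \<Rightarrow> 'a, 'c) cochain_complex"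
  assumes "well_filtered A C"
  shows "\<exists>s h. half_invertible s \<and> scalar_homotopy L C (differential C) s h"
  using assms
proof (induction rule: well_filtered.induct)
  case (1 C)
  interpret C: graded_complex L C by (rule 1(1))
  let ?d = "differential C"
  have d: "?d \<in> module_hom L C C" by (rule C.differential_hom)
  show ?case
  proof (cases "carrier C = {\<zero>\<^bsub>C\<^esub>}")
    case True
    have "scalar_homotopy L C ?d \<one>\<^bsub>L\<^esub> (\<lambda>x. x)"
      unfolding scalar_homotopy_def
      using True C.id_hom module_hom_zero[OF C.module_axioms C.module_axioms d]
        C.smult_one[OF C.M.zero_closed]
      by (simp del: laurent_simps)
    then show ?thesis using half_invertible_one by blast
  next
    case False
    then obtain F n where n: "n > 0" and filt: "decreasing_filtration L C F"
      and F0: "F 0 = carrier C" and Fn1: "F (n + 1) = {\<zero>\<^bsub>C\<^esub>}"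
      and conc: "concentrated_in (restrict_complex C (F n)) n"
        "concentrated_in (graded_piece C F (n - 1)) (n - 1)"
      and ex: "\<exists>p\<in>carrier L. p \<noteq> \<zero>\<^bsub>L\<^esub> \<and> extreme_coeffs_invertible A p \<and>
             (\<exists>u\<in>module_iso L (graded_piece C F (n - 1)) (regular_module L).
              \<exists>v\<in>module_iso L (graded_piece C F n) (regular_module L).
              \<forall>S\<in>carrier (graded_piece C F (n - 1)).
                v (induced_differential C (F (n + 1)) S) = p \<otimes>\<^bsub>L\<^esub> u S)"
      and pieces: "\<And>i. i \<noteq> n - 1 \<Longrightarrow> i \<noteq> n \<Longrightarrow>
              (\<exists>D :: (int \<Rightarrow> 'a, 'c) cochain_complex.
                 complexes_isomorphic L (graded_piece C F i) D \<and>
                 (well_filtered A D \<and>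
                  (\<exists>s h. half_invertible s \<and> scalar_homotopy L D (differential D) s h)))"
      using 1(4) by (elim impE exE conjE) blast+
    obtain p u v where p: "p \<in> carrier L" "p \<noteq> \<zero>\<^bsub>L\<^esub>" "extreme_coeffs_invertible A p"
      and u: "u \<in> module_iso L (graded_piece C F (n - 1)) (regular_module L)"
      and v: "v \<in> module_iso L (graded_piece C F n) (regular_module L)"
      and vu: "\<And>S. S \<in> carrier (graded_piece C F (n - 1)) \<Longrightarrow>
                v (induced_differential C (F (n + 1)) S) = p \<otimes>\<^bsub>L\<^esub> u S"
      using ex by blast
    have FC: "F i \<subseteq> carrier C" and Fg: "graded_complex L (restrict_complex C (F i))" for i
      using filt by (auto simp: decreasing_filtration_def graded_subcomplex_def)
    have Fdec: "F (i + 1) \<subseteq> F i" for i using filt by (simp add: decreasing_filtration_def)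
    let ?Y = "\<lambda>i. C\<lparr>carrier := F i\<rparr>"
    have Ym: "module L (?Y i)" for i
      using module_cong[OF graded_complex.axioms(1)[OF Fg[of i]], of "?Y i"] by simp
    have Fsub: "submodule (F i) L C" for i using C.module_incl_imp_submodule[OF FC Ym] .
    have Fsub': "submodule (F (i + 1)) L (?Y i)" for i
      using C.submodule_restrict_iff[OF Fsub[of i]] Fsub[of "i + 1"] Fdec by blast
    have dF: "?d x \<in> F i" if "x \<in> F i" for i x
      using module_hom_closed[OF graded_complex.differential_hom[OF Fg[of i]], of x] that by simp
    have dY: "?d \<in> module_hom L (?Y i) (?Y i)" for i
      using d dF FC[of i] by (auto simp: module_hom_def subset_iff)
    have coset_d: "(?d ` (F i +>\<^bsub>C\<^esub> x)) <+>\<^bsub>C\<^esub> F i = F i +>\<^bsub>C\<^esub> ?d x" if "x \<in> carrier C" for i x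
      using C.coset_image[OF Fsub C.module_axioms Fsub d _ that] dF by blast
    have iso: "f \<in> module_iso L (quotient_module (?Y i) (F (i + 1))) D"
      if "f \<in> module_iso L (graded_piece C F i) D" for f i and D :: "(int \<Rightarrow> 'a, 'x, 'y) module_scheme"
      using that unfolding module_iso_def module_hom_def quotient_complex_simps .
    note piece = module.quotient_iso_hom[OF Ym Fsub' _ iso]
    have base: "\<exists>s h. half_invertible s \<and> scalar_homotopy L (?Y (n - 1)) ?d s h"
    proof -
      have Lm: "module L (regular_module L)" by (rule L.regular_is_module)
      have Fn: "x \<in> homog C n" if "x \<in> F n" for x
        using conc(1) that by (auto simp: concentrated_in_def)
      have d0: "?d x = \<zero>\<^bsub>C\<^esub>" if x: "x \<in> F n" for x
        using C.homog_Int[of "n + 1" n] C.differential_degree[OF Fn[OF x]] Fn[OF dF[OF x]] by simp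
      \<comment> \<open>The coset of \<open>y\<close> contains some \<open>z\<close> of degree \<open>n - 1\<close>.  Then \<open>d z\<close> has degree \<open>n\<close>, but modulo \<open>F n\<close>
        it is some \<open>w\<close> of degree \<open>n - 1\<close>; as \<open>F n\<close> has degree \<open>n\<close>, this forces \<open>w = 0\<close>.\<close>
      have dFn: "?d y \<in> F n" if y: "y \<in> F (n - 1)" for y
      proof -
        have yc: "y \<in> carrier C" using FC y by auto
        have "F n +>\<^bsub>C\<^esub> y \<in> (\<lambda>x. F n +>\<^bsub>C\<^esub> x) ` (homog C (n - 1) \<inter> F (n - 1))"
          using conc(2) module.quotient_carrierI[OF Ym Fsub', of y "n - 1"] y
          unfolding concentrated_in_def quotient_complex_simps by simp
        then obtain z where z: "z \<in> homog C (n - 1)" "z \<in> F (n - 1)" "F n +>\<^bsub>C\<^esub> y = F n +>\<^bsub>C\<^esub> z" by auto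
        have zc: "z \<in> carrier C" using FC z by auto
        have yz: "y \<ominus>\<^bsub>C\<^esub> z \<in> F n" using C.coset_eq_iff[OF Fsub yc zc] z by simp
        have "?d (y \<ominus>\<^bsub>C\<^esub> z) = ?d y \<ominus>\<^bsub>C\<^esub> ?d z"
          by (rule module_hom_minus[OF C.module_axioms C.module_axioms d yc zc])
        then have dyz: "?d y = ?d z"
          using d0[OF yz] C.minus_eq_zero_iff module_hom_closed[OF d yc] module_hom_closed[OF d zc]
          by metis
        have dz: "?d z \<in> F (n - 1)" "?d z \<in> homog C n"
          using dF[OF z(2)] C.differential_degree[OF z(1)] by simp_all
        have "F n +>\<^bsub>C\<^esub> ?d z \<in> (\<lambda>x. F n +>\<^bsub>C\<^esub> x) ` (homog C (n - 1) \<inter> F (n - 1))"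
          using conc(2) module.quotient_carrierI[OF Ym Fsub', of "?d z" "n - 1"] dz
          unfolding concentrated_in_def quotient_complex_simps by simp
        then obtain w where w: "w \<in> homog C (n - 1)" "F n +>\<^bsub>C\<^esub> ?d z = F n +>\<^bsub>C\<^esub> w" by auto
        have c: "?d z \<in> carrier C" "w \<in> carrier C" using dz w C.homog_closed by auto
        have dzw: "?d z \<ominus>\<^bsub>C\<^esub> w \<in> F n" using C.coset_eq_iff[OF Fsub c] w by simp
        have "?d z \<ominus>\<^bsub>C\<^esub> (?d z \<ominus>\<^bsub>C\<^esub> w) \<in> homog C n"
          using C.submodule_minus[OF C.homog_submodule dz(2) Fn[OF dzw]] .
        moreover have "?d z \<ominus>\<^bsub>C\<^esub> (?d z \<ominus>\<^bsub>C\<^esub> w) = w"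
          using c by (simp add: C.minus_eq C.M.minus_add C.M.a_assoc[symmetric] C.M.r_neg)
        ultimately have "w = \<zero>\<^bsub>C\<^esub>" using C.homog_Int[of n "n - 1"] w(1) by simp
        then have "F n +>\<^bsub>C\<^esub> ?d z = F n"
          using w(2) C.coset_eq_zero_iff[OF Fsub c(2)] C.submodule_zero[OF Fsub] by simp
        then show ?thesis using C.coset_eq_zero_iff[OF Fsub c(1)] dyz by simp
      qed
      have u': "(\<lambda>x. u (F n +>\<^bsub>C\<^esub> x)) \<in> module_hom L (?Y (n - 1)) (regular_module L)"
        "(\<lambda>x. u (F n +>\<^bsub>C\<^esub> x)) ` F (n - 1) = carrier L"
        "\<And>x. x \<in> F (n - 1) \<Longrightarrow> u (F n +>\<^bsub>C\<^esub> x) = \<zero>\<^bsub>L\<^esub> \<longleftrightarrow> x \<in> F n"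
        using piece[OF Lm u] by (simp_all del: laurent_simps)
      have v': "(\<lambda>x. v (F (n + 1) +>\<^bsub>C\<^esub> x)) \<in> module_hom L (?Y n) (regular_module L)"
        "\<And>x. x \<in> F n \<Longrightarrow> v (F (n + 1) +>\<^bsub>C\<^esub> x) = \<zero>\<^bsub>L\<^esub> \<longleftrightarrow> x = \<zero>\<^bsub>C\<^esub>"
        using piece(1,3)[OF Lm v] Fn1 by (simp_all del: laurent_simps)
      have vinj: "inj_on (\<lambda>x. v (F (n + 1) +>\<^bsub>C\<^esub> x)) (F n)"
      proof (rule inj_onI)
        fix x y assume xy: "x \<in> F n" "y \<in> F n" and eq: "v (F (n + 1) +>\<^bsub>C\<^esub> x) = v (F (n + 1) +>\<^bsub>C\<^esub> y)"
        interpret Yn: module L "?Y n" by (rule Ym)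
        interpret Lm: module L "regular_module L" by (rule Lm)
        have m: "x \<ominus>\<^bsub>?Y n\<^esub> y \<in> F n" using Yn.minus_closed[of x y] xy by simp
        have "v (F (n + 1) +>\<^bsub>C\<^esub> (x \<ominus>\<^bsub>?Y n\<^esub> y)) = \<zero>\<^bsub>L\<^esub>"
          using module_hom_minus[OF Ym Lm v'(1), of x y] xy eq
            Lm.minus_eq_zero_iff[of "v (F (n + 1) +>\<^bsub>C\<^esub> x)"] module_hom_closed[OF v'(1), of y]
          by (simp del: laurent_simps)
        then have "x \<ominus>\<^bsub>?Y n\<^esub> y = \<zero>\<^bsub>?Y n\<^esub>" using v'(2)[OF m] by simp
        then show "x = y" using Yn.minus_eq_zero_iff[of x y] xy by simp
      qed
      have vd: "v (F (n + 1) +>\<^bsub>C\<^esub> ?d y) = p \<otimes>\<^bsub>L\<^esub> u (F n +>\<^bsub>C\<^esub> y)" if y: "y \<in> F (n - 1)" for y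
      proof -
        have yc: "y \<in> carrier C" using FC y by auto
        have "(?d ` (F n +>\<^bsub>C\<^esub> y)) <+>\<^bsub>C\<^esub> F (n + 1) = F (n + 1) +>\<^bsub>C\<^esub> ?d y"
          using C.coset_image[OF Fsub C.module_axioms Fsub d _ yc, of n "n + 1"] d0 Fn1 by auto
        moreover have "F n +>\<^bsub>C\<^esub> y \<in> carrier (graded_piece C F (n - 1))"
          using module.quotient_carrierI[OF Ym Fsub', of y "n - 1"] y
          unfolding quotient_complex_simps by simp
        ultimately show ?thesis using vu[of "F n +>\<^bsub>C\<^esub> y"] by (simp add: induced_differential_def)
      qed
      have Fsubn: "submodule (F n) L (?Y (n - 1))" using Fsub'[of "n - 1"] by simp
      obtain h where "scalar_homotopy L (?Y (n - 1)) ?d p h"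
        by (rule scalar_homotopy_two_term[OF Ym dY Fsubn, where u = "\<lambda>x. u (F n +>\<^bsub>C\<^esub> x)"
              and v = "\<lambda>x. v (F (n + 1) +>\<^bsub>C\<^esub> x)" and p = p])
           (use dFn d0 u' v' vinj p vd in \<open>simp_all del: laurent_simps\<close>)
      then show ?thesis using half_invertible_extreme_coeffs[OF p] by blast
    qed
    have "0 \<le> i \<Longrightarrow> \<exists>s h. half_invertible s \<and> scalar_homotopy L (?Y i) ?d s h" if "i \<le> n - 1" for i
      using that
    proof (induction i rule: int_le_induct)
      case base
      then show ?case using \<open>\<exists>s h. half_invertible s \<and> scalar_homotopy L (?Y (n - 1)) ?d s h\<close> by simp
    next
      case (step i)
      then obtain s hX where s: "half_invertible s" and hX: "scalar_homotopy L (?Y i) ?d s hX" by auto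
      have "i - 1 \<noteq> n - 1" "i - 1 \<noteq> n" using step by auto
      then obtain D :: "(int \<Rightarrow> 'a, 'c) cochain_complex" and t hD
        where D: "complexes_isomorphic L (graded_piece C F (i - 1)) D" "well_filtered A D"
          and t: "half_invertible t" and hD: "scalar_homotopy L D (differential D) t hD"
        using pieces[of "i - 1"] by blast
      obtain f where f: "f \<in> module_iso L (graded_piece C F (i - 1)) D"
        and f2: "(\<forall>j. f ` homog (graded_piece C F (i - 1)) j = homog D j) \<and>
          (\<forall>S\<in>carrier (graded_piece C F (i - 1)).
            f (differential (graded_piece C F (i - 1)) S) = differential D (f S))"
        using D(1) unfolding complexes_isomorphic_def by (elim bexE)
      have fd: "f (differential (graded_piece C F (i - 1)) S) = differential D (f S)"
        if "S \<in> carrier (graded_piece C F (i - 1))" for S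
        using conjunct2[OF f2] that by (rule bspec)
      have Df: "free_finitely_generated L D" using D(2) by (cases rule: well_filtered.cases)
      then have Dm: "module L D" by (simp add: free_finitely_generated_def)
      let ?\<pi> = "\<lambda>x. f (F i +>\<^bsub>C\<^esub> x)"
      have \<pi>: "?\<pi> \<in> module_hom L (?Y (i - 1)) D" "?\<pi> ` F (i - 1) = carrier D"
        "\<And>x. x \<in> F (i - 1) \<Longrightarrow> ?\<pi> x = \<zero>\<^bsub>D\<^esub> \<longleftrightarrow> x \<in> F i"
        using piece[OF Dm f] by simp_all
      have \<pi>d: "?\<pi> (?d x) = differential D (?\<pi> x)" if x: "x \<in> F (i - 1)" for x
      proof -
        have xc: "x \<in> carrier C" using FC x by auto
        have "F i +>\<^bsub>C\<^esub> x \<in> carrier (graded_piece C F (i - 1))"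
          using module.quotient_carrierI[OF Ym Fsub', of x "i - 1"] x
          unfolding quotient_complex_simps by simp
        from fd[OF this] show ?thesis
          using coset_d[OF xc, of i] unfolding quotient_complex_simps by simp
      qed
      have Fsubi: "submodule (F i) L (?Y (i - 1))" using Fsub'[of "i - 1"] by simp
      have st: "s \<in> carrier L" "t \<in> carrier L" using s t by (auto simp: half_invertible_def)
      have dd: "?d (?d x) = \<zero>\<^bsub>C\<^esub>" if "x \<in> F (i - 1)" for x
        using C.differential_square FC that by blast
      obtain h where "scalar_homotopy L (?Y (i - 1)) ?d (s \<otimes>\<^bsub>L\<^esub> t) h"
        by (rule scalar_homotopy_extension[OF Ym dY _ Fsubi _ Df \<pi>(1) _ _ _ st _ hD])
           (use dd dF \<pi> \<pi>d hX in \<open>auto simp del: laurent_simps\<close>)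
      then show ?case using half_invertible_mult[OF s t] by blast
    qed
    from this[of 0] have "\<exists>s h. half_invertible s \<and> scalar_homotopy L (?Y 0) ?d s h" using n by simp
    moreover have "?Y 0 = C" using F0 by simp
    ultimately show ?thesis by simp
  qed
qed


section \<open>Tensoring with a coefficient module that splits into two halves\<close>

context tensor_pair
begin

text \<open>For a submodule \<open>P\<close> of \<open>N\<close> this is the image of \<open>M \<otimes> P\<close> in \<open>M \<otimes> N\<close>.  Working with the image keeps
  everything inside a single tensor product.\<close>

definition sub_tensor :: "'e set \<Rightarrow> ('c \<times> 'e \<Rightarrow> 'a) set set"
  where "sub_tensor P = module_span R T {x \<otimes>\<^sub>T y | x y. x \<in> carrier M \<and> y \<in> P}"

lemma sub_tensor_generators:
  "P \<subseteq> carrier N \<Longrightarrow> {x \<otimes>\<^sub>T y | x y. x \<in> carrier M \<and> y \<in> P} \<subseteq> carrier T"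
  by auto

lemma pure_in_sub_tensor: "x \<in> carrier M \<Longrightarrow> y \<in> P \<Longrightarrow> x \<otimes>\<^sub>T y \<in> sub_tensor P"
  unfolding sub_tensor_def by (rule T.span_mem) auto

lemma sub_tensor_submodule: "P \<subseteq> carrier N \<Longrightarrow> submodule (sub_tensor P) R T"
  unfolding sub_tensor_def by (rule T.span_submodule[OF sub_tensor_generators])

lemma sub_tensor_hom_range:
  assumes "P \<subseteq> carrier N" "module R L" "f \<in> module_hom R T L" "submodule S R L"
    and "\<And>x y. x \<in> carrier M \<Longrightarrow> y \<in> P \<Longrightarrow> f (x \<otimes>\<^sub>T y) \<in> S" and "t \<in> sub_tensor P"
  shows "f t \<in> S"
  using T.span_hom_range[OF assms(2-4) sub_tensor_generators[OF assms(1)]] assms(5,6)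
  unfolding sub_tensor_def by auto

lemma sub_tensor_map:
  assumes P: "P \<subseteq> carrier N" and f: "f \<in> module_hom R M M" and t: "t \<in> sub_tensor P"
  shows "tensor_map R M N f t \<in> sub_tensor P"
proof (rule sub_tensor_hom_range[OF P T.module_axioms tensor_map_hom_pure(1)[OF f]
      sub_tensor_submodule[OF P] _ t])
  fix x y assume x: "x \<in> carrier M" and y: "y \<in> P"
  then have "y \<in> carrier N" using P by blast
  then show "tensor_map R M N f (x \<otimes>\<^sub>T y) \<in> sub_tensor P"
    using x y by (simp add: tensor_map_hom_pure(2)[OF f] module_hom_closed[OF f] pure_in_sub_tensor)
qed

lemma sub_tensor_sum:
  assumes P: "P \<subseteq> carrier N" and Q: "Q \<subseteq> carrier N"
    and split: "\<And>y. y \<in> carrier N \<Longrightarrow> \<exists>a\<in>P. \<exists>b\<in>Q. y = a \<oplus>\<^bsub>N\<^esub> b"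
    and t: "t \<in> carrier T"
  shows "\<exists>a\<in>sub_tensor P. \<exists>b\<in>sub_tensor Q. t = a \<oplus>\<^bsub>T\<^esub> b"
proof -
  let ?P = "sub_tensor P" and ?Q = "sub_tensor Q"
  note Ps = sub_tensor_submodule[OF P] and Qs = sub_tensor_submodule[OF Q]
  have c: "a \<in> carrier T" if "a \<in> ?P \<or> a \<in> ?Q" for a
    using that T.submoduleE(1)[OF Ps] T.submoduleE(1)[OF Qs] by auto
  let ?S = "{a \<oplus>\<^bsub>T\<^esub> b | a b. a \<in> ?P \<and> b \<in> ?Q}"
  have S: "submodule ?S R T"
  proof (rule T.submoduleI)
    show "?S \<subseteq> carrier T" using c by auto
    have "\<zero>\<^bsub>T\<^esub> = \<zero>\<^bsub>T\<^esub> \<oplus>\<^bsub>T\<^esub> \<zero>\<^bsub>T\<^esub>" by simp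
    then show "\<zero>\<^bsub>T\<^esub> \<in> ?S" using T.submodule_zero[OF Ps] T.submodule_zero[OF Qs] by blast
    fix u assume "u \<in> ?S"
    then obtain a b where u: "u = a \<oplus>\<^bsub>T\<^esub> b" "a \<in> ?P" "b \<in> ?Q" by blast
    have "\<ominus>\<^bsub>T\<^esub> u = \<ominus>\<^bsub>T\<^esub> a \<oplus>\<^bsub>T\<^esub> \<ominus>\<^bsub>T\<^esub> b" using u c by (simp add: T.M.minus_add)
    then show "\<ominus>\<^bsub>T\<^esub> u \<in> ?S" using T.submoduleE(3)[OF Ps u(2)] T.submoduleE(3)[OF Qs u(3)] by blast
    fix w assume "w \<in> ?S"
    then obtain a' b' where w: "w = a' \<oplus>\<^bsub>T\<^esub> b'" "a' \<in> ?P" "b' \<in> ?Q" by blast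
    have "u \<oplus>\<^bsub>T\<^esub> w = (a \<oplus>\<^bsub>T\<^esub> a') \<oplus>\<^bsub>T\<^esub> (b \<oplus>\<^bsub>T\<^esub> b')" using u w c by (simp add: T.M.add.m_ac)
    then show "u \<oplus>\<^bsub>T\<^esub> w \<in> ?S"
      using T.submoduleE(5)[OF Ps u(2) w(2)] T.submoduleE(5)[OF Qs u(3) w(3)] by blast
  next
    fix r u assume r: "r \<in> carrier R" and "u \<in> ?S"
    then obtain a b where u: "u = a \<oplus>\<^bsub>T\<^esub> b" "a \<in> ?P" "b \<in> ?Q" by blast
    have "r \<odot>\<^bsub>T\<^esub> u = r \<odot>\<^bsub>T\<^esub> a \<oplus>\<^bsub>T\<^esub> r \<odot>\<^bsub>T\<^esub> b" using u r c by (simp add: T.smult_r_distr)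
    then show "r \<odot>\<^bsub>T\<^esub> u \<in> ?S"
      using T.submoduleE(4)[OF Ps r u(2)] T.submoduleE(4)[OF Qs r u(3)] by blast
  qed
  have "t \<in> ?S"
  proof (rule tensor_hom_range[OF T.module_axioms T.id_hom S _ t])
    fix x y assume x: "x \<in> carrier M" and "y \<in> carrier N"
    then obtain a b where ab: "a \<in> P" "b \<in> Q" "y = a \<oplus>\<^bsub>N\<^esub> b" using split by blast
    then have "a \<in> carrier N" "b \<in> carrier N" using P Q by auto
    then have "x \<otimes>\<^sub>T y = x \<otimes>\<^sub>T a \<oplus>\<^bsub>T\<^esub> x \<otimes>\<^sub>T b" unfolding ab(3) using x by (simp add: pure_add_right)
    then show "x \<otimes>\<^sub>T y \<in> ?S" using pure_in_sub_tensor[OF x ab(1)] pure_in_sub_tensor[OF x ab(2)] by blast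
  qed
  then show ?thesis by blast
qed

lemma sub_tensor_smult_surj:
  assumes P: "P \<subseteq> carrier N" and s: "s \<in> carrier R" and surj: "P \<subseteq> (\<lambda>y. s \<odot>\<^bsub>N\<^esub> y) ` P"
    and t: "t \<in> sub_tensor P"
  shows "\<exists>t'\<in>sub_tensor P. t = s \<odot>\<^bsub>T\<^esub> t'"
proof -
  have "t \<in> (\<lambda>t. s \<odot>\<^bsub>T\<^esub> t) ` sub_tensor P"
  proof (rule sub_tensor_hom_range[OF P T.module_axioms T.id_hom _ _ t])
    show "submodule ((\<lambda>t. s \<odot>\<^bsub>T\<^esub> t) ` sub_tensor P) R T"
      using module_hom_image_submodule[OF T.module_axioms T.module_axioms T.smult_hom[OF s]
          sub_tensor_submodule[OF P]] .
    fix x y assume x: "x \<in> carrier M" and "y \<in> P"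
    then obtain y' where y': "y' \<in> P" "y = s \<odot>\<^bsub>N\<^esub> y'" using surj by blast
    then have "y' \<in> carrier N" using P by auto
    then have "x \<otimes>\<^sub>T y = s \<odot>\<^bsub>T\<^esub> (x \<otimes>\<^sub>T y')" unfolding y'(2) using x s by (simp add: pure_smult_right)
    then show "x \<otimes>\<^sub>T y \<in> (\<lambda>t. s \<odot>\<^bsub>T\<^esub> t) ` sub_tensor P"
      using pure_in_sub_tensor[OF x y'(1)] by blast
  qed
  then show ?thesis by blast
qed

text \<open>The functional \<open>\<phi>\<close> on \<open>M\<close> extended to the tensor product, \<open>x \<otimes> y \<mapsto> \<phi> x y\<close>.\<close>

definition coord :: "('c \<Rightarrow> 'a) \<Rightarrow> ('c \<times> 'e \<Rightarrow> 'a) set \<Rightarrow> 'e"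
  where "coord \<phi> = (SOME \<Lambda>. \<Lambda> \<in> module_hom R T N \<and>
    (\<forall>x\<in>carrier M. \<forall>y\<in>carrier N. \<Lambda> (x \<otimes>\<^sub>T y) = \<phi> x \<odot>\<^bsub>N\<^esub> y))"

lemma coord:
  assumes \<phi>: "\<phi> \<in> module_hom R M (regular_module R)"
  shows coord_hom: "coord \<phi> \<in> module_hom R T N"
    and coord_pure: "x \<in> carrier M \<Longrightarrow> y \<in> carrier N \<Longrightarrow> coord \<phi> (x \<otimes>\<^sub>T y) = \<phi> x \<odot>\<^bsub>N\<^esub> y"
proof -
  have left: "(\<lambda>x. \<phi> x \<odot>\<^bsub>N\<^esub> y) \<in> module_hom R M N" if "y \<in> carrier N" for y
    by (rule module_hom_scale[OF M.module_axioms N.module_axioms \<phi> that])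
  have right: "(\<lambda>y. \<phi> x \<odot>\<^bsub>N\<^esub> y) \<in> module_hom R N N" if "x \<in> carrier M" for x
    using N.smult_hom module_hom_closed[OF \<phi> that] by simp
  obtain \<Lambda> where "\<Lambda> \<in> module_hom R T N"
    "\<And>x y. x \<in> carrier M \<Longrightarrow> y \<in> carrier N \<Longrightarrow> \<Lambda> (x \<otimes>\<^sub>T y) = \<phi> x \<odot>\<^bsub>N\<^esub> y"
    by (rule tensor_universal[OF N.module_axioms, where \<beta> = "\<lambda>x y. \<phi> x \<odot>\<^bsub>N\<^esub> y"])
       (use left right in auto)
  then have "\<exists>\<Lambda>. \<Lambda> \<in> module_hom R T N \<and>
    (\<forall>x\<in>carrier M. \<forall>y\<in>carrier N. \<Lambda> (x \<otimes>\<^sub>T y) = \<phi> x \<odot>\<^bsub>N\<^esub> y)" by blast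
  from someI_ex[OF this] show "coord \<phi> \<in> module_hom R T N"
    "x \<in> carrier M \<Longrightarrow> y \<in> carrier N \<Longrightarrow> coord \<phi> (x \<otimes>\<^sub>T y) = \<phi> x \<odot>\<^bsub>N\<^esub> y"
    unfolding coord_def by blast+
qed

lemma coord_sub_tensor:
  assumes "\<phi> \<in> module_hom R M (regular_module R)" "submodule P R N" "t \<in> sub_tensor P"
  shows "coord \<phi> t \<in> P"
proof -
  have PN: "P \<subseteq> carrier N" using N.submoduleE(1)[OF assms(2)] .
  show ?thesis
  proof (rule sub_tensor_hom_range[OF PN N.module_axioms coord_hom[OF assms(1)] assms(2) _ assms(3)])
    fix x y assume xy: "x \<in> carrier M" "y \<in> P"
    then show "coord \<phi> (x \<otimes>\<^sub>T y) \<in> P"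
      using PN coord_pure[OF assms(1) xy(1), of y] N.submoduleE(4)[OF assms(2) _ xy(2)]
        module_hom_closed[OF assms(1) xy(1)] by auto
  qed
qed

text \<open>Elements of \<open>M \<otimes> N\<close> have coordinates in \<open>N\<close> with respect to a basis of \<open>M\<close>.  This replaces flatness
  of \<open>M\<close>: what is true in \<open>N\<close> coordinate by coordinate is true in \<open>M \<otimes> N\<close>.\<close>

lemma tensor_expand:
  assumes B: "finite B" "B \<subseteq> carrier M"
    and \<phi>: "\<And>b. b \<in> B \<Longrightarrow> \<phi> b \<in> module_hom R M (regular_module R)"
    and rep: "\<And>x. x \<in> carrier M \<Longrightarrow> x = (\<Oplus>\<^bsub>M\<^esub>b\<in>B. \<phi> b x \<odot>\<^bsub>M\<^esub> b)"
    and t: "t \<in> carrier T"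
  shows "t = (\<Oplus>\<^bsub>T\<^esub>b\<in>B. b \<otimes>\<^sub>T coord (\<phi> b) t)"
proof (rule tensor_hom_eqI[OF T.module_axioms T.id_hom _ _ t])
  have BM: "b \<in> carrier M" if "b \<in> B" for b using B that by auto
  show "(\<lambda>t. \<Oplus>\<^bsub>T\<^esub>b\<in>B. b \<otimes>\<^sub>T coord (\<phi> b) t) \<in> module_hom R T T"
    using module_hom_comp[OF coord_hom[OF \<phi>] pure_hom_right[OF BM]]
    by (intro module_hom_finsumf[OF T.module_axioms T.module_axioms B(1)]) blast
  fix x y assume x: "x \<in> carrier M" and y: "y \<in> carrier N"
  have c: "\<phi> b x \<in> carrier R" if "b \<in> B" for b using module_hom_closed[OF \<phi>[OF that] x] by simp
  have "x \<otimes>\<^sub>T y = (\<Oplus>\<^bsub>M\<^esub>b\<in>B. \<phi> b x \<odot>\<^bsub>M\<^esub> b) \<otimes>\<^sub>T y" using rep[OF x] by simp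
  also have "\<dots> = (\<Oplus>\<^bsub>T\<^esub>b\<in>B. (\<phi> b x \<odot>\<^bsub>M\<^esub> b) \<otimes>\<^sub>T y)"
    using module_hom_finsum[OF M.module_axioms T.module_axioms pure_hom_left[OF y] B(1),
        of "\<lambda>b. \<phi> b x \<odot>\<^bsub>M\<^esub> b"] c BM by auto
  also have "\<dots> = (\<Oplus>\<^bsub>T\<^esub>b\<in>B. b \<otimes>\<^sub>T coord (\<phi> b) (x \<otimes>\<^sub>T y))"
  proof (rule T.finsum_cong')
    fix b assume b: "b \<in> B"
    show "(\<phi> b x \<odot>\<^bsub>M\<^esub> b) \<otimes>\<^sub>T y = b \<otimes>\<^sub>T coord (\<phi> b) (x \<otimes>\<^sub>T y)"
      using coord_pure[OF \<phi>[OF b] x y] pure_smult_left[OF c[OF b] BM[OF b] y]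
        pure_smult_right[OF c[OF b] BM[OF b] y] by simp
  qed (use BM x y module_hom_closed[OF coord_hom[OF \<phi>]] in auto)
  finally show "x \<otimes>\<^sub>T y = (\<Oplus>\<^bsub>T\<^esub>b\<in>B. b \<otimes>\<^sub>T coord (\<phi> b) (x \<otimes>\<^sub>T y))" .
qed

end

text \<open>A coefficient module \<open>N\<close> that is the sum of two submodules \<open>P\<close> and \<open>Q\<close> meeting in a copy \<open>R e\<close> of \<open>R\<close>,
  that is, an exact sequence \<open>0 \<rightarrow> R \<rightarrow> P \<oplus> Q \<rightarrow> N \<rightarrow> 0\<close>, together with a scalar that is null-homotopic on the
  complex and acts bijectively on \<open>P\<close> and on \<open>Q\<close>.\<close>

locale split_coefficients =
  C: graded_complex R C + tensor_pair R C N
  for R :: "('r, 'm) ring_scheme" and C :: "('r, 'c) cochain_complex" and N :: "('r, 'e, 'k) module_scheme" +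
  fixes s :: 'r and h :: "'c \<Rightarrow> 'c" and P Q e
  assumes free: "free_finitely_generated R C"
    and s: "s \<in> carrier R" and homotopy: "scalar_homotopy R C (differential C) s h"
    and P: "submodule P R N" and Q: "submodule Q R N"
    and split: "\<And>y. y \<in> carrier N \<Longrightarrow> \<exists>a\<in>P. \<exists>b\<in>Q. y = a \<oplus>\<^bsub>N\<^esub> b"
    and e: "e \<in> P" "e \<in> Q"
    and cyclic: "\<And>y. y \<in> P \<Longrightarrow> y \<in> Q \<Longrightarrow> \<exists>r\<in>carrier R. y = r \<odot>\<^bsub>N\<^esub> e"
    and torsion_free: "\<And>r. r \<in> carrier R \<Longrightarrow> r \<odot>\<^bsub>N\<^esub> e = \<zero>\<^bsub>N\<^esub> \<Longrightarrow> r = \<zero>\<^bsub>R\<^esub>"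
    and bij: "bij_betw (\<lambda>y. s \<odot>\<^bsub>N\<^esub> y) P P" "bij_betw (\<lambda>y. s \<odot>\<^bsub>N\<^esub> y) Q Q"
begin

abbreviation pureC (infixl "\<otimes>\<^sub>T" 70) where "x \<otimes>\<^sub>T y \<equiv> pure_tensor R C N x y"
abbreviation "d \<equiv> differential C"
abbreviation "dT \<equiv> tensor_map R C N d"

lemma PN: "P \<subseteq> carrier N" and QN: "Q \<subseteq> carrier N"
  using N.submoduleE(1)[OF P] N.submoduleE(1)[OF Q] by auto

lemma eN: "e \<in> carrier N"
  using PN e by auto

lemmas d_hom = C.differential_hom
lemmas dT_hom = tensor_map_hom_pure(1)[OF d_hom]
lemmas dT_pure = tensor_map_hom_pure(2)[OF d_hom]
lemmas d_closed = module_hom_closed[OF d_hom]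
lemmas dT_closed = module_hom_closed[OF dT_hom]

lemma h_hom: "h \<in> module_hom R C C"
  and h_eq: "x \<in> carrier C \<Longrightarrow> d (h x) \<oplus>\<^bsub>C\<^esub> h (d x) = s \<odot>\<^bsub>C\<^esub> x"
  using homotopy by (auto simp: scalar_homotopy_def)

lemma zero_tensor: "y \<in> carrier N \<Longrightarrow> \<zero>\<^bsub>C\<^esub> \<otimes>\<^sub>T y = \<zero>\<^bsub>T\<^esub>"
  using module_hom_zero[OF C.module_axioms T.module_axioms pure_hom_left] .

lemma coordinates:
  obtains B \<phi> where "finite B" "B \<subseteq> carrier C"
    "\<And>b. b \<in> B \<Longrightarrow> \<phi> b \<in> module_hom R C (regular_module R)"
    "\<And>x. x \<in> carrier C \<Longrightarrow> x = (\<Oplus>\<^bsub>C\<^esub>b\<in>B. \<phi> b x \<odot>\<^bsub>C\<^esub> b)"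
    "\<And>t. t \<in> carrier T \<Longrightarrow> t = (\<Oplus>\<^bsub>T\<^esub>b\<in>B. b \<otimes>\<^sub>T coord (\<phi> b) t)"
proof (rule free_dual_basis[OF free])
  fix B \<phi>
  assume B: "finite B" "B \<subseteq> carrier C"
    "\<And>b. b \<in> B \<Longrightarrow> \<phi> b \<in> module_hom R C (regular_module R)"
    "\<And>x. x \<in> carrier C \<Longrightarrow> x = (\<Oplus>\<^bsub>C\<^esub>b\<in>B. \<phi> b x \<odot>\<^bsub>C\<^esub> b)"
  show thesis by (rule that[OF B tensor_expand[OF B]])
qed

lemma sub_tensor_smult_inj:
  assumes S: "submodule S R N" and inj: "inj_on (\<lambda>y. s \<odot>\<^bsub>N\<^esub> y) S"
    and t: "t \<in> sub_tensor S" and st: "s \<odot>\<^bsub>T\<^esub> t = \<zero>\<^bsub>T\<^esub>"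
  shows "t = \<zero>\<^bsub>T\<^esub>"
proof -
  obtain B \<phi> where B: "finite B" "B \<subseteq> carrier C"
    and \<phi>: "\<And>b. b \<in> B \<Longrightarrow> \<phi> b \<in> module_hom R C (regular_module R)"
    and ex: "\<And>t. t \<in> carrier T \<Longrightarrow> t = (\<Oplus>\<^bsub>T\<^esub>b\<in>B. b \<otimes>\<^sub>T coord (\<phi> b) t)"
    by (rule coordinates) (rule that)
  have SN: "S \<subseteq> carrier N" using N.submoduleE(1)[OF S] .
  have tT: "t \<in> carrier T" using T.submoduleE(1)[OF sub_tensor_submodule[OF SN]] t by auto
  have "coord (\<phi> b) t = \<zero>\<^bsub>N\<^esub>" if b: "b \<in> B" for b
  proof -
    note ch = coord_hom[OF \<phi>[OF b]]
    have "s \<odot>\<^bsub>N\<^esub> coord (\<phi> b) t = s \<odot>\<^bsub>N\<^esub> \<zero>\<^bsub>N\<^esub>"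
      using module_hom_smult[OF ch s tT, symmetric] module_hom_zero[OF T.module_axioms N.module_axioms ch]
      by (simp add: st N.smult_r_null[OF s])
    then show ?thesis
      using inj coord_sub_tensor[OF \<phi>[OF b] S t] N.submodule_zero[OF S] by (simp add: inj_on_def)
  qed
  moreover have "b \<otimes>\<^sub>T \<zero>\<^bsub>N\<^esub> = \<zero>\<^bsub>T\<^esub>" if "b \<in> B" for b
    using module_hom_zero[OF N.module_axioms T.module_axioms pure_hom_right] that B by auto
  ultimately have "(\<Oplus>\<^bsub>T\<^esub>b\<in>B. b \<otimes>\<^sub>T coord (\<phi> b) t) = \<zero>\<^bsub>T\<^esub>"
    by (intro T.M.add.finprod_one_eqI) simp
  then show ?thesis using ex[OF tT] by simp
qed

lemma sub_tensor_Int: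
  assumes "t \<in> sub_tensor P" "t \<in> sub_tensor Q"
  obtains c where "c \<in> carrier C" "t = c \<otimes>\<^sub>T e"
proof -
  obtain B \<phi> where B: "finite B" "B \<subseteq> carrier C"
    and \<phi>: "\<And>b. b \<in> B \<Longrightarrow> \<phi> b \<in> module_hom R C (regular_module R)"
    and ex: "\<And>t. t \<in> carrier T \<Longrightarrow> t = (\<Oplus>\<^bsub>T\<^esub>b\<in>B. b \<otimes>\<^sub>T coord (\<phi> b) t)"
    by (rule coordinates) (rule that)
  have tT: "t \<in> carrier T" using T.submoduleE(1)[OF sub_tensor_submodule[OF PN]] assms by auto
  have "\<exists>r\<in>carrier R. coord (\<phi> b) t = r \<odot>\<^bsub>N\<^esub> e" if "b \<in> B" for b
    using coord_sub_tensor[OF \<phi>[OF that] P assms(1)] coord_sub_tensor[OF \<phi>[OF that] Q assms(2)]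
    by (rule cyclic)
  then obtain r where r: "\<And>b. b \<in> B \<Longrightarrow> r b \<in> carrier R" "\<And>b. b \<in> B \<Longrightarrow> coord (\<phi> b) t = r b \<odot>\<^bsub>N\<^esub> e"
    by metis
  have BM: "b \<in> carrier C" if "b \<in> B" for b using B that by auto
  let ?c = "\<Oplus>\<^bsub>C\<^esub>b\<in>B. r b \<odot>\<^bsub>C\<^esub> b"
  have "?c \<otimes>\<^sub>T e = (\<Oplus>\<^bsub>T\<^esub>b\<in>B. (r b \<odot>\<^bsub>C\<^esub> b) \<otimes>\<^sub>T e)"
    using module_hom_finsum[OF C.module_axioms T.module_axioms pure_hom_left[OF eN] B(1),
        of "\<lambda>b. r b \<odot>\<^bsub>C\<^esub> b"] r BM by auto
  also have "\<dots> = (\<Oplus>\<^bsub>T\<^esub>b\<in>B. b \<otimes>\<^sub>T coord (\<phi> b) t)"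
    using r BM eN by (intro T.finsum_cong') (auto simp: pure_smult_left pure_smult_right)
  also have "\<dots> = t" using ex[OF tT] by simp
  finally show thesis using that[of ?c] r BM by (auto intro!: C.M.finsum_closed)
qed

lemma tensor_unit_inj:
  assumes c: "c \<in> carrier C" and "c \<otimes>\<^sub>T e = \<zero>\<^bsub>T\<^esub>"
  shows "c = \<zero>\<^bsub>C\<^esub>"
proof -
  obtain B \<phi> where B: "finite B" "B \<subseteq> carrier C"
    and \<phi>: "\<And>b. b \<in> B \<Longrightarrow> \<phi> b \<in> module_hom R C (regular_module R)"
    and rep: "\<And>x. x \<in> carrier C \<Longrightarrow> x = (\<Oplus>\<^bsub>C\<^esub>b\<in>B. \<phi> b x \<odot>\<^bsub>C\<^esub> b)"
    by (rule coordinates) (rule that)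
  have "\<phi> b c \<odot>\<^bsub>C\<^esub> b = \<zero>\<^bsub>C\<^esub>" if b: "b \<in> B" for b
  proof -
    have "\<phi> b c \<odot>\<^bsub>N\<^esub> e = \<zero>\<^bsub>N\<^esub>"
      using coord_pure[OF \<phi>[OF b] c eN] assms(2)
        module_hom_zero[OF T.module_axioms N.module_axioms coord_hom[OF \<phi>[OF b]]] by simp
    moreover have "\<phi> b c \<in> carrier R" using module_hom_closed[OF \<phi>[OF b] c] by simp
    ultimately have "\<phi> b c = \<zero>\<^bsub>R\<^esub>" by (intro torsion_free)
    then show ?thesis using B b by auto
  qed
  then have "(\<Oplus>\<^bsub>C\<^esub>b\<in>B. \<phi> b c \<odot>\<^bsub>C\<^esub> b) = \<zero>\<^bsub>C\<^esub>" by (intro C.M.add.finprod_one_eqI) simp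
  then show ?thesis using rep[OF c] by simp
qed

lemma dT_square: "t \<in> carrier T \<Longrightarrow> dT (dT t) = \<zero>\<^bsub>T\<^esub>"
proof -
  assume t: "t \<in> carrier T"
  have "dT (dT t) \<in> {\<zero>\<^bsub>T\<^esub>}"
  proof (rule tensor_hom_range[OF T.module_axioms module_hom_comp[OF dT_hom dT_hom] _ _ t])
    show "submodule {\<zero>\<^bsub>T\<^esub>} R T" by (rule T.submoduleI) auto
    show "dT (dT (x \<otimes>\<^sub>T y)) \<in> {\<zero>\<^bsub>T\<^esub>}" if "x \<in> carrier C" "y \<in> carrier N" for x y
      using that d_closed C.differential_square zero_tensor by (simp add: dT_pure)
  qed
  then show ?thesis by simp
qed

text \<open>Multiplication by \<open>s\<close> is homotopic to zero on the image of \<open>C \<otimes> S\<close>, and it is also bijective there.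
  So a cocycle \<open>t\<close> is \<open>s t'\<close> for a cocycle \<open>t'\<close>, and the homotopy turns \<open>s t'\<close> into a coboundary.\<close>

lemma sub_tensor_acyclic:
  assumes S: "submodule S R N" and bij: "bij_betw (\<lambda>y. s \<odot>\<^bsub>N\<^esub> y) S S"
    and t: "t \<in> sub_tensor S" and dt: "dT t = \<zero>\<^bsub>T\<^esub>"
  obtains w where "w \<in> carrier T" "t = dT w"
proof -
  let ?hT = "tensor_map R C N h"
  have SN: "S \<subseteq> carrier N" using N.submoduleE(1)[OF S] .
  note hT = tensor_map_hom_pure(1)[OF h_hom]
  have "S \<subseteq> (\<lambda>y. s \<odot>\<^bsub>N\<^esub> y) ` S" using bij by (simp add: bij_betw_def)
  from sub_tensor_smult_surj[OF SN s this t] obtain t'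
    where t': "t' \<in> sub_tensor S" "t = s \<odot>\<^bsub>T\<^esub> t'" by auto
  have tT: "t' \<in> carrier T" using T.submoduleE(1)[OF sub_tensor_submodule[OF SN]] t' by auto
  have "s \<odot>\<^bsub>T\<^esub> dT t' = \<zero>\<^bsub>T\<^esub>" using module_hom_smult[OF dT_hom s tT] t' dt by simp
  then have dt': "dT t' = \<zero>\<^bsub>T\<^esub>"
    using sub_tensor_smult_inj[OF S bij_betw_imp_inj_on[OF bij] sub_tensor_map[OF SN d_hom t'(1)]] by simp
  have "dT (?hT t') \<oplus>\<^bsub>T\<^esub> ?hT (dT t') = s \<odot>\<^bsub>T\<^esub> t'"
  proof (rule tensor_hom_eqI[OF T.module_axioms _ T.smult_hom[OF s] _ tT])
    show "(\<lambda>t. dT (?hT t) \<oplus>\<^bsub>T\<^esub> ?hT (dT t)) \<in> module_hom R T T"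
      by (intro module_hom_addf[OF T.module_axioms T.module_axioms] module_hom_comp[OF hT dT_hom]
          module_hom_comp[OF dT_hom hT])
    fix x y assume x: "x \<in> carrier C" and y: "y \<in> carrier N"
    have "dT (?hT (x \<otimes>\<^sub>T y)) \<oplus>\<^bsub>T\<^esub> ?hT (dT (x \<otimes>\<^sub>T y)) = d (h x) \<otimes>\<^sub>T y \<oplus>\<^bsub>T\<^esub> h (d x) \<otimes>\<^sub>T y"
      using x y d_closed module_hom_closed[OF h_hom] by (simp add: dT_pure tensor_map_hom_pure(2)[OF h_hom])
    also have "\<dots> = (d (h x) \<oplus>\<^bsub>C\<^esub> h (d x)) \<otimes>\<^sub>T y"
      using x y d_closed module_hom_closed[OF h_hom] by (simp add: pure_add_left)
    finally show "dT (?hT (x \<otimes>\<^sub>T y)) \<oplus>\<^bsub>T\<^esub> ?hT (dT (x \<otimes>\<^sub>T y)) = s \<odot>\<^bsub>T\<^esub> (x \<otimes>\<^sub>T y)"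
      using h_eq[OF x] x y s by (simp add: pure_smult_left)
  qed
  then have "t = dT (?hT t')"
    using dt' module_hom_zero[OF T.module_axioms T.module_axioms hT] t'(2)
      dT_closed[OF module_hom_closed[OF hT tT]] by simp
  then show thesis using that module_hom_closed[OF hT tT] by blast
qed

abbreviation "proj i \<equiv> C.component i"
abbreviation "compT i \<equiv> tensor_map R C N (proj i)"

definition homogT :: "int \<Rightarrow> ('c \<times> 'e \<Rightarrow> 'r) set set"
  where "homogT i = module_span R T {x \<otimes>\<^sub>T y | x y. x \<in> homog C i \<and> y \<in> carrier N}"

lemmas compT_hom = tensor_map_hom_pure(1)[OF C.component_hom]
lemmas compT_pure = tensor_map_hom_pure(2)[OF C.component_hom]
lemmas comp_closed = module_hom_closed[OF C.component_hom]

lemma homogT_submodule: "submodule (homogT i) R T"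
  unfolding homogT_def using C.homog_closed by (intro T.span_submodule) auto

lemma homogT_closed: "t \<in> homogT i \<Longrightarrow> t \<in> carrier T"
  using T.submoduleE(1)[OF homogT_submodule] by blast

lemma compT_homogT:
  assumes t: "t \<in> homogT i"
  shows "compT i t = t"
proof (rule T.span_hom_eqI[OF T.module_axioms compT_hom T.id_hom _ _ t[unfolded homogT_def]])
  show "{x \<otimes>\<^sub>T y | x y. x \<in> homog C i \<and> y \<in> carrier N} \<subseteq> carrier T" using C.homog_closed by auto
  show "compT i u = u" if "u \<in> {x \<otimes>\<^sub>T y | x y. x \<in> homog C i \<and> y \<in> carrier N}" for u
    using that C.homog_closed by (auto simp: compT_pure C.component_homog)
qed

lemma compT_mem: "t \<in> carrier T \<Longrightarrow> compT i t \<in> homogT i"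
proof (rule tensor_hom_range[OF T.module_axioms compT_hom homogT_submodule])
  fix x y assume "x \<in> carrier C" "y \<in> carrier N"
  then show "compT i (x \<otimes>\<^sub>T y) \<in> homogT i"
    unfolding homogT_def using C.component_mem by (intro T.span_mem) (auto simp: compT_pure)
qed

lemma compT_dT:
  assumes t: "t \<in> carrier T"
  shows "compT (i + 1) (dT t) = dT (compT i t)"
proof (rule tensor_hom_eqI[OF T.module_axioms module_hom_comp[OF dT_hom compT_hom]
      module_hom_comp[OF compT_hom dT_hom] _ t])
  fix x y assume "x \<in> carrier C" "y \<in> carrier N"
  then show "compT (i + 1) (dT (x \<otimes>\<^sub>T y)) = dT (compT i (x \<otimes>\<^sub>T y))"
    using d_closed comp_closed by (simp add: compT_pure dT_pure C.component_differential)
qed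

lemma dT_homogT: "t \<in> homogT i \<Longrightarrow> dT t \<in> homogT (i + 1)"
  using compT_mem[of "dT t" "i + 1"] compT_dT[of t i] compT_homogT[of t i] homogT_closed dT_closed by simp

text \<open>The homotopy equation survives when \<open>h\<close> is replaced by its part of degree \<open>-1\<close>.\<close>

lemma comp_homotopy:
  assumes x: "x \<in> carrier C"
  shows "d (proj i (h x)) \<oplus>\<^bsub>C\<^esub> proj (i + 1) (h (d x)) = s \<odot>\<^bsub>C\<^esub> proj (i + 1) x"
proof -
  note hc = module_hom_closed[OF h_hom]
  have "d (proj i (h x)) = proj (i + 1) (d (h x))"
    using C.component_differential[OF hc[OF x]] by simp
  then have "d (proj i (h x)) \<oplus>\<^bsub>C\<^esub> proj (i + 1) (h (d x)) = proj (i + 1) (d (h x) \<oplus>\<^bsub>C\<^esub> h (d x))"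
    using module_hom_add[OF C.component_hom] x hc d_closed by simp
  then show ?thesis using h_eq[OF x] module_hom_smult[OF C.component_hom s x] by simp
qed

text \<open>Let \<open>a\<close> in \<open>P\<close> and \<open>b\<close> in \<open>Q\<close> be the two inverse images of \<open>e\<close> under \<open>s\<close>, and \<open>\<theta> = a - b\<close>, so that
  \<open>s \<theta> = 0\<close>.  With \<open>g\<close> the degree \<open>-1\<close> part of \<open>h\<close>, a cocycle \<open>z\<close> of degree \<open>i + 1\<close> satisfies \<open>d (g z) = s z\<close>,
  hence \<open>z \<otimes> e\<close> is the coboundary of \<open>g z \<otimes> a\<close> in the first half and of \<open>g z \<otimes> b\<close> in the second.  The
  difference \<open>g z \<otimes> \<theta>\<close> of these two primitives is a cocycle of degree \<open>i\<close> in \<open>C \<otimes> N\<close>; this is the inverse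
  of the connecting map of \<open>0 \<rightarrow> C \<rightarrow> C \<otimes> P \<oplus> C \<otimes> Q \<rightarrow> C \<otimes> N \<rightarrow> 0\<close>, up to sign.\<close>

lemma cohomology_shift:
  "modules_isomorphic R (quotient_module (C\<lparr>carrier := {x \<in> homog C (i + 1). d x = \<zero>\<^bsub>C\<^esub>}\<rparr>) (d ` homog C i))
     (quotient_module (T\<lparr>carrier := {t \<in> homogT i. dT t = \<zero>\<^bsub>T\<^esub>}\<rparr>) (dT ` homogT (i - 1)))"
proof -
  let ?Z = "{x \<in> homog C (i + 1). d x = \<zero>\<^bsub>C\<^esub>}" and ?ZT = "{t \<in> homogT i. dT t = \<zero>\<^bsub>T\<^esub>}"
  let ?B = "d ` homog C i" and ?BT = "dT ` homogT (i - 1)"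
  note hc = module_hom_closed[OF h_hom]
  have Z: "submodule ?Z R C"
  proof -
    interpret H: module R "C\<lparr>carrier := homog C (i + 1)\<rparr>"
      using submodule.submodule_is_module[OF C.homog_submodule C.module_axioms] .
    have "d \<in> module_hom R (C\<lparr>carrier := homog C (i + 1)\<rparr>) C"
      using d_hom C.homog_closed by (auto simp: module_hom_def)
    from module_hom_kernel_submodule[OF H.module_axioms C.module_axioms this]
    show ?thesis using C.submodule_restrict_iff[OF C.homog_submodule] by simp
  qed
  have ZT: "submodule ?ZT R T"
  proof -
    interpret H: module R "T\<lparr>carrier := homogT i\<rparr>"
      using submodule.submodule_is_module[OF homogT_submodule T.module_axioms] .
    have "dT \<in> module_hom R (T\<lparr>carrier := homogT i\<rparr>) T"
      using dT_hom homogT_closed by (auto simp: module_hom_def)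
    from module_hom_kernel_submodule[OF H.module_axioms T.module_axioms this]
    show ?thesis using T.submodule_restrict_iff[OF homogT_submodule] by simp
  qed
  have ZC: "x \<in> carrier C" if "x \<in> ?Z" for x using that C.homog_closed by auto
  have BZ: "?B \<subseteq> ?Z" using C.homog_closed C.differential_degree C.differential_square by auto
  have BZT: "?BT \<subseteq> ?ZT" using homogT_closed dT_homogT[of _ "i - 1"] dT_square by auto
  have Zm: "module R (C\<lparr>carrier := ?Z\<rparr>)" using submodule.submodule_is_module[OF Z C.module_axioms] .
  have ZTm: "module R (T\<lparr>carrier := ?ZT\<rparr>)" using submodule.submodule_is_module[OF ZT T.module_axioms] .
  have Bs: "submodule ?B R (C\<lparr>carrier := ?Z\<rparr>)"
    using C.submodule_restrict_iff[OF Z] BZ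
      module_hom_image_submodule[OF C.module_axioms C.module_axioms d_hom C.homog_submodule] by blast
  have BTs: "submodule ?BT R (T\<lparr>carrier := ?ZT\<rparr>)"
    using T.submodule_restrict_iff[OF ZT] BZT
      module_hom_image_submodule[OF T.module_axioms T.module_axioms dT_hom homogT_submodule] by blast
  obtain a where a: "a \<in> P" "s \<odot>\<^bsub>N\<^esub> a = e"
    using bij_betw_imp_surj_on[OF bij(1)] e(1) by (metis imageE)
  obtain b where b: "b \<in> Q" "s \<odot>\<^bsub>N\<^esub> b = e"
    using bij_betw_imp_surj_on[OF bij(2)] e(2) by (metis imageE)
  have abN: "a \<in> carrier N" "b \<in> carrier N" using a b PN QN by auto
  define \<theta> where "\<theta> = a \<ominus>\<^bsub>N\<^esub> b"
  have \<theta>: "\<theta> \<in> carrier N" unfolding \<theta>_def using abN by simp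
  have s\<theta>: "s \<odot>\<^bsub>N\<^esub> \<theta> = \<zero>\<^bsub>N\<^esub>"
    unfolding \<theta>_def using module_hom_minus[OF N.module_axioms N.module_axioms N.smult_hom[OF s] abN]
      a b eN by (simp add: N.minus_eq N.r_neg)
  define g where "g x = proj i (h x)" for x
  have gc: "g x \<in> carrier C" "g x \<in> homog C i" if "x \<in> carrier C" for x
    unfolding g_def using C.component_mem[OF hc[OF that]] C.homog_closed by auto
  have ghom: "g \<in> module_hom R C C"
    unfolding g_def[abs_def] by (rule module_hom_comp[OF h_hom C.component_hom])
  have dg: "d (g z) = s \<odot>\<^bsub>C\<^esub> z" if z: "z \<in> ?Z" for z
  proof -
    have "h (d z) = \<zero>\<^bsub>C\<^esub>" using z module_hom_zero[OF C.module_axioms C.module_axioms h_hom] by simp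
    then have "proj (i + 1) (h (d z)) = \<zero>\<^bsub>C\<^esub>"
      using module_hom_zero[OF C.module_axioms C.module_axioms C.component_hom] by simp
    then show ?thesis
      using comp_homotopy[OF ZC[OF z], of i] C.component_homog[of z "i + 1" "i + 1"] z
        d_closed[OF gc(1)[OF ZC[OF z]]] by (simp add: g_def)
  qed
  let ?f = "\<lambda>z. g z \<otimes>\<^sub>T \<theta>"
  have fhom: "?f \<in> module_hom R C T" by (rule module_hom_comp[OF ghom pure_hom_left[OF \<theta>]])
  have kill: "(s \<odot>\<^bsub>C\<^esub> x) \<otimes>\<^sub>T \<theta> = \<zero>\<^bsub>T\<^esub>" if "x \<in> carrier C" for x
    using that s \<theta> s\<theta> pure_smult_left[of s x \<theta>] pure_smult_right[of s x \<theta>]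
      module_hom_zero[OF N.module_axioms T.module_axioms pure_hom_right[OF that]] by simp
  have fZ: "?f z \<in> ?ZT" if z: "z \<in> ?Z" for z
  proof -
    have "compT i (?f z) = ?f z"
      using gc[OF ZC[OF z]] \<theta> by (simp add: compT_pure C.component_homog)
    then have "?f z \<in> homogT i" using compT_mem[of "?f z" i] gc[OF ZC[OF z]] \<theta> by simp
    moreover have "dT (?f z) = \<zero>\<^bsub>T\<^esub>"
      using dT_pure[OF gc(1)[OF ZC[OF z]] \<theta>] dg[OF z] kill[OF ZC[OF z]] by simp
    ultimately show ?thesis by simp
  qed
  have f: "?f \<in> module_hom R (C\<lparr>carrier := ?Z\<rparr>) (T\<lparr>carrier := ?ZT\<rparr>)"
    using fZ module_hom_add[OF fhom] module_hom_smult[OF fhom] ZC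
    by (intro module_homI) simp_all
  have ga: "dT (g z \<otimes>\<^sub>T y) = z \<otimes>\<^sub>T e" if z: "z \<in> ?Z" and y: "y \<in> carrier N" "s \<odot>\<^bsub>N\<^esub> y = e" for z y
    using dT_pure[OF gc(1)[OF ZC[OF z]] y(1)] dg[OF z]
      pure_smult_left[OF s ZC[OF z] y(1)] pure_smult_right[OF s ZC[OF z] y(1)] y(2) by simp
  have f_split: "?f z = g z \<otimes>\<^sub>T a \<ominus>\<^bsub>T\<^esub> g z \<otimes>\<^sub>T b" if "z \<in> carrier C" for z
    unfolding \<theta>_def using module_hom_minus[OF N.module_axioms T.module_axioms pure_hom_right[OF gc(1)[OF that]] abN] .
  have c: "t \<in> carrier T" if "t \<in> sub_tensor P \<or> t \<in> sub_tensor Q" for t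
    using that T.submoduleE(1)[OF sub_tensor_submodule[OF PN]] T.submoduleE(1)[OF sub_tensor_submodule[OF QN]]
    by auto
  have inj: "?f z \<in> ?BT \<longleftrightarrow> z \<in> ?B" if z: "z \<in> ?Z" for z
  proof
    assume "z \<in> ?B"
    then obtain w where w: "w \<in> homog C i" "z = d w" by auto
    have wc: "w \<in> carrier C" using w C.homog_closed by auto
    let ?v = "proj (i - 1) (h w)"
    have vc: "?v \<in> carrier C" "?v \<in> homog C (i - 1)"
      using C.component_mem[OF hc[OF wc]] C.homog_closed by auto
    have "d ?v \<oplus>\<^bsub>C\<^esub> g z = s \<odot>\<^bsub>C\<^esub> w"
      using comp_homotopy[OF wc, of "i - 1"] C.component_homog[of w i i] w by (simp add: g_def)
    then have "d ?v \<otimes>\<^sub>T \<theta> \<oplus>\<^bsub>T\<^esub> ?f z = \<zero>\<^bsub>T\<^esub>"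
      using kill[OF wc] pure_add_left[OF d_closed[OF vc(1)] gc(1)[OF ZC[OF z]] \<theta>] by simp
    then have "\<ominus>\<^bsub>T\<^esub> ?f z = d ?v \<otimes>\<^sub>T \<theta>"
      using d_closed[OF vc(1)] gc(1)[OF ZC[OF z]] \<theta> by (intro T.M.minus_equality) simp_all
    also have "\<dots> = dT (?v \<otimes>\<^sub>T \<theta>)" using dT_pure[OF vc(1) \<theta>] by simp
    finally have "?f z = dT (\<ominus>\<^bsub>T\<^esub> (?v \<otimes>\<^sub>T \<theta>))"
      using module_hom_uminus[OF T.module_axioms T.module_axioms dT_hom, of "?v \<otimes>\<^sub>T \<theta>"] vc(1) \<theta>
        gc(1)[OF ZC[OF z]] T.M.minus_minus[of "?f z"] by simp
    moreover have "?v \<otimes>\<^sub>T \<theta> \<in> homogT (i - 1)"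
      unfolding homogT_def using vc \<theta> by (intro T.span_mem) auto
    ultimately show "?f z \<in> ?BT" using T.submoduleE(3)[OF homogT_submodule] by blast
  next
    assume "?f z \<in> ?BT"
    then obtain y where y: "y \<in> homogT (i - 1)" "?f z = dT y" by auto
    \<comment> \<open>Splitting a primitive \<open>y\<close> as \<open>y1 + y2\<close> makes \<open>g z \<otimes> a - d y1\<close> equal to \<open>g z \<otimes> b + d y2\<close>.  This element
      of both halves comes from some \<open>w\<close> in \<open>C\<close>, and \<open>d w = z\<close>.\<close>
    obtain y1 y2 where y12: "y1 \<in> sub_tensor P" "y2 \<in> sub_tensor Q" "y = y1 \<oplus>\<^bsub>T\<^esub> y2"
      using sub_tensor_sum[OF PN QN split homogT_closed[OF y(1)]] by blast
    have yc: "y1 \<in> carrier T" "y2 \<in> carrier T" using y12 c by auto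
    let ?u = "g z \<otimes>\<^sub>T a" and ?v = "g z \<otimes>\<^sub>T b"
    have uv: "?u \<in> carrier T" "?v \<in> carrier T" using gc(1)[OF ZC[OF z]] abN by auto
    have "?u \<ominus>\<^bsub>T\<^esub> ?v = dT y1 \<oplus>\<^bsub>T\<^esub> dT y2"
      using f_split[OF ZC[OF z]] y(2) y12(3) module_hom_add[OF dT_hom yc] by simp
    then have "(?u \<ominus>\<^bsub>T\<^esub> ?v) \<oplus>\<^bsub>T\<^esub> (?v \<ominus>\<^bsub>T\<^esub> dT y1) = (dT y1 \<oplus>\<^bsub>T\<^esub> dT y2) \<oplus>\<^bsub>T\<^esub> (?v \<ominus>\<^bsub>T\<^esub> dT y1)"
      by simp
    moreover have "(?u \<ominus>\<^bsub>T\<^esub> ?v) \<oplus>\<^bsub>T\<^esub> (?v \<ominus>\<^bsub>T\<^esub> dT y1) = ?u \<ominus>\<^bsub>T\<^esub> dT y1"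
    proof -
      have "(?u \<oplus>\<^bsub>T\<^esub> \<ominus>\<^bsub>T\<^esub> ?v) \<oplus>\<^bsub>T\<^esub> (?v \<oplus>\<^bsub>T\<^esub> \<ominus>\<^bsub>T\<^esub> dT y1) = ?u \<oplus>\<^bsub>T\<^esub> ((\<ominus>\<^bsub>T\<^esub> ?v \<oplus>\<^bsub>T\<^esub> ?v) \<oplus>\<^bsub>T\<^esub> \<ominus>\<^bsub>T\<^esub> dT y1)"
        using uv dT_closed[OF yc(1)] by (simp add: T.M.a_assoc)
      then show ?thesis using uv dT_closed[OF yc(1)] by (simp add: T.minus_eq T.M.l_neg)
    qed
    moreover have "(dT y1 \<oplus>\<^bsub>T\<^esub> dT y2) \<oplus>\<^bsub>T\<^esub> (?v \<ominus>\<^bsub>T\<^esub> dT y1) = ?v \<oplus>\<^bsub>T\<^esub> dT y2"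
    proof -
      have "(dT y1 \<oplus>\<^bsub>T\<^esub> dT y2) \<oplus>\<^bsub>T\<^esub> (?v \<oplus>\<^bsub>T\<^esub> \<ominus>\<^bsub>T\<^esub> dT y1) = (dT y1 \<oplus>\<^bsub>T\<^esub> \<ominus>\<^bsub>T\<^esub> dT y1) \<oplus>\<^bsub>T\<^esub> (?v \<oplus>\<^bsub>T\<^esub> dT y2)"
        using uv dT_closed yc by (simp add: T.M.add.m_ac)
      then show ?thesis using uv dT_closed yc by (simp add: T.minus_eq T.M.r_neg)
    qed
    ultimately have eq: "?u \<ominus>\<^bsub>T\<^esub> dT y1 = ?v \<oplus>\<^bsub>T\<^esub> dT y2" by simp
    have "?u \<ominus>\<^bsub>T\<^esub> dT y1 \<in> sub_tensor P"
      using T.submodule_minus[OF sub_tensor_submodule[OF PN]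
          pure_in_sub_tensor[OF gc(1)[OF ZC[OF z]] a(1)] sub_tensor_map[OF PN d_hom y12(1)]] .
    moreover have "?u \<ominus>\<^bsub>T\<^esub> dT y1 \<in> sub_tensor Q"
      unfolding eq using T.submoduleE(5)[OF sub_tensor_submodule[OF QN]
          pure_in_sub_tensor[OF gc(1)[OF ZC[OF z]] b(1)] sub_tensor_map[OF QN d_hom y12(2)]] .
    ultimately obtain w where w: "w \<in> carrier C" "?u \<ominus>\<^bsub>T\<^esub> dT y1 = w \<otimes>\<^sub>T e"
      by (rule sub_tensor_Int)
    have "d w \<otimes>\<^sub>T e = dT (?u \<ominus>\<^bsub>T\<^esub> dT y1)" using w dT_pure[OF w(1) eN] by simp
    also have "\<dots> = z \<otimes>\<^sub>T e"
      using module_hom_minus[OF T.module_axioms T.module_axioms dT_hom uv(1) dT_closed[OF yc(1)]]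
        T.minus_zero_right[OF pure_closed[OF ZC[OF z] eN]]
      unfolding ga[OF z abN(1) a(2)] dT_square[OF yc(1)] by simp
    finally have "(d w \<ominus>\<^bsub>C\<^esub> z) \<otimes>\<^sub>T e = \<zero>\<^bsub>T\<^esub>"
      using module_hom_minus[OF C.module_axioms T.module_axioms pure_hom_left[OF eN] d_closed[OF w(1)] ZC[OF z]]
        ZC[OF z] eN by (simp add: T.minus_eq T.M.r_neg)
    then have "d w \<ominus>\<^bsub>C\<^esub> z = \<zero>\<^bsub>C\<^esub>" using tensor_unit_inj d_closed[OF w(1)] ZC[OF z] by simp
    then have "d w = z" using C.minus_eq_zero_iff d_closed[OF w(1)] ZC[OF z] by blast
    then have "d (proj i w) = z"
      using C.component_differential[OF w(1), of i] C.component_homog[of z "i + 1" "i + 1"] z by simp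
    then show "z \<in> ?B" using C.component_mem[OF w(1)] by blast
  qed
  have surj: "\<exists>z\<in>?Z. \<exists>k\<in>?BT. y = k \<oplus>\<^bsub>T\<^esub> ?f z" if y: "y \<in> ?ZT" for y
  proof -
    have yT: "y \<in> carrier T" using y homogT_closed by auto
    \<comment> \<open>Splitting the cocycle \<open>y\<close> as \<open>y1 + y2\<close> makes \<open>d y1 = - d y2\<close> an element \<open>z \<otimes> e\<close> of both halves.  Then
      \<open>y1 - g z \<otimes> a\<close> and \<open>y2 + g z \<otimes> b\<close> are cocycles of the halves, so they are coboundaries.\<close>
    obtain x1 x2 where x12: "x1 \<in> sub_tensor P" "x2 \<in> sub_tensor Q" "y = x1 \<oplus>\<^bsub>T\<^esub> x2"
      using sub_tensor_sum[OF PN QN split yT] by blast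
    define y1 y2 where "y1 = compT i x1" and "y2 = compT i x2"
    have y12: "y1 \<in> sub_tensor P" "y2 \<in> sub_tensor Q"
      unfolding y1_def y2_def
      using sub_tensor_map[OF PN C.component_hom x12(1)] sub_tensor_map[OF QN C.component_hom x12(2)] .
    have y1i: "y1 \<in> homogT i" unfolding y1_def using x12 c by (intro compT_mem) auto
    have yc: "y1 \<in> carrier T" "y2 \<in> carrier T" using y12 c by auto
    have y_eq: "y = y1 \<oplus>\<^bsub>T\<^esub> y2"
      using compT_homogT[of y i] y x12 c module_hom_add[OF compT_hom, of x1 x2 i]
      by (simp add: y1_def y2_def)
    have dsum: "dT y1 \<oplus>\<^bsub>T\<^esub> dT y2 = \<zero>\<^bsub>T\<^esub>" using module_hom_add[OF dT_hom yc] y_eq y by simp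
    have neg: "\<ominus>\<^bsub>T\<^esub> dT y2 = dT y1"
      using dsum dT_closed yc by (intro T.M.minus_equality) simp_all
    have "dT y1 \<in> sub_tensor P" using sub_tensor_map[OF PN d_hom y12(1)] .
    moreover have "dT y1 \<in> sub_tensor Q"
      unfolding neg[symmetric]
      using T.submoduleE(3)[OF sub_tensor_submodule[OF QN] sub_tensor_map[OF QN d_hom y12(2)]] .
    ultimately obtain z where z: "z \<in> carrier C" "dT y1 = z \<otimes>\<^sub>T e" by (rule sub_tensor_Int)
    have zero_of: "x = x'" if "x \<in> carrier C" "x' \<in> carrier C" "x \<otimes>\<^sub>T e = x' \<otimes>\<^sub>T e" for x x'
    proof -
      have "(x \<ominus>\<^bsub>C\<^esub> x') \<otimes>\<^sub>T e = \<zero>\<^bsub>T\<^esub>"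
        using module_hom_minus[OF C.module_axioms T.module_axioms pure_hom_left[OF eN] that(1,2)] that eN
        by (simp add: T.minus_eq T.M.r_neg)
      then have "x \<ominus>\<^bsub>C\<^esub> x' = \<zero>\<^bsub>C\<^esub>" using tensor_unit_inj that by simp
      then show ?thesis using C.minus_eq_zero_iff that by blast
    qed
    have "proj (i + 1) z \<otimes>\<^sub>T e = z \<otimes>\<^sub>T e"
      using compT_pure[OF z(1) eN, of "i + 1"] compT_dT[OF yc(1), of i] compT_homogT[OF y1i] z(2) by simp
    then have "proj (i + 1) z = z" by (rule zero_of[OF comp_closed[OF z(1)] z(1)])
    then have zi: "z \<in> homog C (i + 1)" using C.component_mem[OF z(1), of "i + 1"] by metis
    have "d z \<otimes>\<^sub>T e = \<zero>\<^bsub>T\<^esub>" using dT_square[OF yc(1)] z dT_pure[OF z(1) eN] by simp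
    then have zZ: "z \<in> ?Z" using tensor_unit_inj[OF d_closed[OF z(1)]] zi by simp
    let ?u = "g z \<otimes>\<^sub>T a" and ?v = "g z \<otimes>\<^sub>T b"
    have uv: "?u \<in> carrier T" "?v \<in> carrier T" using gc(1)[OF z(1)] abN by auto
    have "dT (y1 \<ominus>\<^bsub>T\<^esub> ?u) = \<zero>\<^bsub>T\<^esub>"
      using module_hom_minus[OF T.module_axioms T.module_axioms dT_hom yc(1) uv(1)]
        ga[OF zZ abN(1) a(2)] z eN by (simp add: T.minus_eq T.M.r_neg)
    then obtain w1 where w1: "w1 \<in> carrier T" "y1 \<ominus>\<^bsub>T\<^esub> ?u = dT w1"
      using sub_tensor_acyclic[OF P bij(1) T.submodule_minus[OF sub_tensor_submodule[OF PN] y12(1)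
            pure_in_sub_tensor[OF gc(1)[OF z(1)] a(1)]]] by blast
    have "dT (y2 \<oplus>\<^bsub>T\<^esub> ?v) = \<zero>\<^bsub>T\<^esub>"
      using module_hom_add[OF dT_hom yc(2) uv(2)] ga[OF zZ abN(2) b(2)] z(2) dsum
        T.M.a_comm[OF dT_closed[OF yc(1)] dT_closed[OF yc(2)]] by simp
    then obtain w2 where w2: "w2 \<in> carrier T" "y2 \<oplus>\<^bsub>T\<^esub> ?v = dT w2"
      using sub_tensor_acyclic[OF Q bij(2) T.submoduleE(5)[OF sub_tensor_submodule[OF QN] y12(2)
            pure_in_sub_tensor[OF gc(1)[OF z(1)] b(1)]]] by blast
    have "dT (w1 \<oplus>\<^bsub>T\<^esub> w2) \<oplus>\<^bsub>T\<^esub> ?f z = (y1 \<ominus>\<^bsub>T\<^esub> ?u) \<oplus>\<^bsub>T\<^esub> (y2 \<oplus>\<^bsub>T\<^esub> ?v) \<oplus>\<^bsub>T\<^esub> (?u \<ominus>\<^bsub>T\<^esub> ?v)"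
      using module_hom_add[OF dT_hom w1(1) w2(1)] w1(2) w2(2) f_split[OF z(1)] by simp
    also have "\<dots> = y" using T.telescope[OF yc uv] y_eq by simp
    finally have y2: "y = dT (w1 \<oplus>\<^bsub>T\<^esub> w2) \<oplus>\<^bsub>T\<^esub> ?f z" by simp
    \<comment> \<open>The primitives of these cocycles need not be homogeneous; the component of degree \<open>i - 1\<close> serves.\<close>
    define w where "w = compT (i - 1) (w1 \<oplus>\<^bsub>T\<^esub> w2)"
    have ww: "w1 \<oplus>\<^bsub>T\<^esub> w2 \<in> carrier T" using w1 w2 by simp
    have "w \<in> homogT (i - 1)" unfolding w_def by (rule compT_mem[OF ww])
    moreover have "y = dT w \<oplus>\<^bsub>T\<^esub> ?f z"
    proof -
      have fz: "?f z \<in> homogT i" using fZ[OF zZ] by simp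
      have "y = compT i (dT (w1 \<oplus>\<^bsub>T\<^esub> w2) \<oplus>\<^bsub>T\<^esub> ?f z)" using compT_homogT[of y i] y y2 by simp
      also have "\<dots> = compT i (dT (w1 \<oplus>\<^bsub>T\<^esub> w2)) \<oplus>\<^bsub>T\<^esub> ?f z"
        using module_hom_add[OF compT_hom dT_closed[OF ww] homogT_closed[OF fz], of i] compT_homogT[OF fz] by simp
      also have "compT i (dT (w1 \<oplus>\<^bsub>T\<^esub> w2)) = dT w" using compT_dT[OF ww, of "i - 1"] by (simp add: w_def)
      finally show ?thesis .
    qed
    ultimately show ?thesis using zZ by blast
  qed
  show ?thesis
    by (rule module.quotients_isomorphic[OF Zm Bs ZTm BTs f]) (use inj surj in auto)
qed

end

section \<open>The degree shift\<close>

theorem theorem1: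
  fixes A :: "('a, 'm) ring_scheme"
    and C :: "(int \<Rightarrow> 'a, 'c) cochain_complex"
  assumes "cring A"
    and "well_filtered A C"
  shows "\<forall>i::int. modules_isomorphic (laurent_ring A)
           (cohomology C (i + 1))
           (cohomology (tensor_complex (laurent_ring A) C (biinfinite_series A)) i)"
proof
  fix i :: int
  interpret coefficients A using assms(1) by (rule coefficients.intro)
  obtain s h where s: "half_invertible s" and h: "scalar_homotopy L C (differential C) s h"
    using well_filtered_scalar_homotopy[OF assms(2)] by blast
  have C: "graded_complex L C" and free: "free_finitely_generated L C"
    using assms(2) by (auto elim: well_filtered.cases)
  have Cm: "module L C" using graded_complex.axioms(1)[OF C] .
  interpret split_coefficients L C Series s h below above "\<one>\<^bsub>L\<^esub>"
  proof (intro split_coefficients.intro split_coefficients_axioms.intro tensor_pair.intro)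
    show "graded_complex L C" "module L C" "module L Series" "free_finitely_generated L C"
      "scalar_homotopy L C (differential C) s h" "submodule below L Series" "submodule above L Series"
      using C Cm series_module free h below_submodule above_submodule by auto
    show "s \<in> carrier L" "bij_betw (\<lambda>y. s \<odot>\<^bsub>Series\<^esub> y) below below"
      "bij_betw (\<lambda>y. s \<odot>\<^bsub>Series\<^esub> y) above above"
      using s by (simp_all add: half_invertible_def)
    show "\<exists>a\<in>below. \<exists>b\<in>above. y = a \<oplus>\<^bsub>Series\<^esub> b" if "y \<in> carrier Series" for y
      using series_split[OF that] by metis
    show "\<one>\<^bsub>L\<^esub> \<in> below" "\<one>\<^bsub>L\<^esub> \<in> above" using below_Int_above L.one_closed by blast+
    have r: "r \<odot>\<^bsub>Series\<^esub> \<one>\<^bsub>L\<^esub> = r" if "r \<in> carrier L" for r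
      using L.r_one[OF that] by simp
    show "\<exists>r\<in>carrier L. y = r \<odot>\<^bsub>Series\<^esub> \<one>\<^bsub>L\<^esub>" if "y \<in> below" "y \<in> above" for y
      using r below_Int_above that by (metis IntI)
    show "r = \<zero>\<^bsub>L\<^esub>" if "r \<in> carrier L" "r \<odot>\<^bsub>Series\<^esub> \<one>\<^bsub>L\<^esub> = \<zero>\<^bsub>Series\<^esub>" for r
      using r that by simp
  qed
  have "cohomology (tensor_complex L C Series) i =
    quotient_module (T\<lparr>carrier := {t \<in> homogT i. dT t = \<zero>\<^bsub>T\<^esub>}\<rparr>) (dT ` homogT (i - 1))"
    unfolding cohomology_def tensor_complex_def homogT_def quotient_module_def
    by (simp add: module.defs cochain_complex.defs A_RCOSETS_def' a_r_coset_def' set_add_def' fun_eq_iff)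
  then show "modules_isomorphic L (cohomology C (i + 1)) (cohomology (tensor_complex L C Series) i)"
    using cohomology_shift[of i] by (simp add: cohomology_def)
qed

end
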